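(* Let $\sigma\ge1$, $\Upsilon\ge1$, $l>1$, $0<\varepsilon<1$ and $\mu>0$. Let $H:\mathbb{T}^n\times B_1\times\mathbb{R}\to\mathbb{R}$ be a Hamiltonian of the form $$H(q,p,t)=h(p)+R(q,p)+f(q,p,t)$$ such that: (i) $f,\ \partial_pf\in\bar{\mathcal{D}}_{\sigma,2}$ (with $A=B_1$); (ii) $|f|_{\sigma+2,0,L(B_1)}+\|\partial_qf\|_{\sigma,1,l+2,L(B_1)}+\|\partial_pf\|_{\sigma,2,l+1,L(B_1)}<\varepsilon$; (iii) $D\subset B_1$ is a set with $\mathrm{Leb}(B_1\setminus D)<\mu$; (iv) $R\in C^2(\mathbb{T}^n\times B_1)$ and $R(q,p)=\partial_pR(q,p)=0$ for all $(q,p)\in\mathbb{T}^n\times D$; (v) $\partial_p^2H^t\in C^{\sigma+2}(\mathbb{T}^n\times B_1)$ for every fixed $t\in\mathbb{R}$, and all partial derivatives $\partial^i_{qp}(\partial_p^2H)$ of order $i$ with respect to $(q,p)$, $0\le i\le2$, belong to $C(\mathbb{T}^n\times B_1\times\mathbb{R})$; (vi) $\sup_{t\in\mathbb{R}}|\partial_p^2H^t|_{C^{\sigma+2}}\le\Upsilon$. For $p\in B_1$ let $\varphi_{0,p}:\mathbb{T}^n\to\mathbb{T}^n\times B_1$, $\varphi_{0,p}(q)=(q,p)$. Then there exists a time-dependent Hamiltonian $\tilde h$ on $\mathbb{T}^n\times B_1\times\mathbb{R}$ such that, for $\varepsilon$ small enough with respect to $n$, $l$, $\Upsilon$, $|\partial_ph|_{L(D)}$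 and $\mu$, there exists a set $\mathcal{W}\subset\mathbb{T}^n\times B_1$ such that for all $(q,p)\in\mathcal{W}$ there exist $p_-,p_+\in D$ and a biasymptotically quasiperiodic solution $g$ associated to $(X_H,X_{\tilde h},\varphi_{0,p_\pm})$ with $g(0)=(q,p)$. Moreover, $$\mathrm{Leb}\big((\mathbb{T}^n\times B_1)\setminus\mathcal{W}\big)\le4\mu.$$
   Context: Notation. $\mathbb{T}^n=\mathbb{R}^n/\mathbb{Z}^n$ (so that $\mathrm{Leb}(\mathbb{T}^n)=1$), $B_r\subset\mathbb{R}^n$ is the ball of radius $r$ centred at the origin, and $\mathrm{Leb}$ is Lebesgue measure. For a function $f(q,p,t)$, $f^t(q,p)=f(q,p,t)$ and $f^t_p(q)=f(q,p,t)$. For a time-dependent Hamiltonian $H(q,p,t)$, $X_H=(\partial_pH,-\partial_qH)$. Hölder norms. For an integer $k\ge0$, $|f|_{C^k}=\sup_{|\alpha|\le k}|\partial^\alpha f|_{C^0}$, where $|\cdot|_{C^0}$ is the sup norm. For $\sigma=k+\nu$ with $0<\nu<1$, $|f|_{C^\sigma}=\sup_{|\alpha|\le k}|\partial^\alpha f|_{C^0}+\sup_{|\alpha|=k}\sup_{x\ne y}\frac{|\partial^\alpha f(x)-\partial^\alpha f(y)|}{|x-y|^\nu}$, and $C^\sigma$ is the space of $C^k$ functions with $|f|_{C^\sigma}<\infty$. Lipschitz norms. For $A\subset\mathbb{R}^n$, $E$ equal to $\mathbb{T}^n$ or $\mathbb{T}^n\times B$ ($B$ a ball), and $f:E\times A\to\mathbb{R}$,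 $$|f|_{L(A)}=\sup_{z\in E}\Big(\sup_{x,y\in A,\,x\ne y}\frac{|f(z,x)-f(z,y)|}{|x-y|}\Big)+|f|_{C^0}.$$ If $f$ depends only on the variable in $A$, $|f|_{L(A)}$ is its Lipschitz constant on $A$ plus its sup norm on $A$. Function spaces. For $\sigma\ge1$, $\mathcal{D}_\sigma$ is the space of functions $f$ on $\mathbb{T}^n\times A\times\mathbb{R}$ such that $f\in C(\mathbb{T}^n\times A\times\mathbb{R})$ and $f^t_p\in C^\sigma(\mathbb{T}^n)$ for all $(p,t)\in A\times\mathbb{R}$. For $l\ge1$, $$|f|_{\sigma,l,L(A)}=\sup_{(p,t)\in A\times\mathbb{R}}|f^t_p|_{C^\sigma}(1+|t|^l)+\sup_{t\in\mathbb{R}}|f^t|_{L(A)}(1+|t|^{l-1}),$$ $$|f|_{\sigma,0,L(A)}=\sup_{(p,t)\in A\times\mathbb{R}}|f^t_p|_{C^\sigma}+\sup_{t\in\mathbb{R}}|f^t|_{L(A)}.$$ For an integer $k\ge0$, $\bar{\mathcal{D}}_{\sigma,k}$ is the space of $f$ with $\partial_q^if\in\mathcal{D}_{\sigma+k-i}$ for all $0\le i\le k$ ($\partial_q^i$ denotes all partial derivatives of order $i$ in $q$, $\partial_q^0f=f$), and for $l>1$, $\|f\|_{\sigma,k,l,L(A)}=\max_{0\le i\le k}|\partial_q^if|_{\sigma+k-i,l,L(A)}$. For vector-valued functions these are understood componentwise. Biasymptotically quasiperiodic solutions. Let $X^t,X^t_{0,+},X^t_{0,-}$ be time-dependent vector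 fields of class $C^{\sigma+k}$ on $\mathbb{T}^n\times B$ ($\sigma\ge0$ real, $k\ge0$ integer) for all $t\in\mathbb{R}$, and $\varphi_{0,\pm}:\mathbb{T}^n\to\mathbb{T}^n\times B$ embeddings of class $C^\sigma$ such that, for some $\omega_\pm\in\mathbb{R}^n$, $$\lim_{t\to\pm\infty}|X^t-X^t_{0,\pm}|_{C^{\sigma+k}}=0,\qquad X_{0,\pm}(\varphi_{0,\pm}(q),t)=\partial_q\varphi_{0,\pm}(q)\,\omega_\pm\ \text{ for all }(q,t)\in\mathbb{T}^n\times\mathbb{R}.$$ An integral curve $g(t)$ of $X$ is a biasymptotically quasiperiodic solution associated to $(X,X_{0,\pm},\varphi_{0,\pm})$ if there exist $q_-,q_+\in\mathbb{T}^n$ such that $\lim_{t\to\pm\infty}|g(t)-\varphi_{0,\pm}(q_\pm+\omega_\pm t)|=0$. In the claim, $X=X_H$, $X_{0,+}=X_{0,-}=X_{\tilde h}$, $\varphi_{0,\pm}=\varphi_{0,p_\pm}$ (with the given $\sigma$ and some integer $k\ge0$); being associated to this triple includes that the two displayed conditions hold for some $\omega_\pm$. "Small enough with respect to" the listed quantities means $\varepsilon\le\varepsilon_0$ for some threshold $\varepsilon_0>0$ depending on them, the regularity $\sigma$ being fixed from the outset. *)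

theory Defs
  imports "HOL-Analysis.Analysis"
begin

text \<open>
  Throughout, the torus \<open>\<real>\<^sup>n/\<int>\<^sup>n\<close> is handled through its universal cover: points of the torus are
  given by representatives in \<open>real^'n\<close>, functions on the torus are \<open>\<int>\<^sup>n\<close>-periodic functions on
  \<open>real^'n\<close>, and subsets of the torus are \<open>\<int>\<^sup>n\<close>-invariant subsets of \<open>real^'n\<close>. Functions on
  \<open>\<real>\<^sup>n/\<int>\<^sup>n \<times> A\<close> are total functions of which only the values over \<open>A\<close> matter.
\<close>

type_synonym 'n phase = "(real^'n) \<times> (real^'n)"

type_synonym 'n observable = "real^'n \<Rightarrow> real^'n \<Rightarrow> real \<Rightarrow> real"

definition lattice_vecs :: "(real^'n) set" where
  "lattice_vecs = {m. \<forall>i. m $ i \<in> \<int>}"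

definition q_periodic :: "(real^'n) set \<Rightarrow> (real^'n \<Rightarrow> real^'n \<Rightarrow> 'b) \<Rightarrow> bool" where
  "q_periodic A F \<longleftrightarrow> (\<forall>q. \<forall>p\<in>A. \<forall>m\<in>lattice_vecs. F (q + m) p = F q p)"

text \<open>Partial derivatives. A multi-index \<open>\<alpha>\<close> is encoded by a list of basis vectors of length
  \<open>|\<alpha>|\<close>; for functions of class \<open>C\<^sup>k\<close> the order of the list is irrelevant.\<close>

definition has_partial :: "'a::euclidean_space \<Rightarrow> ('a \<Rightarrow> real) \<Rightarrow> 'a \<Rightarrow> bool" where
  "has_partial b f x \<longleftrightarrow> (\<lambda>s::real. f (x + s *\<^sub>R b)) field_differentiable at 0"

definition partial :: "'a::euclidean_space \<Rightarrow> ('a \<Rightarrow> real) \<Rightarrow> 'a \<Rightarrow> real" where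
  "partial b f x = deriv (\<lambda>s::real. f (x + s *\<^sub>R b)) 0"

primrec partials :: "'a::euclidean_space list \<Rightarrow> ('a \<Rightarrow> real) \<Rightarrow> 'a \<Rightarrow> real" where
  "partials [] f = f"
| "partials (b # bs) f = partial b (partials bs f)"

definition multi_indices :: "nat \<Rightarrow> 'a::euclidean_space list set" where
  "multi_indices k = {bs. set bs \<subseteq> Basis \<and> length bs = k}"

definition Ck_on :: "nat \<Rightarrow> 'a::euclidean_space set \<Rightarrow> ('a \<Rightarrow> real) \<Rightarrow> bool" where
  "Ck_on k S f \<longleftrightarrow>
     (\<forall>i<k. \<forall>bs\<in>multi_indices i. \<forall>b\<in>Basis. \<forall>x\<in>S. has_partial b (partials bs f) x) \<and>
     (\<forall>i\<le>k. \<forall>bs\<in>multi_indices i. continuous_on S (partials bs f))"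

text \<open>For periodic functions the Hoelder quotients over all pairs of representatives have the same
  supremum as those formed with the distance of the torus: the latter is the minimum of the former
  distances. Norms take values in \<^typ>\<open>ennreal\<close>, where an empty supremum is 0.\<close>

definition hoelder_norm :: "real \<Rightarrow> 'a::euclidean_space set \<Rightarrow> ('a \<Rightarrow> real) \<Rightarrow> ennreal" where
  "hoelder_norm \<sigma> S f =
     (SUP i\<in>{..nat \<lfloor>\<sigma>\<rfloor>}. SUP bs\<in>multi_indices i. SUP x\<in>S. ennreal \<bar>partials bs f x\<bar>) +
     (if \<sigma> \<in> \<int> then 0
      else SUP bs\<in>multi_indices (nat \<lfloor>\<sigma>\<rfloor>). SUP x\<in>S. SUP y\<in>S - {x}.
             ennreal (\<bar>partials bs f x - partials bs f y\<bar> / dist x y powr frac \<sigma>))"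

definition C_sigma :: "real \<Rightarrow> 'a::euclidean_space set \<Rightarrow> ('a \<Rightarrow> real) \<Rightarrow> bool" where
  "C_sigma \<sigma> S f \<longleftrightarrow> Ck_on (nat \<lfloor>\<sigma>\<rfloor>) S f \<and> (\<sigma> \<notin> \<int> \<longrightarrow> hoelder_norm \<sigma> S f < \<infinity>)"

definition lip_norm :: "'z set \<Rightarrow> 'a::metric_space set \<Rightarrow> ('z \<Rightarrow> 'a \<Rightarrow> real) \<Rightarrow> ennreal" where
  "lip_norm E A F =
     (SUP z\<in>E. SUP x\<in>A. SUP y\<in>A - {x}. ennreal (\<bar>F z x - F z y\<bar> / dist x y)) +
     (SUP z\<in>E. SUP x\<in>A. ennreal \<bar>F z x\<bar>)"

definition dq :: "(real^'n) list \<Rightarrow> 'n observable \<Rightarrow> 'n observable" where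
  "dq bs f = (\<lambda>q p t. partials bs (\<lambda>q'. f q' p t) q)"

definition dp :: "(real^'n) list \<Rightarrow> 'n observable \<Rightarrow> 'n observable" where
  "dp bs f = (\<lambda>q p t. partials bs (\<lambda>p'. f q p' t) p)"

definition D_space :: "real \<Rightarrow> (real^'n) set \<Rightarrow> 'n observable set" where
  "D_space \<sigma> A = {f. q_periodic A f \<and>
     continuous_on (UNIV \<times> A \<times> UNIV) (\<lambda>(q, p, t). f q p t) \<and>
     (\<forall>p\<in>A. \<forall>t. C_sigma \<sigma> UNIV (\<lambda>q. f q p t))}"

text \<open>The exponent \<open>l\<close> is either 0 or at least 1. At \<open>l = 1\<close>, \<open>t = 0\<close> the term \<open>\<bar>t\<bar> powr (l - 1)\<close>
  would be 0 instead of 1; the norm is only used with \<open>l = 0\<close> and \<open>l > 2\<close>.\<close>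

definition D_norm :: "real \<Rightarrow> real \<Rightarrow> (real^'n) set \<Rightarrow> 'n observable \<Rightarrow> ennreal" where
  "D_norm \<sigma> l A f =
     (if l = 0 then
        (SUP p\<in>A. SUP t. hoelder_norm \<sigma> UNIV (\<lambda>q. f q p t)) +
        (SUP t. lip_norm UNIV A (\<lambda>q p. f q p t))
      else
        (SUP p\<in>A. SUP t. hoelder_norm \<sigma> UNIV (\<lambda>q. f q p t) * ennreal (1 + \<bar>t\<bar> powr l)) +
        (SUP t. lip_norm UNIV A (\<lambda>q p. f q p t) * ennreal (1 + \<bar>t\<bar> powr (l - 1))))"

definition D_bar_space :: "real \<Rightarrow> nat \<Rightarrow> (real^'n) set \<Rightarrow> 'n observable set" where
  "D_bar_space \<sigma> k A =
     {f. \<forall>i\<le>k. \<forall>bs\<in>multi_indices i. dq bs f \<in> D_space (\<sigma> + real (k - i)) A}"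

definition D_bar_norm :: "real \<Rightarrow> nat \<Rightarrow> real \<Rightarrow> (real^'n) set \<Rightarrow> 'n observable \<Rightarrow> ennreal" where
  "D_bar_norm \<sigma> k l A f =
     (SUP i\<in>{..k}. SUP bs\<in>multi_indices i. D_norm (\<sigma> + real (k - i)) l A (dq bs f))"

definition hamiltonian_on :: "(real^'n) set \<Rightarrow> 'n observable \<Rightarrow> bool" where
  "hamiltonian_on B H \<longleftrightarrow> q_periodic B H \<and>
     continuous_on (UNIV \<times> B \<times> UNIV) (\<lambda>(q, p, t). H q p t) \<and>
     (\<forall>t. Ck_on 1 (UNIV \<times> B) (\<lambda>(q, p). H q p t))"

definition ham_field :: "'n::finite observable \<Rightarrow> 'n phase \<Rightarrow> real \<Rightarrow> 'n phase" where
  "ham_field H = (\<lambda>(q, p) t.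
     (\<chi> i. dp [axis i 1] H q p t, \<chi> i. - dq [axis i 1] H q p t))"

definition C_sigma_field :: "real \<Rightarrow> (real^'n) set \<Rightarrow> ('n phase \<Rightarrow> real \<Rightarrow> 'n phase) \<Rightarrow> bool" where
  "C_sigma_field \<sigma> B X \<longleftrightarrow> q_periodic B (\<lambda>q p. X (q, p)) \<and>
     (\<forall>t. \<forall>b\<in>Basis. C_sigma \<sigma> (UNIV \<times> B) (\<lambda>z. X z t \<bullet> b))"

definition field_norm :: "real \<Rightarrow> (real^'n) set \<Rightarrow> ('n phase \<Rightarrow> 'n phase) \<Rightarrow> ennreal" where
  "field_norm \<sigma> B Y = (SUP b\<in>Basis. hoelder_norm \<sigma> (UNIV \<times> B) (\<lambda>z. Y z \<bullet> b))"

text \<open>A map between the torus and the torus times \<open>B\<close> is given by a lift \<open>\<phi>\<close>. A lift is not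
  periodic and in general unbounded, so its regularity is required on balls of arbitrary radius.
  Injectivity is modulo the lattice; as the torus is compact, it makes \<open>\<phi>\<close> a homeomorphism onto
  its image.\<close>

definition torus_embedding :: "real \<Rightarrow> (real^'n) set \<Rightarrow> (real^'n \<Rightarrow> 'n phase) \<Rightarrow> bool" where
  "torus_embedding \<sigma> B \<phi> \<longleftrightarrow>
     (\<forall>q. snd (\<phi> q) \<in> B) \<and>
     (\<forall>q. \<forall>m\<in>lattice_vecs. \<exists>m'\<in>lattice_vecs. \<phi> (q + m) = \<phi> q + (m', 0)) \<and>
     (\<forall>q q'. (\<exists>m\<in>lattice_vecs. \<phi> q' = \<phi> q + (m, 0)) \<longrightarrow> q' - q \<in> lattice_vecs) \<and>
     (\<forall>r. \<forall>b\<in>Basis. C_sigma \<sigma> (ball 0 r) (\<lambda>q. \<phi> q \<bullet> b)) \<and>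
     (\<sigma> \<ge> 1 \<longrightarrow> (\<forall>q. inj (frechet_derivative \<phi> (at q))))"

definition torus_dist :: "'n::finite phase \<Rightarrow> 'n phase \<Rightarrow> real" where
  "torus_dist z z' = (INF m\<in>lattice_vecs. norm (z + (m, 0) - z'))"

definition integral_curve ::
  "(real^'n) set \<Rightarrow> ('n phase \<Rightarrow> real \<Rightarrow> 'n phase) \<Rightarrow> (real \<Rightarrow> 'n phase) \<Rightarrow> bool" where
  "integral_curve B X g \<longleftrightarrow>
     (\<forall>t. snd (g t) \<in> B \<and> (g has_vector_derivative X (g t) t) (at t))"

text \<open>The relation \<open>X0 (\<phi> q, t) = \<partial>\<^sub>q\<phi>(q) \<omega>\<close> is expressed through the derivative of \<open>\<phi>\<close> at \<open>q\<close> in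
  direction \<open>\<omega>\<close>.\<close>

definition quasiperiodic_on ::
  "('n::finite phase \<Rightarrow> real \<Rightarrow> 'n phase) \<Rightarrow> (real^'n \<Rightarrow> 'n phase) \<Rightarrow> real^'n \<Rightarrow> bool" where
  "quasiperiodic_on X0 \<phi> \<omega> \<longleftrightarrow>
     (\<forall>q t. ((\<lambda>s. \<phi> (q + s *\<^sub>R \<omega>)) has_vector_derivative X0 (\<phi> q) t) (at 0))"

definition biasymptotically_quasiperiodic ::
  "real \<Rightarrow> nat \<Rightarrow> (real^'n) set \<Rightarrow> ('n phase \<Rightarrow> real \<Rightarrow> 'n phase) \<Rightarrow>
   ('n phase \<Rightarrow> real \<Rightarrow> 'n phase) \<Rightarrow> ('n phase \<Rightarrow> real \<Rightarrow> 'n phase) \<Rightarrow>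
   (real^'n \<Rightarrow> 'n phase) \<Rightarrow> (real^'n \<Rightarrow> 'n phase) \<Rightarrow> (real \<Rightarrow> 'n phase) \<Rightarrow> bool" where
  "biasymptotically_quasiperiodic \<sigma> k B X Xplus Xminus \<phi>plus \<phi>minus g \<longleftrightarrow>
     C_sigma_field (\<sigma> + real k) B X \<and>
     C_sigma_field (\<sigma> + real k) B Xplus \<and>
     C_sigma_field (\<sigma> + real k) B Xminus \<and>
     torus_embedding \<sigma> B \<phi>plus \<and>
     torus_embedding \<sigma> B \<phi>minus \<and>
     ((\<lambda>t. field_norm (\<sigma> + real k) B (\<lambda>z. X z t - Xplus z t)) \<longlongrightarrow> 0) at_top \<and>
     ((\<lambda>t. field_norm (\<sigma> + real k) B (\<lambda>z. X z t - Xminus z t)) \<longlongrightarrow> 0) at_bot \<and>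
     integral_curve B X g \<and>
     (\<exists>\<omega>plus \<omega>minus qplus qminus.
        quasiperiodic_on Xplus \<phi>plus \<omega>plus \<and>
        quasiperiodic_on Xminus \<phi>minus \<omega>minus \<and>
        ((\<lambda>t. torus_dist (g t) (\<phi>plus (qplus + t *\<^sub>R \<omega>plus))) \<longlongrightarrow> 0) at_top \<and>
        ((\<lambda>t. torus_dist (g t) (\<phi>minus (qminus + t *\<^sub>R \<omega>minus))) \<longlongrightarrow> 0) at_bot)"

definition trivial_torus :: "real^'n \<Rightarrow> real^'n \<Rightarrow> 'n phase" where
  "trivial_torus p = (\<lambda>q. (q, p))"

text \<open>Measurable sets of the torus times \<open>\<real>\<^sup>n\<close> and their Lebesgue measure, computed on the
  fundamental domain \<open>[0,1)\<^sup>n\<close>.\<close>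

definition torus_measurable :: "'n::finite phase set \<Rightarrow> bool" where
  "torus_measurable S \<longleftrightarrow> S \<in> sets lebesgue \<and>
     (\<forall>q p. \<forall>m\<in>lattice_vecs. (q, p) \<in> S \<longrightarrow> (q + m, p) \<in> S)"

definition torus_leb :: "'n::finite phase set \<Rightarrow> ennreal" where
  "torus_leb S = emeasure lebesgue (S \<inter> {q. \<forall>i. 0 \<le> q $ i \<and> q $ i < 1} \<times> UNIV)"

end

theory Submission
  imports Defs
begin

text \<open>
  On \<open>\<real>\<^sup>n \<times> D\<close> the Hamiltonian \<open>htilde = h + R\<close> has the linear flow \<open>(q + t \<partial>h(p), p)\<close>. As the field of
  \<open>H\<close> differs from that of \<open>htilde\<close> by integrable terms, every \<open>(q, p)\<close> with \<open>p\<close> in a compact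
  \<open>P \<subseteq> D\<close> is the asymptotic datum at \<open>+\<infinity>\<close> of a solution, found as the fixed point
  of the operator integrating from \<open>t\<close> to \<open>\<infinity>\<close> in a space of decaying perturbations; likewise at
  \<open>-\<infinity>\<close>. The maps sending asymptotic data to the value at time 0 are Lipschitz close to the
  identity and commute with lattice translations, so each image of \<open>\<real>\<^sup>n \<times> P\<close> misses a set of measure
  at most \<open>2 \<mu>\<close>, and \<open>\<W>\<close> is the intersection of the two images. The Lipschitz estimates in \<open>p\<close> use
  Taylor expansion at points of \<open>D\<close> together with the bound on \<open>\<partial>\<^sub>p\<^sup>2 H\<close>; as this also bounds the
  fields in a higher norm, their convergence in the Hoelder norm follows from uniform convergence
  by interpolation.
\<close>

subsection \<open>Partial derivatives\<close>

text \<open>Off \<open>D\<close> no smallness of \<open>R\<close> is given; \<open>R\<close> is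
  controlled there only through the second p-derivative of \<open>H\<close>. Since \<open>R\<close>
  and its p-gradient vanish over \<open>D\<close>, Taylor's formula in p at a point of
  \<open>D\<close>, differentiated in q, expresses the force by derivatives of \<open>f\<close> plus
  a term quadratic in the displacement v. With \<open>f\<close> of size at most
  \<open>\<rho>\<^sup>2\<close> and v of size \<rho> the whole force is of order
  \<open>\<rho>\<^sup>2\<close>, which leaves a factor \<rho> for the contraction. Two difficulties
  remain. The velocity depends on v with a constant that is not small; for this reason the
  v-component receives a large weight \<open>M\<close> in the norm. And data with different p drift
  apart linearly in time, so differences of solutions are measured with one power of t less than the
  solutions themselves; what is left is integrable because l > 1. Finally, \<rho> is also taken
  small relative to \<mu>, so that the maps from asymptotic data to initial values distort volume by
  an arbitrarily small amount.\<close>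

lemma has_partial_iff:
  "has_partial b f x \<longleftrightarrow> ((\<lambda>s. f (x + s *\<^sub>R b)) has_field_derivative partial b f x) (at 0)"
  unfolding has_partial_def partial_def by (simp add: DERIV_deriv_iff_field_differentiable)

lemma has_partialI:
  assumes "((\<lambda>s. f (x + s *\<^sub>R b)) has_field_derivative d) (at 0)"
  shows "has_partial b f x" "partial b f x = d"
  using assms unfolding has_partial_def partial_def
  by (auto simp: field_differentiable_def DERIV_imp_deriv)

lemma has_partial_along:
  assumes "has_partial b f (x + s *\<^sub>R b)"
  shows "((\<lambda>s. f (x + s *\<^sub>R b)) has_field_derivative partial b f (x + s *\<^sub>R b)) (at s)"
proof -
  have "((\<lambda>r. f ((x + s *\<^sub>R b) + r *\<^sub>R b)) has_field_derivative partial b f (x + s *\<^sub>R b)) (at 0)"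
    using assms has_partial_iff by blast
  hence "((\<lambda>r. (\<lambda>s. f (x + s *\<^sub>R b)) (r + s)) has_field_derivative partial b f (x + s *\<^sub>R b)) (at 0)"
    by (simp add: algebra_simps)
  thus ?thesis by (simp add: DERIV_shift[of _ _ 0 s, simplified])
qed

lemma eventually_line_in_open:
  fixes x b :: "'a::real_normed_vector"
  assumes "open S" "x \<in> S"
  shows "\<forall>\<^sub>F s in nhds (0::real). x + s *\<^sub>R b \<in> S"
proof -
  have "((\<lambda>s::real. x + s *\<^sub>R b) \<longlongrightarrow> x + 0 *\<^sub>R b) (nhds 0)"
    by (intro tendsto_intros filterlim_ident)
  thus ?thesis using topological_tendstoD[of _ "x + 0 *\<^sub>R b" _ S] assms by simp
qed

text \<open>Functions are total but meaningful only over a domain, while \<open>partial\<close> is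
  built from \<open>deriv\<close>, which looks at a whole neighbourhood. Over an open domain the
  values outside do not matter, so identities valid there may be differentiated.\<close>

lemma partial_cong_open:
  assumes "open S" "x \<in> S" "\<And>y. y \<in> S \<Longrightarrow> f y = g y"
  shows "has_partial b f x \<longleftrightarrow> has_partial b g x" "partial b f x = partial b g x"
proof -
  have ev: "\<forall>\<^sub>F s in nhds (0::real). f (x + s *\<^sub>R b) = g (x + s *\<^sub>R b)"
    using eventually_line_in_open[OF assms(1,2), of b] by eventually_elim (rule assms(3))
  have *: "((\<lambda>s. f (x + s *\<^sub>R b)) has_field_derivative d) (at 0) \<longleftrightarrow>
        ((\<lambda>s. g (x + s *\<^sub>R b)) has_field_derivative d) (at 0)" for d
    by (rule DERIV_cong_ev[OF refl ev refl])
  show "has_partial b f x \<longleftrightarrow> has_partial b g x"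
    unfolding has_partial_def field_differentiable_def * ..
  show "partial b f x = partial b g x" unfolding partial_def deriv_def * ..
qed

lemma partials_append: "partials (xs @ ys) f = partials xs (partials ys f)"
  by (induction xs) auto

lemma has_partial_const: "has_partial b (\<lambda>x. c) x" "partial b (\<lambda>x. c) x = 0"
  by (rule has_partialI[where d=0], simp)+

lemma has_partial_add:
  assumes "has_partial b f x" "has_partial b g x"
  shows "has_partial b (\<lambda>x. f x + g x) x"
    "partial b (\<lambda>x. f x + g x) x = partial b f x + partial b g x"
  using assms unfolding has_partial_iff[of _ f] has_partial_iff[of _ g]
  by (auto intro!: has_partialI derivative_eq_intros)

lemma has_partial_diff:
  assumes "has_partial b f x" "has_partial b g x"
  shows "has_partial b (\<lambda>x. f x - g x) x"
    "partial b (\<lambda>x. f x - g x) x = partial b f x - partial b g x"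
  using assms unfolding has_partial_iff[of _ f] has_partial_iff[of _ g]
  by (auto intro!: has_partialI derivative_eq_intros)

lemma has_partial_mult:
  assumes "has_partial b f x" "has_partial b g x"
  shows "has_partial b (\<lambda>x. f x * g x) x"
    "partial b (\<lambda>x. f x * g x) x = partial b f x * g x + f x * partial b g x"
  using assms unfolding has_partial_iff[of _ f] has_partial_iff[of _ g]
  by (auto intro!: has_partialI derivative_eq_intros)

lemma has_partial_inner:
  "has_partial b (\<lambda>x. (x - a) \<bullet> e) x" "partial b (\<lambda>x. (x - a) \<bullet> e) x = b \<bullet> e"
  by (rule has_partialI, auto intro!: derivative_eq_intros simp: inner_add_left inner_diff_left)+

text \<open>Telescoping along the coordinate directions.\<close>

lemma C1_has_derivative:
  fixes f :: "'a::euclidean_space \<Rightarrow> real"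
  assumes S: "open S" "x \<in> S"
    and ex: "\<And>b y. b \<in> Basis \<Longrightarrow> y \<in> S \<Longrightarrow> has_partial b f y"
    and cont: "\<And>b. b \<in> Basis \<Longrightarrow> continuous_on S (partial b f)"
  shows "(f has_derivative (\<lambda>v. \<Sum>b\<in>Basis. (v \<bullet> b) * partial b f x)) (at x)"
proof -
  define T where "T A v = (\<Sum>b\<in>A. (v \<bullet> b) *\<^sub>R b)" for A :: "'a set" and v
  have key: "\<forall>e>0. \<exists>d>0. \<forall>v. norm v < d \<longrightarrow>
      \<bar>f (x + T A v) - f x - (\<Sum>b\<in>A. (v \<bullet> b) * partial b f x)\<bar> \<le> e * norm v"
    if "finite A" "A \<subseteq> Basis" for A
    using that
  proof (induction A)
    case empty
    thus ?case by (auto simp: T_def intro: exI[of _ 1])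
  next
    case (insert c A)
    show ?case
    proof (intro allI impI)
      fix e :: real assume "e > 0"
      from insert have c: "c \<in> Basis" and A: "A \<subseteq> Basis" "c \<notin> A" "finite A" by auto
      from insert.IH[OF A(1)] \<open>e > 0\<close> obtain d1 where d1: "d1 > 0"
        "\<And>v. norm v < d1 \<Longrightarrow>
          \<bar>f (x + T A v) - f x - (\<Sum>b\<in>A. (v \<bullet> b) * partial b f x)\<bar> \<le> e / 2 * norm v"
        by (meson half_gt_zero)
      obtain d2 where d2: "d2 > 0" "ball x d2 \<subseteq> S" using S open_contains_ball by blast
      have "continuous (at x) (partial c f)"
        using cont[OF c] S by (simp add: continuous_on_eq_continuous_at)
      then obtain d3 where d3: "d3 > 0"
        "\<And>y. dist y x < d3 \<Longrightarrow> \<bar>partial c f y - partial c f x\<bar> < e / 2"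
        using \<open>e > 0\<close> unfolding continuous_at_eps_delta dist_real_def by (meson half_gt_zero)
      define m :: real where "m = real DIM('a)"
      have m: "m > 0" unfolding m_def by simp
      have nT: "norm (T B v) \<le> m * norm v" if "B \<subseteq> Basis" for B v
      proof -
        have "norm (T B v) \<le> (\<Sum>b\<in>B. norm ((v \<bullet> b) *\<^sub>R b))" unfolding T_def by (rule norm_sum)
        also have "\<dots> \<le> (\<Sum>b\<in>B. norm v)"
          using that by (intro sum_mono) (auto simp: Basis_le_norm subset_iff)
        also have "\<dots> \<le> m * norm v"
          using that card_mono[OF finite_Basis that] by (simp add: m_def mult_right_mono)
        finally show ?thesis .
      qed
      \<comment> \<open>All points met on the way lie within \<open>(m + 1) * norm v\<close> of
        \<open>x\<close>: the part already travelled has length at most \<open>m * norm v\<close>,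
        the new edge at most \<open>norm v\<close>.\<close>
      define d where "d = Min {d1, d2 / (m + 1), d3 / (m + 1)}"
      have d: "d > 0" "d \<le> d1" "d \<le> d2 / (m + 1)" "d \<le> d3 / (m + 1)"
        using d1 d2 d3 m by (auto simp: d_def)
      show "\<exists>d>0. \<forall>v. norm v < d \<longrightarrow>
        \<bar>f (x + T (insert c A) v) - f x - (\<Sum>b\<in>insert c A. (v \<bullet> b) * partial b f x)\<bar> \<le> e * norm v"
      proof (intro exI[of _ d] conjI allI impI d(1))
        fix v :: 'a assume v: "norm v < d"
        define y where "y = x + T A v"
        have nb: "dist (y + s *\<^sub>R c) x < d2 \<and> dist (y + s *\<^sub>R c) x < d3"
          if "\<bar>s\<bar> \<le> norm v" for s
        proof -
          have "dist (y + s *\<^sub>R c) x \<le> norm (T A v) + norm (s *\<^sub>R c)"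
            unfolding y_def dist_norm using norm_triangle_ineq[of "T A v" "s *\<^sub>R c"]
            by (simp add: algebra_simps)
          also have "\<dots> \<le> m * norm v + norm v"
            using nT[OF A(1), of v] that c by simp
          also have "\<dots> = (m + 1) * norm v" by (simp add: algebra_simps)
          also have "\<dots> < (m + 1) * d" using v m by simp
          finally have *: "dist (y + s *\<^sub>R c) x < (m + 1) * d" .
          have "(m + 1) * d \<le> d2" "(m + 1) * d \<le> d3"
            using d m by (simp_all add: field_simps)
          thus ?thesis using * by linarith
        qed
        define r where "r = v \<bullet> c"
        have r: "\<bar>r\<bar> \<le> norm v" unfolding r_def using c by (simp add: Basis_le_norm)
        have dv: "((\<lambda>s. f (y + s *\<^sub>R c)) has_field_derivative partial c f (y + s *\<^sub>R c)) (at s)"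
          if "\<bar>s\<bar> \<le> norm v" for s
          using nb[OF that] d2 by (intro has_partial_along ex[OF c]) (auto simp: dist_commute)
        \<comment> \<open>Subtracting the linear function of slope \<open>partial c f x\<close>
          turns continuity of the partial derivative at \<open>x\<close> into a bound for the
          derivative of the difference along the whole edge.\<close>
        have "\<bar>(f (y + r *\<^sub>R c) - partial c f x * r) - (f (y + 0 *\<^sub>R c) - partial c f x * 0)\<bar> \<le> e / 2 * \<bar>r - 0\<bar>"
        proof (rule field_differentiable_bound[where S="{-norm v..norm v}" and
               f'="\<lambda>s. partial c f (y + s *\<^sub>R c) - partial c f x", unfolded real_norm_def])
          show "((\<lambda>s. f (y + s *\<^sub>R c) - partial c f x * s) has_field_derivative
               partial c f (y + s *\<^sub>R c) - partial c f x) (at s within {- norm v..norm v})"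
            if "s \<in> {- norm v..norm v}" for s
            using that by (auto intro!: derivative_eq_intros DERIV_subset[OF dv])
          show "\<bar>partial c f (y + s *\<^sub>R c) - partial c f x\<bar> \<le> e / 2" if "s \<in> {- norm v..norm v}" for s
            using d3(2) nb[of s] that by (intro less_imp_le d3(2)) auto
        qed (use r in auto)
        moreover have "e / 2 * \<bar>r - 0\<bar> \<le> e / 2 * norm v"
          using r \<open>e > 0\<close> by (intro mult_left_mono) auto
        moreover have "(f (y + r *\<^sub>R c) - partial c f x * r) - (f (y + 0 *\<^sub>R c) - partial c f x * 0)
            = f (y + r *\<^sub>R c) - f y - r * partial c f x" by simp
        ultimately have 1: "\<bar>f (y + r *\<^sub>R c) - f y - r * partial c f x\<bar> \<le> e / 2 * norm v"
          by linarith
        have Ti: "x + T (insert c A) v = y + r *\<^sub>R c"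
          using A by (simp add: T_def y_def r_def)
        have 2: "\<bar>f y - f x - (\<Sum>b\<in>A. (v \<bullet> b) * partial b f x)\<bar> \<le> e / 2 * norm v"
          unfolding y_def using d v by (intro d1(2)) auto
        have "(\<Sum>b\<in>insert c A. (v \<bullet> b) * partial b f x)
            = r * partial c f x + (\<Sum>b\<in>A. (v \<bullet> b) * partial b f x)"
          using A by (simp add: r_def)
        thus "\<bar>f (x + T (insert c A) v) - f x - (\<Sum>b\<in>insert c A. (v \<bullet> b) * partial b f x)\<bar> \<le> e * norm v"
          using 1 2 unfolding Ti by linarith
      qed
    qed
  qed
  have T: "T Basis v = v" for v by (simp add: T_def euclidean_representation)
  show ?thesis
    unfolding has_derivative_at_alt
  proof (intro conjI allI impI)
    show "bounded_linear (\<lambda>v. \<Sum>b\<in>Basis. (v \<bullet> b) * partial b f x)"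
      by (intro bounded_linear_intros)
    fix e :: real assume "e > 0"
    with key[OF finite_Basis subset_refl] obtain d where d: "d > 0"
      "\<And>v. norm v < d \<Longrightarrow> \<bar>f (x + v) - f x - (\<Sum>b\<in>Basis. (v \<bullet> b) * partial b f x)\<bar> \<le> e * norm v"
      unfolding T by meson
    show "\<exists>d>0. \<forall>y. norm (y - x) < d \<longrightarrow>
       norm (f y - f x - (\<Sum>b\<in>Basis. ((y - x) \<bullet> b) * partial b f x)) \<le> e * norm (y - x)"
      using d(1) d(2)[of "y - x" for y] by (intro exI[of _ d]) auto
  qed
qed

subsection \<open>Functions with bounded and Lipschitz continuous partial derivatives\<close>

definition bd_lip :: "'a::metric_space set \<Rightarrow> real \<Rightarrow> ('a \<Rightarrow> real) \<Rightarrow> bool" where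
  "bd_lip S K f \<longleftrightarrow> (\<forall>x\<in>S. \<bar>f x\<bar> \<le> K) \<and> (\<forall>x\<in>S. \<forall>y\<in>S. \<bar>f x - f y\<bar> \<le> K * dist x y)"

text \<open>The Lipschitz condition on the derivatives of order \<open>m\<close> stands in for
  bounds of order \<open>m + 1\<close>: it survives uniform limits, and together with the sup bound
  it controls Hoelder quotients of every exponent below 1. One constant serves all orders, which
  keeps the algebra of sums and products short.\<close>

primrec CkLip :: "nat \<Rightarrow> 'a::euclidean_space set \<Rightarrow> real \<Rightarrow> ('a \<Rightarrow> real) \<Rightarrow> bool" where
  "CkLip 0 S K f = bd_lip S K f"
| "CkLip (Suc m) S K f =
    (bd_lip S K f \<and> (\<forall>b\<in>Basis. (\<forall>x\<in>S. has_partial b f x) \<and> CkLip m S K (partial b f)))"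

lemma bd_lip_mono: "bd_lip S K f \<Longrightarrow> K \<le> L \<Longrightarrow> bd_lip S L f"
  unfolding bd_lip_def by (meson mult_right_mono order_trans zero_le_dist)

lemma bd_lip_cong: "(\<And>x. x \<in> S \<Longrightarrow> f x = g x) \<Longrightarrow> bd_lip S K f \<longleftrightarrow> bd_lip S K g"
  unfolding bd_lip_def by simp

lemma bd_lip_nonneg: "bd_lip S K f \<Longrightarrow> x \<in> S \<Longrightarrow> 0 \<le> K"
  unfolding bd_lip_def using abs_ge_zero order_trans by blast

lemma bd_lip_continuous: "bd_lip S K f \<Longrightarrow> continuous_on S f"
proof (cases "S = {}")
  case False
  assume a: "bd_lip S K f"
  have "0 \<le> K" using False bd_lip_nonneg[OF a] by auto
  have "K-lipschitz_on S f"
    using a \<open>0 \<le> K\<close> by (intro lipschitz_onI) (auto simp: bd_lip_def dist_real_def)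
  thus ?thesis by (rule lipschitz_on_continuous_on)
qed simp

lemma bd_lip_add: "bd_lip S K f \<Longrightarrow> bd_lip S L g \<Longrightarrow> bd_lip S (K + L) (\<lambda>x. f x + g x)"
  unfolding bd_lip_def
proof (intro conjI ballI; elim conjE)
  fix x y assume a: "x \<in> S" "y \<in> S" and
    l: "\<forall>x\<in>S. \<forall>y\<in>S. \<bar>f x - f y\<bar> \<le> K * dist x y" "\<forall>x\<in>S. \<forall>y\<in>S. \<bar>g x - g y\<bar> \<le> L * dist x y"
  have "\<bar>f x - f y\<bar> \<le> K * dist x y" "\<bar>g x - g y\<bar> \<le> L * dist x y" using a l by auto
  thus "\<bar>f x + g x - (f y + g y)\<bar> \<le> (K + L) * dist x y"
    unfolding distrib_right by linarith
next
  fix x assume a: "x \<in> S" and l: "\<forall>x\<in>S. \<bar>f x\<bar> \<le> K" "\<forall>x\<in>S. \<bar>g x\<bar> \<le> L"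
  hence "\<bar>f x\<bar> \<le> K" "\<bar>g x\<bar> \<le> L" by auto
  thus "\<bar>f x + g x\<bar> \<le> K + L" by linarith
qed

lemma bd_lip_mult:
  assumes f: "bd_lip S K f" and g: "bd_lip S L g"
  shows "bd_lip S (2 * K * L) (\<lambda>x. f x * g x)"
  unfolding bd_lip_def
proof (intro conjI ballI)
  fix x y assume a: "x \<in> S" "y \<in> S"
  have K: "0 \<le> K" "0 \<le> L" using bd_lip_nonneg f g a by auto
  have "f x * g x - f y * g y = f x * (g x - g y) + (f x - f y) * g y"
    by (simp add: algebra_simps)
  hence "\<bar>f x * g x - f y * g y\<bar> \<le> \<bar>f x\<bar> * \<bar>g x - g y\<bar> + \<bar>f x - f y\<bar> * \<bar>g y\<bar>"
    by (metis abs_mult abs_triangle_ineq)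
  also have "\<dots> \<le> K * (L * dist x y) + (K * dist x y) * L"
    using f g a K unfolding bd_lip_def by (intro add_mono mult_mono) auto
  finally show "\<bar>f x * g x - f y * g y\<bar> \<le> 2 * K * L * dist x y" by (simp add: algebra_simps)
next
  fix x assume a: "x \<in> S"
  have K: "0 \<le> K" "0 \<le> L" using bd_lip_nonneg f g a by auto
  have "\<bar>f x\<bar> * \<bar>g x\<bar> \<le> K * L"
    using f g a K unfolding bd_lip_def by (intro mult_mono) auto
  also have "\<dots> \<le> 2 * K * L" using K by simp
  finally show "\<bar>f x * g x\<bar> \<le> 2 * K * L" by (simp add: abs_mult)
qed

lemma CkLip_bd_lip: "CkLip m S K f \<Longrightarrow> bd_lip S K f"
  by (cases m) auto

lemma CkLip_mono: "CkLip m S K f \<Longrightarrow> K \<le> L \<Longrightarrow> CkLip m S L f"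
  by (induction m arbitrary: f) (auto intro: bd_lip_mono)

lemma CkLip_Suc_imp: "CkLip (Suc m) S K f \<Longrightarrow> CkLip m S K f"
proof (induction m arbitrary: f)
  case (Suc m)
  have "bd_lip S K f"
    "\<forall>b\<in>Basis. (\<forall>x\<in>S. has_partial b f x) \<and> CkLip (Suc m) S K (partial b f)"
    using Suc.prems CkLip.simps(2)[of "Suc m" S K f] by blast+
  with Suc.IH show ?case by (subst CkLip.simps(2)) blast
qed auto

lemma CkLip_SucD:
  assumes "CkLip (Suc m) S K f"
  shows "bd_lip S K f" "CkLip m S K f" "b \<in> Basis \<Longrightarrow> CkLip m S K (partial b f)"
    "b \<in> Basis \<Longrightarrow> x \<in> S \<Longrightarrow> has_partial b f x"
  using assms CkLip_Suc_imp by auto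

lemma CkLip_cong:
  assumes S: "open S" and eq: "\<And>x. x \<in> S \<Longrightarrow> f x = g x"
  shows "CkLip m S K f \<longleftrightarrow> CkLip m S K g"
  using eq
proof (induction m arbitrary: f g)
  case 0
  thus ?case using bd_lip_cong[of S f g K] by auto
next
  case (Suc m)
  have "CkLip m S K (partial b f) \<longleftrightarrow> CkLip m S K (partial b g)" for b
    using partial_cong_open(2)[OF S _ Suc.prems] by (intro Suc.IH)
  moreover have "has_partial b f x \<longleftrightarrow> has_partial b g x" if "x \<in> S" for b x
    using partial_cong_open(1)[OF S that Suc.prems] .
  ultimately show ?case using bd_lip_cong[of S f g K, OF Suc.prems] by simp
qed

lemma CkLip_const: "\<bar>c\<bar> \<le> K \<Longrightarrow> CkLip m S K (\<lambda>x. c)"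
proof (induction m arbitrary: c)
  case 0
  thus ?case by (auto simp: bd_lip_def intro!: mult_nonneg_nonneg)
next
  case (Suc m)
  have "bd_lip S K (\<lambda>x. c)" using Suc.prems by (auto simp: bd_lip_def intro!: mult_nonneg_nonneg)
  moreover have "partial b (\<lambda>x::'a. c) = (\<lambda>x. 0)" for b using has_partial_const by blast
  moreover have "CkLip m S K (\<lambda>x. 0)" using Suc by (intro Suc.IH) auto
  ultimately show ?case by (simp add: has_partial_const(1))
qed

lemma CkLip_inner:
  assumes "\<And>x. x \<in> S \<Longrightarrow> \<bar>(x - a) \<bullet> e\<bar> \<le> K" "norm e \<le> K"
  shows "CkLip m S K (\<lambda>x. (x - a) \<bullet> e)"
proof -
  have 1: "bd_lip S K (\<lambda>x. (x - a) \<bullet> e)"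
    unfolding bd_lip_def
  proof (intro conjI ballI)
    fix x y
    have "\<bar>(x - a) \<bullet> e - (y - a) \<bullet> e\<bar> = \<bar>(x - y) \<bullet> e\<bar>" by (simp add: inner_diff_left)
    also have "\<dots> \<le> norm (x - y) * norm e" by (rule Cauchy_Schwarz_ineq2)
    also have "\<dots> \<le> norm (x - y) * K" using assms(2) by (rule mult_left_mono) simp
    finally show "\<bar>(x - a) \<bullet> e - (y - a) \<bullet> e\<bar> \<le> K * dist x y" by (simp add: dist_norm mult.commute)
  qed (rule assms(1))
  have 2: "CkLip k S K (partial b (\<lambda>x. (x - a) \<bullet> e))" if "b \<in> Basis" for b k
  proof -
    have "partial b (\<lambda>x. (x - a) \<bullet> e) = (\<lambda>x. b \<bullet> e)" using has_partial_inner(2) by blast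
    moreover have "\<bar>b \<bullet> e\<bar> \<le> K"
      using Basis_le_norm[OF that, of e] assms(2) by (simp add: inner_commute)
    ultimately show ?thesis by (simp add: CkLip_const)
  qed
  show ?thesis using 1 2 by (cases m) (auto simp: has_partial_inner(1))
qed

lemma CkLip_add:
  assumes "open S" "CkLip m S K f" "CkLip m S L g"
  shows "CkLip m S (K + L) (\<lambda>x. f x + g x)"
  using assms(2,3)
proof (induction m arbitrary: f g)
  case 0
  thus ?case using bd_lip_add by simp
next
  case (Suc m)
  have "CkLip m S (K + L) (partial b (\<lambda>x. f x + g x))" if "b \<in> Basis" for b
    using Suc.IH[of "partial b f" "partial b g"] Suc.prems that
    by (subst CkLip_cong[OF assms(1), of _ "\<lambda>x. partial b f x + partial b g x"])
       (auto simp: has_partial_add(2))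
  thus ?case using Suc.prems by (auto intro: bd_lip_add has_partial_add(1))
qed

text \<open>The product rule replaces one product by two, so each derivative doubles the constant;
  the remaining factor 2 is the one for the Lipschitz constant of a product.\<close>

lemma CkLip_mult:
  assumes S: "open S" and "0 \<le> K" "0 \<le> L" and f: "CkLip m S K f" and g: "CkLip m S L g"
  shows "CkLip m S (2 ^ (m + 1) * K * L) (\<lambda>x. f x * g x)"
  using f g
proof (induction m arbitrary: f g)
  case 0
  thus ?case using bd_lip_mult by simp
next
  case (Suc m)
  have *: "CkLip m S (2 ^ (Suc m + 1) * K * L) (partial b (\<lambda>x. f x * g x))" if "b \<in> Basis" for b
  proof -
    have "CkLip m S (2 ^ (m + 1) * K * L + 2 ^ (m + 1) * K * L)
        (\<lambda>x. partial b f x * g x + f x * partial b g x)"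
      using CkLip_SucD[OF Suc.prems(1)] CkLip_SucD[OF Suc.prems(2)] that
      by (intro CkLip_add[OF S] Suc.IH) blast+
    also have "2 ^ (m + 1) * K * L + 2 ^ (m + 1) * K * L = 2 ^ (Suc m + 1) * K * L" by simp
    finally have "CkLip m S (2 ^ (Suc m + 1) * K * L) (\<lambda>x. partial b f x * g x + f x * partial b g x)" .
    thus ?thesis
      using has_partial_mult(2) CkLip_SucD(4)[OF Suc.prems(1) that] CkLip_SucD(4)[OF Suc.prems(2) that]
      by (subst CkLip_cong[OF S, of _ "\<lambda>x. partial b f x * g x + f x * partial b g x"]) blast+
  qed
  have "1 * (2 * K * L) \<le> 2 ^ Suc m * (2 * K * L)"
    using assms(2,3) by (intro mult_right_mono) (auto intro: one_le_power simp del: power_Suc)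
  hence "bd_lip S (2 ^ (Suc m + 1) * K * L) (\<lambda>x. f x * g x)"
    using Suc.prems by (intro bd_lip_mono[OF bd_lip_mult]) (auto simp: algebra_simps)
  thus ?case
    using * has_partial_mult(1) CkLip_SucD(4)[OF Suc.prems(1)] CkLip_SucD(4)[OF Suc.prems(2)]
    by (simp only: CkLip.simps) blast
qed

lemma CkLip_sum:
  assumes "open S" "finite I" "\<And>i. i \<in> I \<Longrightarrow> CkLip m S K (f i)"
  shows "CkLip m S (real (card I) * K) (\<lambda>x. \<Sum>i\<in>I. f i x)"
  using assms(2,3)
proof (induction I)
  case (insert i I)
  have "CkLip m S (K + real (card I) * K) (\<lambda>x. f i x + (\<Sum>i\<in>I. f i x))"
    using insert by (intro CkLip_add[OF assms(1)]) auto
  thus ?case using insert by (simp add: algebra_simps)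
qed (auto intro: CkLip_const)

lemma CkLip_fst:
  fixes f :: "'a::euclidean_space \<Rightarrow> real" and B :: "'b::euclidean_space set"
  assumes "CkLip m UNIV K f"
  shows "CkLip m (UNIV \<times> B) K (\<lambda>z. f (fst z))"
  using assms
proof (induction m arbitrary: f)
  have *: "bd_lip (UNIV \<times> B) K (\<lambda>z. f (fst z))" if "bd_lip UNIV K f" for f :: "'a \<Rightarrow> real"
    unfolding bd_lip_def
  proof (intro conjI ballI)
    fix x y :: "'a \<times> 'b"
    have K: "0 \<le> K" using bd_lip_nonneg[OF that] by blast
    have "\<bar>f (fst x) - f (fst y)\<bar> \<le> K * dist (fst x) (fst y)" using that by (auto simp: bd_lip_def)
    also have "\<dots> \<le> K * dist x y" using K by (intro mult_left_mono dist_fst_le)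
    finally show "\<bar>f (fst x) - f (fst y)\<bar> \<le> K * dist x y" .
  qed (use that in \<open>auto simp: bd_lip_def\<close>)
  { case 0 thus ?case using * by simp }
  case (Suc m)
  have "(\<forall>x\<in>UNIV \<times> B. has_partial b (\<lambda>z. f (fst z)) x) \<and> CkLip m (UNIV \<times> B) K (partial b (\<lambda>z. f (fst z)))"
    if "b \<in> Basis" for b :: "'a \<times> 'b"
  proof -
    from that consider c where "c \<in> Basis" "b = (c, 0)" | c where "c \<in> Basis" "b = (0, c)"
      by (auto simp: Basis_prod_def)
    thus ?thesis
    proof cases
      case 1
      have "((\<lambda>s. f (fst (x + s *\<^sub>R b))) has_field_derivative partial c f (fst x)) (at 0)" for x
        using Suc.prems 1 by (simp add: has_partial_iff)
      from has_partialI[OF this] have "has_partial b (\<lambda>z. f (fst z)) x"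
        "partial b (\<lambda>z. f (fst z)) = (\<lambda>z. partial c f (fst z))" for x by auto
      thus ?thesis using Suc.IH[of "partial c f"] Suc.prems 1 by auto
    next
      case 2
      have "((\<lambda>s. f (fst (x + s *\<^sub>R b))) has_field_derivative 0) (at 0)" for x
        by (simp add: 2)
      from has_partialI[OF this] have "has_partial b (\<lambda>z. f (fst z)) x"
        "partial b (\<lambda>z. f (fst z)) = (\<lambda>z. 0)" for x by auto
      moreover have "0 \<le> K" using Suc.prems bd_lip_nonneg[of UNIV] by auto
      ultimately show ?thesis using CkLip_const[of 0 K m "UNIV \<times> B"] by simp
    qed
  qed
  thus ?case using * Suc.prems by simp
qed

lemma CkLip_partials:
  assumes "CkLip m S K f" "set bs \<subseteq> Basis" "length bs \<le> m"
  shows "CkLip (m - length bs) S K (partials bs f)"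
  using assms
\<comment> \<open>\<open>partials\<close> applies the last list element first, and this is the
  derivative that \<open>CkLip\<close> peels off; hence the induction from the right.\<close>
proof (induction bs arbitrary: f m rule: rev_induct)
  case (snoc c bs)
  then obtain k where k: "m = Suc k" by (cases m) auto
  have "CkLip (k - length bs) S K (partials bs (partial c f))"
    using snoc.prems k by (intro snoc.IH) auto
  thus ?case using k by (simp add: partials_append)
qed auto

lemma CkLip_partials_bd_lip:
  assumes "CkLip m S K f" "bs \<in> multi_indices i" "i \<le> m"
  shows "bd_lip S K (partials bs f)"
  using CkLip_partials[of m S K f bs] CkLip_bd_lip assms by (auto simp: multi_indices_def)

lemma CkLip_has_partial:
  assumes "CkLip m S K f" "bs \<in> multi_indices i" "i < m" "b \<in> Basis" "x \<in> S"
  shows "has_partial b (partials bs f) x"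
proof -
  have "CkLip (Suc (m - Suc i)) S K (partials bs f)"
    using CkLip_partials[of m S K f bs] assms by (auto simp: multi_indices_def Suc_diff_Suc)
  thus ?thesis using assms by simp
qed

lemma CkLip_Ck_on: "CkLip m S K f \<Longrightarrow> Ck_on m S f"
  unfolding Ck_on_def using CkLip_has_partial CkLip_partials_bd_lip bd_lip_continuous by blast

lemma Nil_in_multi_indices [simp]: "[] \<in> multi_indices 0"
  by (simp add: multi_indices_def)

lemma Ck_on_continuous: "Ck_on k S f \<Longrightarrow> continuous_on S f"
  using Nil_in_multi_indices unfolding Ck_on_def by (metis le0 partials.simps(1))

lemma Ck_on_Suc:
  fixes S :: "'a::euclidean_space set"
  assumes "Ck_on (Suc k) S f"
  shows "continuous_on S f" "b \<in> Basis \<Longrightarrow> x \<in> S \<Longrightarrow> has_partial b f x"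
    "b \<in> Basis \<Longrightarrow> Ck_on k S (partial b f)"
proof -
  show "continuous_on S f" using assms by (rule Ck_on_continuous)
  show "has_partial b f x" if "b \<in> Basis" "x \<in> S"
  proof -
    have "has_partial b (partials [] f) x"
      using assms that Nil_in_multi_indices unfolding Ck_on_def by blast
    thus ?thesis by simp
  qed
  assume b: "b \<in> Basis"
  have m: "bs @ [b] \<in> multi_indices (Suc i)"
    if "bs \<in> multi_indices i" for bs i
    using that b by (auto simp: multi_indices_def)
  show "Ck_on k S (partial b f)"
    unfolding Ck_on_def
  proof (intro conjI allI impI ballI)
    fix i and c x :: 'a and bs :: "'a list" assume "i < k" "bs \<in> multi_indices i" "c \<in> Basis" "x \<in> S"
    hence "has_partial c (partials (bs @ [b]) f) x"
      using assms m[of bs i] unfolding Ck_on_def by (meson Suc_mono)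
    thus "has_partial c (partials bs (partial b f)) x" by (simp add: partials_append)
  next
    fix i and bs :: "'a list" assume "i \<le> k" "bs \<in> multi_indices i"
    hence "continuous_on S (partials (bs @ [b]) f)"
      using assms m[of bs i] unfolding Ck_on_def by (meson Suc_le_mono)
    thus "continuous_on S (partials bs (partial b f))" by (simp add: partials_append)
  qed
qed

lemma Ck_on_mono: "Ck_on k S f \<Longrightarrow> j \<le> k \<Longrightarrow> Ck_on j S f"
  unfolding Ck_on_def by (meson less_le_trans order_trans)

lemma Ck_on_has_derivative:
  assumes "Ck_on (Suc k) S f" "open S" "x \<in> S"
  shows "(f has_derivative (\<lambda>v. \<Sum>b\<in>Basis. (v \<bullet> b) * partial b f x)) (at x)"
proof (rule C1_has_derivative[OF assms(2,3)])
  show "has_partial b f y" if "b \<in> Basis" "y \<in> S" for b y using Ck_on_Suc assms that by blast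
  show "continuous_on S (partial b f)" if "b \<in> Basis" for b
    using Ck_on_continuous[OF Ck_on_Suc(3)[OF assms(1) that]] .
qed

lemma Lipschitz_of_partial_bound:
  fixes f :: "'a::euclidean_space \<Rightarrow> real"
  assumes "Ck_on (Suc k) S f" "open S" "convex S"
    and K: "\<And>b x. b \<in> Basis \<Longrightarrow> x \<in> S \<Longrightarrow> \<bar>partial b f x\<bar> \<le> K" and xy: "x \<in> S" "y \<in> S"
  shows "\<bar>f x - f y\<bar> \<le> real DIM('a) * K * dist x y"
proof -
  have "norm (f x - f y) \<le> real DIM('a) * K * norm (x - y)"
  proof (rule differentiable_bound[OF assms(3) _ _ xy])
    show "(f has_derivative (\<lambda>v. \<Sum>b\<in>Basis. (v \<bullet> b) * partial b f z)) (at z within S)" if "z \<in> S" for z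
      using Ck_on_has_derivative[OF assms(1,2) that] by (rule has_derivative_at_withinI)
    show "onorm (\<lambda>v. \<Sum>b\<in>Basis. (v \<bullet> b) * partial b f z) \<le> real DIM('a) * K" if "z \<in> S" for z
    proof (rule onorm_le)
      fix v :: 'a
      have "norm (\<Sum>b\<in>Basis. (v \<bullet> b) * partial b f z) \<le> (\<Sum>b\<in>(Basis::'a set). norm v * K)"
        unfolding real_norm_def
      proof (rule order_trans[OF sum_abs sum_mono])
        fix b :: 'a assume b: "b \<in> Basis"
        show "\<bar>(v \<bullet> b) * partial b f z\<bar> \<le> norm v * K"
          unfolding abs_mult using Basis_le_norm[OF b, of v] K[OF b that] by (intro mult_mono) auto
      qed
      thus "norm (\<Sum>b\<in>Basis. (v \<bullet> b) * partial b f z) \<le> real DIM('a) * K * norm v"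
        by (simp add: algebra_simps)
    qed
  qed
  thus ?thesis by (simp add: dist_norm)
qed

text \<open>Bounds of order \<open>Suc m\<close> are traded for Lipschitz bounds of order
  \<open>m\<close> by the mean value inequality on the convex set; the factor \<open>DIM('a)\<close>
  comes from summing over the partial derivatives.\<close>

lemma CkLipI:
  fixes f :: "'a::euclidean_space \<Rightarrow> real"
  assumes S: "open S" "convex S" and "Ck_on (Suc m) S f"
    and "\<And>i bs x. i \<le> Suc m \<Longrightarrow> bs \<in> multi_indices i \<Longrightarrow> x \<in> S \<Longrightarrow> \<bar>partials bs f x\<bar> \<le> K"
  shows "CkLip m S (real DIM('a) * K) f"
proof -
  have base: "bd_lip S (real DIM('a) * K) f" if "Ck_on (Suc k) S f"
    and bd: "\<And>i bs x. i \<le> Suc k \<Longrightarrow> bs \<in> multi_indices i \<Longrightarrow> x \<in> S \<Longrightarrow> \<bar>partials bs f x\<bar> \<le> K" for f k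
    unfolding bd_lip_def
  proof (intro conjI ballI)
    fix x assume "x \<in> S"
    have f: "\<bar>f x\<bar> \<le> K" using bd[of 0 "[]" x, OF _ _ \<open>x \<in> S\<close>] by simp
    hence "K \<ge> 0" by linarith
    have "1 * K \<le> real DIM('a) * K"
      by (rule mult_right_mono[OF _ \<open>K \<ge> 0\<close>]) (simp add: Suc_leI)
    thus "\<bar>f x\<bar> \<le> real DIM('a) * K" using f by linarith
  next
    fix x y assume xy: "x \<in> S" "y \<in> S"
    show "\<bar>f x - f y\<bar> \<le> real DIM('a) * K * dist x y"
    proof (rule Lipschitz_of_partial_bound[OF that(1) S _ xy])
      show "\<bar>partial b f x\<bar> \<le> K" if "b \<in> Basis" "x \<in> S" for b x
        using bd[of 1 "[b]" x] that by (simp add: multi_indices_def)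
    qed
  qed
  show ?thesis using assms(3,4)
  proof (induction m arbitrary: f)
    case 0
    thus ?case using base[of 0 f] by simp
  next
    case (Suc m)
    have "CkLip m S (real DIM('a) * K) (partial b f)" if b: "b \<in> Basis" for b
    proof (rule Suc.IH)
      show "Ck_on (Suc m) S (partial b f)" using Ck_on_Suc(3)[OF Suc.prems(1) b] .
      fix i x and bs :: "'a list" assume "i \<le> Suc m" "bs \<in> multi_indices i" "x \<in> S"
      thus "\<bar>partials bs (partial b f) x\<bar> \<le> K"
        using Suc.prems(2)[of "Suc i" "bs @ [b]" x] b by (auto simp: multi_indices_def partials_append)
    qed
    thus ?case using base[of "Suc m" f] Suc.prems Ck_on_Suc(2)[OF Suc.prems(1)] by simp
  qed
qed

subsection \<open>Averages along segments and Taylor's formula in the second variable\<close>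

definition seg :: "'b::real_vector \<Rightarrow> real \<Rightarrow> 'a \<times> 'b \<Rightarrow> 'a \<times> 'b" where
  "seg p0 s z = (fst z, p0 + s *\<^sub>R (snd z - p0))"

text \<open>This is the remainder of Taylor's formula in the second variable with base point
  \<open>p0\<close>: weight 1 at order one, weight \<open>1 - s\<close> at order two. Other weights
  arise when the remainder itself is differentiated.\<close>

definition seg_int ::
    "(real \<Rightarrow> real) \<Rightarrow> 'b::real_normed_vector \<Rightarrow> ('a \<times> 'b \<Rightarrow> real) \<Rightarrow> 'a \<times> 'b \<Rightarrow> real" where
  "seg_int w p0 g z = integral {0..1} (\<lambda>s. w s * g (seg p0 s z))"

lemma convex_segment_point:
  assumes "convex B" "p0 \<in> B" "p \<in> B" "0 \<le> s" "s \<le> (1::real)"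
  shows "p0 + s *\<^sub>R (p - p0) \<in> B"
proof -
  have "(1 - s) *\<^sub>R p0 + s *\<^sub>R p \<in> B" using assms by (intro convexD) auto
  thus ?thesis by (simp add: algebra_simps)
qed

lemma seg_in:
  assumes "convex B" "p0 \<in> B" "z \<in> UNIV \<times> B" "s \<in> {0..1}"
  shows "seg p0 s z \<in> UNIV \<times> B"
  using convex_segment_point[OF assms(1,2), of "snd z" s] assms(3,4) by (auto simp: seg_def)

lemma seg_int_integrand_continuous:
  fixes g :: "'a::real_normed_vector \<times> 'b::real_normed_vector \<Rightarrow> real"
  assumes "convex B" "p0 \<in> B" "z \<in> UNIV \<times> B" "continuous_on (UNIV \<times> B) g" "continuous_on {0..1} w"
  shows "continuous_on {0..1} (\<lambda>s. w s * g (seg p0 s z))"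
proof -
  have "continuous_on {0..1} (\<lambda>s. seg p0 s z)" unfolding seg_def by (intro continuous_intros)
  hence "continuous_on {0..1} (\<lambda>s. g (seg p0 s z))"
    using seg_in[OF assms(1-3)] by (intro continuous_on_compose2[OF assms(4)]) blast+
  thus ?thesis using assms(5) by (intro continuous_intros)
qed

text \<open>The base points may differ because two solutions are expanded at the limits of their
  respective p-components, and the two remainders have to be compared.\<close>

lemma seg_int_diff_bound:
  fixes g :: "'a::real_normed_vector \<times> 'b::real_normed_vector \<Rightarrow> real"
  assumes B: "convex B" "p0 \<in> B" "p1 \<in> B" "z \<in> UNIV \<times> B" "y \<in> UNIV \<times> B"
    and g: "bd_lip (UNIV \<times> B) K g" and w: "continuous_on {0..1} w" "\<And>s. s \<in> {0..1} \<Longrightarrow> \<bar>w s\<bar> \<le> 1"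
    and d: "\<And>s. s \<in> {0..1} \<Longrightarrow> dist (seg p0 s z) (seg p1 s y) \<le> d"
  shows "\<bar>seg_int w p0 g z - seg_int w p1 g y\<bar> \<le> K * d"
proof -
  have K: "0 \<le> K" using bd_lip_nonneg[OF g B(4)] .
  have c: "continuous_on {0..1} (\<lambda>s. w s * g (seg p0 s z))" "continuous_on {0..1} (\<lambda>s. w s * g (seg p1 s y))"
    using B w bd_lip_continuous[OF g] by (auto intro!: seg_int_integrand_continuous)
  have "seg_int w p0 g z - seg_int w p1 g y
      = integral {0..1} (\<lambda>s. w s * g (seg p0 s z) - w s * g (seg p1 s y))"
    unfolding seg_int_def using c by (intro integral_diff[symmetric] integrable_continuous_real)
  moreover have "norm (integral {0..1} (\<lambda>s. w s * g (seg p0 s z) - w s * g (seg p1 s y))) \<le> K * d * (1 - 0)"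
  proof (rule integral_bound)
    fix s :: real assume s: "s \<in> {0..1}"
    have "\<bar>g (seg p0 s z) - g (seg p1 s y)\<bar> \<le> K * dist (seg p0 s z) (seg p1 s y)"
      using g seg_in[OF B(1,2,4) s] seg_in[OF B(1,3,5) s] by (auto simp: bd_lip_def)
    also have "\<dots> \<le> K * d" using d[OF s] K by (intro mult_left_mono)
    finally have "\<bar>w s\<bar> * \<bar>g (seg p0 s z) - g (seg p1 s y)\<bar> \<le> 1 * (K * d)"
      using w(2)[OF s] by (intro mult_mono) auto
    thus "norm (w s * g (seg p0 s z) - w s * g (seg p1 s y)) \<le> K * d"
      by (simp add: abs_mult[symmetric] algebra_simps)
  qed (use c in \<open>auto intro!: continuous_intros\<close>)
  ultimately show ?thesis by simp
qed

lemma seg_int_bound: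
  fixes g :: "'a::real_normed_vector \<times> 'b::real_normed_vector \<Rightarrow> real"
  assumes B: "convex B" "p0 \<in> B" "z \<in> UNIV \<times> B"
    and g: "bd_lip (UNIV \<times> B) K g" and w: "continuous_on {0..1} w" "\<And>s. s \<in> {0..1} \<Longrightarrow> \<bar>w s\<bar> \<le> 1"
  shows "\<bar>seg_int w p0 g z\<bar> \<le> K"
proof -
  have "norm (integral {0..1} (\<lambda>s. w s * g (seg p0 s z))) \<le> K * (1 - 0)"
  proof (rule integral_bound)
    fix s :: real assume s: "s \<in> {0..1}"
    have "\<bar>w s\<bar> * \<bar>g (seg p0 s z)\<bar> \<le> 1 * K"
      using w(2)[OF s] g seg_in[OF B s] by (intro mult_mono) (auto simp: bd_lip_def)
    thus "norm (w s * g (seg p0 s z)) \<le> K" by (simp add: abs_mult)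
  qed (use B w bd_lip_continuous[OF g] in \<open>auto intro!: seg_int_integrand_continuous\<close>)
  thus ?thesis by (simp add: seg_int_def)
qed

lemma seg_int_bd_lip:
  fixes g :: "'a::real_normed_vector \<times> 'b::real_normed_vector \<Rightarrow> real"
  assumes B: "convex B" "p0 \<in> B"
    and g: "bd_lip (UNIV \<times> B) K g" and w: "continuous_on {0..1} w" "\<And>s. s \<in> {0..1} \<Longrightarrow> \<bar>w s\<bar> \<le> 1"
  shows "bd_lip (UNIV \<times> B) K (seg_int w p0 g)"
proof -
  have "dist (seg p0 s z) (seg p0 s y) \<le> dist z y" if "s \<in> {0..1}" for s and z y :: "'a \<times> 'b"
  proof -
    have "dist (p0 + s *\<^sub>R (snd z - p0)) (p0 + s *\<^sub>R (snd y - p0)) = \<bar>s\<bar> * dist (snd z) (snd y)"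
      by (simp add: dist_norm flip: norm_scaleR) (simp add: algebra_simps)
    also have "\<dots> \<le> 1 * dist (snd z) (snd y)" using that by (intro mult_right_mono) auto
    finally show ?thesis by (auto simp: seg_def dist_prod_def intro!: real_sqrt_le_mono power_mono)
  qed
  thus ?thesis
    using seg_int_diff_bound[OF B(1,2,2) _ _ g w] seg_int_bound[OF B _ g w] by (simp add: bd_lip_def)
qed

text \<open>Differentiation under the integral sign. \<open>c s\<close> is the share of a
  displacement of the end point along \<open>b\<close> that reaches the point with parameter
  \<open>s\<close>: 1 in the first component, \<open>s\<close> in the second.\<close>

lemma partial_seg_int:
  fixes g :: "'a::euclidean_space \<times> 'b::euclidean_space \<Rightarrow> real"
  assumes B: "open B" "convex B" "p0 \<in> B" "z \<in> UNIV \<times> B"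
    and g: "bd_lip (UNIV \<times> B) K g" "bd_lip (UNIV \<times> B) K (partial b g)" 
      "\<And>x. x \<in> UNIV \<times> B \<Longrightarrow> has_partial b g x"
    and w: "continuous_on {0..1} w"
    and c: "continuous_on {0..1} c"
      "\<And>s \<eta> y. seg p0 s (y + \<eta> *\<^sub>R b) = seg p0 s y + (\<eta> * c s) *\<^sub>R b"
  shows "has_partial b (seg_int w p0 g) z"
    "partial b (seg_int w p0 g) z = seg_int (\<lambda>s. w s * c s) p0 (partial b g) z"
proof -
  let ?S = "UNIV \<times> B"
  have "open ?S" using B(1) by (simp add: open_Times)
  from eventually_line_in_open[OF this B(4), of b]
  obtain e where e: "e > 0" "\<And>\<eta>. \<bar>\<eta>\<bar> < e \<Longrightarrow> z + \<eta> *\<^sub>R b \<in> ?S"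
    unfolding eventually_nhds_metric by (auto simp: dist_real_def)
  define U where "U = {-(e/2)..e/2}"
  have U: "z + \<eta> *\<^sub>R b \<in> ?S" if "\<eta> \<in> U" for \<eta> using e that by (auto simp: U_def)
  have "((\<lambda>\<eta>. integral (cbox 0 1) (\<lambda>s. w s * g (seg p0 s (z + \<eta> *\<^sub>R b)))) has_field_derivative
       integral (cbox 0 1) (\<lambda>s. w s * c s * partial b g (seg p0 s (z + 0 *\<^sub>R b)))) (at 0 within U)"
  proof (rule leibniz_rule_field_derivative)
    fix \<eta> s assume h: "\<eta> \<in> U" "s \<in> cbox 0 (1::real)"
    have "seg p0 s z + (\<eta> * c s) *\<^sub>R b \<in> ?S"
      using seg_in[OF B(2,3) U[OF h(1)], of s] h(2) c(2)[of s z \<eta>] by simp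
    from has_partial_along[OF g(3)[OF this]]
    have "((\<lambda>r. g (seg p0 s z + r *\<^sub>R b)) has_field_derivative partial b g (seg p0 s z + (\<eta> * c s) *\<^sub>R b)) (at (\<eta> * c s))" .
    hence "((\<lambda>\<eta>. g (seg p0 s z + (\<eta> * c s) *\<^sub>R b)) has_field_derivative
        partial b g (seg p0 s z + (\<eta> * c s) *\<^sub>R b) * c s) (at \<eta>)"
      by (rule DERIV_chain2) (auto intro!: derivative_eq_intros)
    thus "((\<lambda>\<eta>. w s * g (seg p0 s (z + \<eta> *\<^sub>R b))) has_field_derivative
        w s * c s * partial b g (seg p0 s (z + \<eta> *\<^sub>R b))) (at \<eta> within U)"
      unfolding c(2) by (auto intro!: derivative_eq_intros intro: DERIV_subset)
  next
    fix \<eta> assume "\<eta> \<in> U"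
    show "(\<lambda>s. w s * g (seg p0 s (z + \<eta> *\<^sub>R b))) integrable_on cbox 0 1"
      using seg_int_integrand_continuous[OF B(2,3) U[OF \<open>\<eta> \<in> U\<close>] bd_lip_continuous[OF g(1)] w]
      by (simp add: integrable_continuous_real)
  next
    have "continuous_on (U \<times> {0..1}) (\<lambda>x. seg p0 (snd x) (z + fst x *\<^sub>R b))"
      unfolding seg_def by (intro continuous_intros)
    hence "continuous_on (U \<times> {0..1}) (\<lambda>x. partial b g (seg p0 (snd x) (z + fst x *\<^sub>R b)))"
      using seg_in[OF B(2,3) U] by (intro continuous_on_compose2[OF bd_lip_continuous[OF g(2)]]) force+
    moreover have "continuous_on (U \<times> {0..1}) (\<lambda>x. w (snd x))" "continuous_on (U \<times> {0..1}) (\<lambda>x. c (snd x))"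
      by (auto intro!: continuous_on_compose2[OF w] continuous_on_compose2[OF c(1)] continuous_intros)
    ultimately show "continuous_on (U \<times> cbox 0 1) (\<lambda>(\<eta>, s). w s * c s * partial b g (seg p0 s (z + \<eta> *\<^sub>R b)))"
      by (auto simp: case_prod_unfold intro!: continuous_intros)
  qed (use e in \<open>auto simp: U_def\<close>)
  moreover have "at (0::real) within U = at 0"
    unfolding U_def using e(1) by (intro at_within_Icc_at) auto
  ultimately have "((\<lambda>\<eta>. seg_int w p0 g (z + \<eta> *\<^sub>R b)) has_field_derivative
      seg_int (\<lambda>s. w s * c s) p0 (partial b g) z) (at 0)"
    by (simp add: seg_int_def)
  from has_partialI[OF this] show "has_partial b (seg_int w p0 g) z"
    "partial b (seg_int w p0 g) z = seg_int (\<lambda>s. w s * c s) p0 (partial b g) z" .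
qed

text \<open>Each derivative in the second component multiplies the weight by \<open>s\<close>. The
  induction therefore runs over all continuous weights bounded by 1, a class that is preserved, and
  the constant does not grow.\<close>

lemma CkLip_seg_int:
  fixes g :: "'a::euclidean_space \<times> 'b::euclidean_space \<Rightarrow> real"
  assumes B: "open B" "convex B" "p0 \<in> B"
    and "CkLip m (UNIV \<times> B) K g" "continuous_on {0..1} w" "\<And>s. s \<in> {0..1} \<Longrightarrow> \<bar>w s\<bar> \<le> 1"
  shows "CkLip m (UNIV \<times> B) K (seg_int w p0 g)"
  using assms(4-6)
proof (induction m arbitrary: g w)
  case 0
  show ?case using seg_int_bd_lip[OF B(2,3) _ 0(2,3)] 0(1) by simp
next
  case (Suc m)
  let ?S = "UNIV \<times> B"
  note g = CkLip_SucD[OF Suc.prems(1)]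
  have S: "open ?S" using B(1) by (simp add: open_Times)
  have "(\<forall>x\<in>?S. has_partial b (seg_int w p0 g) x) \<and> CkLip m ?S K (partial b (seg_int w p0 g))"
    if b: "b \<in> Basis" for b
  proof -
    obtain c where c: "continuous_on {0..1} c" "\<And>s. s \<in> {0..1} \<Longrightarrow> \<bar>c s\<bar> \<le> 1"
      "\<And>s \<eta> y. seg p0 s (y + \<eta> *\<^sub>R b) = seg p0 s y + (\<eta> * c s) *\<^sub>R b"
    proof -
      from b consider u where "b = (u, 0)" | u where "b = (0, u)" by (auto simp: Basis_prod_def)
      thus ?thesis
      proof cases
        case 1
        show ?thesis by (rule that[of "\<lambda>_. 1"]) (simp_all add: 1 seg_def algebra_simps)
      next
        case 2
        show ?thesis
          by (rule that[of "\<lambda>s. s"]) (simp_all add: 2 seg_def algebra_simps continuous_on_id)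
      qed
    qed
    note P = partial_seg_int[OF B _ g(1) CkLip_bd_lip[OF g(3)[OF b]] g(4)[OF b] Suc.prems(2) c(1,3)]
    have "CkLip m ?S K (seg_int (\<lambda>s. w s * c s) p0 (partial b g))"
    proof (rule Suc.IH[OF g(3)[OF b]])
      show "\<bar>w s * c s\<bar> \<le> 1" if "s \<in> {0..1}" for s
        using mult_mono[OF Suc.prems(3)[OF that] c(2)[OF that]] by (simp add: abs_mult)
    qed (intro continuous_intros Suc.prems c)
    thus ?thesis using P CkLip_cong[OF S, of "partial b (seg_int w p0 g)"] by auto
  qed
  thus ?case using seg_int_bd_lip[OF B(2,3) g(1) Suc.prems(2,3)] by simp
qed

lemma partial_fst_slice:
  "has_partial (e, 0) G (q, p) \<longleftrightarrow> has_partial e (\<lambda>q. G (q, p)) q"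
  "partial (e, 0) G (q, p) = partial e (\<lambda>q. G (q, p)) q"
  by (simp_all add: has_partial_def partial_def)

lemma taylor_order1:
  fixes \<phi> :: "'b::euclidean_space \<Rightarrow> real"
  assumes B: "open B" "convex B" "p0 \<in> B" "p \<in> B" and \<phi>: "Ck_on (Suc k) B \<phi>"
  shows "\<phi> p = \<phi> p0 + (\<Sum>b\<in>Basis. ((p - p0) \<bullet> b) * integral {0..1} (\<lambda>s. partial b \<phi> (p0 + s *\<^sub>R (p - p0))))"
proof -
  define \<gamma> where "\<gamma> s = p0 + s *\<^sub>R (p - p0)" for s :: real
  have \<gamma>: "\<gamma> s \<in> B" if "s \<in> {0..1}" for s
    unfolding \<gamma>_def using convex_segment_point B that by auto
  have c\<gamma>: "continuous_on {0..1} \<gamma>" unfolding \<gamma>_def[abs_def] by (intro continuous_intros)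
  have d: "((\<lambda>s. \<phi> (\<gamma> s)) has_vector_derivative (\<Sum>b\<in>Basis. ((p - p0) \<bullet> b) * partial b \<phi> (\<gamma> s))) (at s within {0..1})"
    if "s \<in> {0..1}" for s
  proof -
    have "((\<lambda>s. \<phi> (\<gamma> s)) has_derivative (\<lambda>h. \<Sum>b\<in>Basis. ((h *\<^sub>R (p - p0)) \<bullet> b) * partial b \<phi> (\<gamma> s))) (at s within {0..1})"
      by (rule has_derivative_compose[where f=\<gamma> and g=\<phi>, OF _ Ck_on_has_derivative[OF \<phi> B(1) \<gamma>[OF that]]])
         (auto simp: \<gamma>_def[abs_def] intro!: derivative_eq_intros)
    thus ?thesis by (simp add: has_vector_derivative_def sum_distrib_left mult.assoc)
  qed
  have c: "continuous_on {0..1} (\<lambda>s. partial b \<phi> (\<gamma> s))" if "b \<in> Basis" for b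
    by (rule continuous_on_compose2[OF Ck_on_continuous[OF Ck_on_Suc(3)[OF \<phi> that]] c\<gamma>]) (use \<gamma> in blast)
  have "\<phi> (\<gamma> 1) - \<phi> (\<gamma> 0) = integral {0..1} (\<lambda>s. \<Sum>b\<in>Basis. ((p - p0) \<bullet> b) * partial b \<phi> (\<gamma> s))"
    using fundamental_theorem_of_calculus[OF _ d] by (simp add: integral_unique)
  also have "\<dots> = (\<Sum>b\<in>Basis. ((p - p0) \<bullet> b) * integral {0..1} (\<lambda>s. partial b \<phi> (\<gamma> s)))"
    using c by (subst integral_sum) (auto intro!: integrable_continuous_real continuous_intros)
  finally show ?thesis by (simp add: \<gamma>_def)
qed

text \<open>The primitive of \<open>(1 - s) g''(s)\<close> is \<open>g(s) + (1 - s) g'(s)\<close>.\<close>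

lemma taylor_order2:
  fixes \<phi> :: "'b::euclidean_space \<Rightarrow> real"
  assumes B: "open B" "convex B" "p0 \<in> B" "p \<in> B" and \<phi>: "Ck_on (Suc (Suc k)) B \<phi>"
  shows "\<phi> p = \<phi> p0 + (\<Sum>c\<in>Basis. ((p - p0) \<bullet> c) * partial c \<phi> p0) +
    (\<Sum>c\<in>Basis. \<Sum>b\<in>Basis. ((p - p0) \<bullet> c) * ((p - p0) \<bullet> b) *
       integral {0..1} (\<lambda>s. (1 - s) * partial b (partial c \<phi>) (p0 + s *\<^sub>R (p - p0))))"
proof -
  define \<gamma> where "\<gamma> s = p0 + s *\<^sub>R (p - p0)" for s :: real
  define v where "v = p - p0"
  have \<gamma>: "\<gamma> s \<in> B" if "s \<in> {0..1}" for s
    unfolding \<gamma>_def using convex_segment_point B that by auto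
  have c\<gamma>: "continuous_on {0..1} \<gamma>" unfolding \<gamma>_def[abs_def] by (intro continuous_intros)
  have d: "((\<lambda>s. \<psi> (\<gamma> s)) has_real_derivative (\<Sum>b\<in>Basis. (v \<bullet> b) * partial b \<psi> (\<gamma> s))) (at s within {0..1})"
    if "s \<in> {0..1}" "Ck_on (Suc j) B \<psi>" for s \<psi> j
  proof -
    have "((\<lambda>s. \<psi> (\<gamma> s)) has_derivative (\<lambda>h. \<Sum>b\<in>Basis. ((h *\<^sub>R v) \<bullet> b) * partial b \<psi> (\<gamma> s))) (at s within {0..1})"
      by (rule has_derivative_compose[where f=\<gamma> and g=\<psi>, OF _ Ck_on_has_derivative[OF that(2) B(1) \<gamma>[OF that(1)]]])
         (auto simp: \<gamma>_def[abs_def] v_def intro!: derivative_eq_intros)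
    moreover have "(\<lambda>h. \<Sum>b\<in>Basis. ((h *\<^sub>R v) \<bullet> b) * partial b \<psi> (\<gamma> s)) = (*) (\<Sum>b\<in>Basis. (v \<bullet> b) * partial b \<psi> (\<gamma> s))"
      by (auto simp: sum_distrib_left sum_distrib_right algebra_simps)
    ultimately show ?thesis by (simp add: has_field_derivative_def)
  qed
  have pc: "Ck_on (Suc k) B (partial c \<phi>)" if "c \<in> Basis" for c
    using Ck_on_Suc(3)[OF \<phi> that] .
  have c: "continuous_on {0..1} (\<lambda>s. partial b (partial c \<phi>) (\<gamma> s))" if "b \<in> Basis" "c \<in> Basis" for b c
    by (rule continuous_on_compose2[OF Ck_on_continuous[OF Ck_on_Suc(3)[OF pc[OF that(2)] that(1)]] c\<gamma>])
       (use \<gamma> in blast)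
  define g where "g s = \<phi> (\<gamma> s) + (1 - s) * (\<Sum>c\<in>Basis. (v \<bullet> c) * partial c \<phi> (\<gamma> s))" for s
  have "(g has_vector_derivative (\<Sum>c\<in>Basis. \<Sum>b\<in>Basis. (v \<bullet> c) * (v \<bullet> b) * ((1 - s) * partial b (partial c \<phi>) (\<gamma> s))))
      (at s within {0..1})" if s: "s \<in> {0..1}" for s
  proof -
    have 1: "((\<lambda>s. \<Sum>c\<in>Basis. (v \<bullet> c) * partial c \<phi> (\<gamma> s)) has_real_derivative
        (\<Sum>c\<in>Basis. (v \<bullet> c) * (\<Sum>b\<in>Basis. (v \<bullet> b) * partial b (partial c \<phi>) (\<gamma> s)))) (at s within {0..1})"
    proof (rule DERIV_sum)
      fix c :: 'b assume "c \<in> Basis"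
      from DERIV_cmult[OF d[OF s pc[OF this]]]
      show "((\<lambda>s. (v \<bullet> c) * partial c \<phi> (\<gamma> s)) has_real_derivative
        (v \<bullet> c) * (\<Sum>b\<in>Basis. (v \<bullet> b) * partial b (partial c \<phi>) (\<gamma> s))) (at s within {0..1})" .
    qed
    have "(g has_real_derivative (\<Sum>b\<in>Basis. (v \<bullet> b) * partial b \<phi> (\<gamma> s)) +
       ((0 - 1) * (\<Sum>c\<in>Basis. (v \<bullet> c) * partial c \<phi> (\<gamma> s)) +
        (\<Sum>c\<in>Basis. (v \<bullet> c) * (\<Sum>b\<in>Basis. (v \<bullet> b) * partial b (partial c \<phi>) (\<gamma> s))) * (1 - s))) (at s within {0..1})"
      unfolding g_def[abs_def]
      by (rule DERIV_add[OF d[OF s \<phi>] DERIV_mult[OF DERIV_diff[OF DERIV_const DERIV_ident] 1]])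
    also have "(\<Sum>b\<in>Basis. (v \<bullet> b) * partial b \<phi> (\<gamma> s)) +
       ((0 - 1) * (\<Sum>c\<in>Basis. (v \<bullet> c) * partial c \<phi> (\<gamma> s)) +
        (\<Sum>c\<in>Basis. (v \<bullet> c) * (\<Sum>b\<in>Basis. (v \<bullet> b) * partial b (partial c \<phi>) (\<gamma> s))) * (1 - s))
      = (\<Sum>c\<in>Basis. \<Sum>b\<in>Basis. (v \<bullet> c) * (v \<bullet> b) * ((1 - s) * partial b (partial c \<phi>) (\<gamma> s)))"
      by (simp add: sum_distrib_left sum_distrib_right sum_negf mult_ac)
    finally show ?thesis by (simp only: has_real_derivative_iff_has_vector_derivative)
  qed
  from fundamental_theorem_of_calculus[OF _ this]
  have "g 1 - g 0 = integral {0..1} (\<lambda>s. \<Sum>c\<in>Basis. \<Sum>b\<in>Basis. (v \<bullet> c) * (v \<bullet> b) * ((1 - s) * partial b (partial c \<phi>) (\<gamma> s)))"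
    by (simp add: integral_unique)
  also have "\<dots> = (\<Sum>c\<in>Basis. \<Sum>b\<in>Basis. (v \<bullet> c) * (v \<bullet> b) * integral {0..1} (\<lambda>s. (1 - s) * partial b (partial c \<phi>) (\<gamma> s)))"
  proof -
    have i: "(\<lambda>s. (v \<bullet> c) * (v \<bullet> b) * ((1 - s) * partial b (partial c \<phi>) (\<gamma> s))) integrable_on {0..1}"
      if "b \<in> Basis" "c \<in> Basis" for b c
      using c[OF that] by (intro integrable_continuous_real continuous_intros)
    have "integral {0..1} (\<lambda>s. \<Sum>c\<in>Basis. \<Sum>b\<in>Basis. (v \<bullet> c) * (v \<bullet> b) * ((1 - s) * partial b (partial c \<phi>) (\<gamma> s)))
      = (\<Sum>c\<in>Basis. \<Sum>b\<in>Basis. integral {0..1} (\<lambda>s. (v \<bullet> c) * (v \<bullet> b) * ((1 - s) * partial b (partial c \<phi>) (\<gamma> s))))"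
    proof -
      have "integral {0..1} (\<lambda>s. \<Sum>c\<in>Basis. \<Sum>b\<in>Basis. (v \<bullet> c) * (v \<bullet> b) * ((1 - s) * partial b (partial c \<phi>) (\<gamma> s)))
        = (\<Sum>c\<in>Basis. integral {0..1} (\<lambda>s. \<Sum>b\<in>Basis. (v \<bullet> c) * (v \<bullet> b) * ((1 - s) * partial b (partial c \<phi>) (\<gamma> s))))"
        by (rule integral_sum[OF finite_Basis]) (intro integrable_sum finite_Basis i; assumption)
      also have "\<dots> = (\<Sum>c\<in>Basis. \<Sum>b\<in>Basis. integral {0..1} (\<lambda>s. (v \<bullet> c) * (v \<bullet> b) * ((1 - s) * partial b (partial c \<phi>) (\<gamma> s))))"
        by (intro sum.cong[OF refl] integral_sum finite_Basis i; assumption)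
      finally show ?thesis .
    qed
    thus ?thesis by simp
  qed
  finally show ?thesis by (simp add: g_def \<gamma>_def v_def)
qed

lemma Hessian_representation:
  fixes H :: "'a::euclidean_space \<times> 'b::euclidean_space \<Rightarrow> real"
  assumes B: "open B" "convex B" "p0 \<in> B" "p \<in> B" and H: "Ck_on 2 B (\<lambda>p. H (q, p))"
  defines "F \<equiv> \<lambda>b c z. partial b (partial c (\<lambda>p. H (fst z, p))) (snd z)"
  shows "c \<in> Basis \<Longrightarrow> partial c (\<lambda>p. H (q, p)) p = partial c (\<lambda>p. H (q, p)) p0 +
      (\<Sum>b\<in>Basis. ((p - p0) \<bullet> b) * seg_int (\<lambda>s. 1) p0 (F b c) (q, p))"
    and "H (q, p) = H (q, p0) + (\<Sum>c\<in>Basis. ((p - p0) \<bullet> c) * partial c (\<lambda>p. H (q, p)) p0) +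
      (\<Sum>c\<in>Basis. \<Sum>b\<in>Basis. ((p - p0) \<bullet> c) * ((p - p0) \<bullet> b) * seg_int (\<lambda>s. 1 - s) p0 (F b c) (q, p))"
proof -
  have H2: "Ck_on (Suc (Suc 0)) B (\<lambda>p. H (q, p))" using H by (simp add: numeral_2_eq_2)
  show "H (q, p) = H (q, p0) + (\<Sum>c\<in>Basis. ((p - p0) \<bullet> c) * partial c (\<lambda>p. H (q, p)) p0) +
      (\<Sum>c\<in>Basis. \<Sum>b\<in>Basis. ((p - p0) \<bullet> c) * ((p - p0) \<bullet> b) * seg_int (\<lambda>s. 1 - s) p0 (F b c) (q, p))"
    using taylor_order2[OF B H2] by (simp add: seg_int_def seg_def F_def)
  assume "c \<in> Basis"
  from taylor_order1[OF B Ck_on_Suc(3)[OF H2 this]]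
  show "partial c (\<lambda>p. H (q, p)) p = partial c (\<lambda>p. H (q, p)) p0 +
      (\<Sum>b\<in>Basis. ((p - p0) \<bullet> b) * seg_int (\<lambda>s. 1) p0 (F b c) (q, p))"
    by (simp add: seg_int_def seg_def F_def)
qed

text \<open>\<open>\<alpha>\<close> and \<open>\<beta>\<close> are \<open>H\<close> and its
  p-gradient over the base point. Differentiability in q is required of these two and of the Hessian
  \<open>F\<close>; that of \<open>H\<close> itself is then a consequence of the Taylor expansion.
  \<open>F\<close> carries one order more than the fields obtained from it, because the force
  contains its q-derivative.\<close>

locale hessian_lip =
  fixes H :: "'a::euclidean_space \<times> 'b::euclidean_space \<Rightarrow> real" and B :: "'b set" and p0 m K
    and F :: "'b \<Rightarrow> 'b \<Rightarrow> 'a \<times> 'b \<Rightarrow> real" and \<alpha> :: "'a \<Rightarrow> real" and \<beta> :: "'b \<Rightarrow> 'a \<Rightarrow> real"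
  assumes B: "open B" "convex B" "p0 \<in> B"
    and H2: "\<And>q. Ck_on 2 B (\<lambda>p. H (q, p))"
    and FK: "\<And>b c. b \<in> Basis \<Longrightarrow> c \<in> Basis \<Longrightarrow> CkLip (Suc m) (UNIV \<times> B) K (F b c)"
    and \<alpha>_partial: "\<And>e q. e \<in> Basis \<Longrightarrow> has_partial e \<alpha> q"
    and \<beta>_partial: "\<And>e c q. e \<in> Basis \<Longrightarrow> c \<in> Basis \<Longrightarrow> has_partial e (\<beta> c) q"
    and F_def: "F = (\<lambda>b c z. partial b (partial c (\<lambda>p. H (fst z, p))) (snd z))"
    and \<alpha>_def: "\<alpha> = (\<lambda>q. H (q, p0))" and \<beta>_def: "\<beta> = (\<lambda>c q. partial c (\<lambda>p. H (q, p)) p0)"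
begin

lemma p_derivative:
  assumes "p \<in> B" "c \<in> Basis"
  shows "partial c (\<lambda>p. H (q, p)) p =
    \<beta> c q + (\<Sum>b\<in>Basis. ((p - p0) \<bullet> b) * seg_int (\<lambda>s. 1) p0 (F b c) (q, p))"
  using Hessian_representation(1)[OF B assms(1) H2 assms(2)] by (simp add: F_def \<beta>_def)

lemma H_expansion:
  assumes "p \<in> B"
  shows "H (q, p) = \<alpha> q + (\<Sum>c\<in>Basis. ((p - p0) \<bullet> c) * \<beta> c q) +
    (\<Sum>c\<in>Basis. \<Sum>b\<in>Basis. ((p - p0) \<bullet> c) * ((p - p0) \<bullet> b) * seg_int (\<lambda>s. 1 - s) p0 (F b c) (q, p))"
  using Hessian_representation(2)[OF B assms H2] by (simp add: F_def \<alpha>_def \<beta>_def)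

text \<open>The expansion at \<open>p0\<close> is differentiated in q at fixed p. As the
  displacement does not depend on q, the derivative falls on \<open>\<alpha>\<close>,
  \<open>\<beta>\<close> and the Hessian only, and the remainder stays quadratic in
  \<open>p - p0\<close>.\<close>

lemma q_derivative:
  assumes p: "p \<in> B" and e: "e \<in> Basis"
  shows "has_partial e (\<lambda>q. H (q, p)) q"
    "partial e (\<lambda>q. H (q, p)) q = partial e \<alpha> q + (\<Sum>c\<in>Basis. ((p - p0) \<bullet> c) * partial e (\<beta> c) q) +
      (\<Sum>c\<in>Basis. \<Sum>b\<in>Basis. ((p - p0) \<bullet> c) * ((p - p0) \<bullet> b) *
         seg_int (\<lambda>s. 1 - s) p0 (partial (e, 0) (F b c)) (q, p))"
proof -
  have E: "(e, 0) \<in> Basis" using e by (simp add: Basis_prod_def)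
  have I: "has_partial e (\<lambda>q. seg_int (\<lambda>s. 1 - s) p0 (F b c) (q, p)) q"
    "partial e (\<lambda>q. seg_int (\<lambda>s. 1 - s) p0 (F b c) (q, p)) q =
     seg_int (\<lambda>s. 1 - s) p0 (partial (e, 0) (F b c)) (q, p)" if "b \<in> Basis" "c \<in> Basis" for b c
  proof -
    note FD = CkLip_SucD[OF FK[OF that]]
    have P: "has_partial (e, 0) (seg_int (\<lambda>s. 1 - s) p0 (F b c)) (q, p) \<and>
       partial (e, 0) (seg_int (\<lambda>s. 1 - s) p0 (F b c)) (q, p) =
       seg_int (\<lambda>s. (1 - s) * 1) p0 (partial (e, 0) (F b c)) (q, p)"
      using p by (intro conjI partial_seg_int[where c = "\<lambda>_. 1", OF B _ FD(1) CkLip_bd_lip[OF FD(3)[OF E]] FD(4)[OF E]])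
        (auto intro!: continuous_intros simp: seg_def algebra_simps)
    show "has_partial e (\<lambda>q. seg_int (\<lambda>s. 1 - s) p0 (F b c) (q, p)) q"
      "partial e (\<lambda>q. seg_int (\<lambda>s. 1 - s) p0 (F b c) (q, p)) q =
        seg_int (\<lambda>s. 1 - s) p0 (partial (e, 0) (F b c)) (q, p)"
      using P by (simp_all add: partial_fst_slice)
  qed
  have eq: "(\<lambda>q. H (q, p)) = (\<lambda>q. \<alpha> q + (\<Sum>c\<in>Basis. ((p - p0) \<bullet> c) * \<beta> c q) +
    (\<Sum>c\<in>Basis. \<Sum>b\<in>Basis. ((p - p0) \<bullet> c) * ((p - p0) \<bullet> b) * seg_int (\<lambda>s. 1 - s) p0 (F b c) (q, p)))"
    using H_expansion[OF p] by blast
  have "((\<lambda>s. H (q + s *\<^sub>R e, p)) has_field_derivative partial e \<alpha> q + (\<Sum>c\<in>Basis. ((p - p0) \<bullet> c) * partial e (\<beta> c) q) +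
      (\<Sum>c\<in>Basis. \<Sum>b\<in>Basis. ((p - p0) \<bullet> c) * ((p - p0) \<bullet> b) *
         seg_int (\<lambda>s. 1 - s) p0 (partial (e, 0) (F b c)) (q, p))) (at 0)"
    unfolding H_expansion[OF p]
    using \<alpha>_partial[OF e] \<beta>_partial[OF e] I
    unfolding has_partial_iff by (auto intro!: DERIV_add DERIV_sum DERIV_cmult)
  from has_partialI[OF this] show "has_partial e (\<lambda>q. H (q, p)) q"
    "partial e (\<lambda>q. H (q, p)) q = partial e \<alpha> q + (\<Sum>c\<in>Basis. ((p - p0) \<bullet> c) * partial e (\<beta> c) q) +
      (\<Sum>c\<in>Basis. \<Sum>b\<in>Basis. ((p - p0) \<bullet> c) * ((p - p0) \<bullet> b) *
         seg_int (\<lambda>s. 1 - s) p0 (partial (e, 0) (F b c)) (q, p))" .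
qed

text \<open>The number 2 bounds the displacement between two points of the unit ball,
  \<open>L\<close> bounds the data over the base point.\<close>

context
  fixes L :: real
  assumes Bbd: "\<And>p b. p \<in> B \<Longrightarrow> b \<in> Basis \<Longrightarrow> \<bar>(p - p0) \<bullet> b\<bar> \<le> 2" and K: "0 \<le> K" and L: "0 \<le> L"
    and \<beta>L: "\<And>c. c \<in> Basis \<Longrightarrow> CkLip m UNIV L (\<beta> c)"
    and \<alpha>L: "\<And>e. e \<in> Basis \<Longrightarrow> CkLip m UNIV L (partial e \<alpha>)"
    and \<beta>eL: "\<And>c e. c \<in> Basis \<Longrightarrow> e \<in> Basis \<Longrightarrow> CkLip m UNIV L (partial e (\<beta> c))"
begin

lemma S: "open (UNIV \<times> B)"
  using B(1) by (simp add: open_Times)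

lemma CkLip_p_coordinate:
  assumes "b \<in> Basis" shows "CkLip k (UNIV \<times> B) 2 (\<lambda>z. (snd z - p0) \<bullet> b)"
proof -
  have "CkLip k (UNIV \<times> B) 2 (\<lambda>z. (z - (0, p0)) \<bullet> (0, b))"
    using Bbd assms by (intro CkLip_inner) (auto simp: norm_Pair)
  thus ?thesis by (simp add: inner_prod_def)
qed

lemma CkLip_p_derivative:
  assumes c: "c \<in> Basis"
  shows "CkLip m (UNIV \<times> B) (L + real DIM('b) * (2 ^ (m + 1) * 2 * K)) (\<lambda>z. partial c (\<lambda>p. H (fst z, p)) (snd z))"
proof -
  have "CkLip m (UNIV \<times> B) (L + real DIM('b) * (2 ^ (m + 1) * 2 * K))
      (\<lambda>z. \<beta> c (fst z) + (\<Sum>b\<in>Basis. ((snd z - p0) \<bullet> b) * seg_int (\<lambda>s. 1) p0 (F b c) z))"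
    using c K by (intro CkLip_add S CkLip_fst \<beta>L CkLip_sum CkLip_mult CkLip_p_coordinate CkLip_seg_int[OF B])
      (auto intro: CkLip_Suc_imp[OF FK])
  thus ?thesis using p_derivative[OF _ c] by (subst CkLip_cong[OF S]) auto
qed

lemma CkLip_q_derivative:
  assumes e: "e \<in> Basis"
  shows "CkLip m (UNIV \<times> B) (L + real DIM('b) * (2 ^ (m + 1) * 2 * L) +
       real DIM('b) * (real DIM('b) * (2 ^ (m + 1) * (2 ^ (m + 1) * 2 * 2) * K)))
     (\<lambda>z. partial e (\<lambda>q. H (q, snd z)) (fst z))"
proof -
  have E: "(e, 0) \<in> Basis" using e by (simp add: Basis_prod_def)
  have "CkLip m (UNIV \<times> B) (L + real DIM('b) * (2 ^ (m + 1) * 2 * L) +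
       real DIM('b) * (real DIM('b) * (2 ^ (m + 1) * (2 ^ (m + 1) * 2 * 2) * K)))
     (\<lambda>z. partial e \<alpha> (fst z) + (\<Sum>c\<in>Basis. ((snd z - p0) \<bullet> c) * partial e (\<beta> c) (fst z)) +
      (\<Sum>c\<in>Basis. \<Sum>b\<in>Basis. ((snd z - p0) \<bullet> c) * ((snd z - p0) \<bullet> b) *
         seg_int (\<lambda>s. 1 - s) p0 (partial (e, 0) (F b c)) z))"
    using e K L by (intro CkLip_add S CkLip_fst \<alpha>L \<beta>eL CkLip_sum CkLip_mult CkLip_p_coordinate CkLip_seg_int[OF B])
      (auto intro: CkLip_SucD(3)[OF FK E] intro!: continuous_intros)
  thus ?thesis using q_derivative(2)[OF _ e] by (subst CkLip_cong[OF S]) auto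
qed

end

end

subsection \<open>Interpolation and limits\<close>

text \<open>Every point of \<open>S\<close> lies within \<open>r\<close> of an edge of length \<open>r\<close> inside \<open>S\<close>; in contrast to
  balls contained in \<open>S\<close>, this holds up to the boundary.\<close>

definition edge_thick :: "'a::euclidean_space set \<Rightarrow> bool" where
  "edge_thick S \<longleftrightarrow> (\<forall>x\<in>S. \<forall>b\<in>Basis. \<forall>r. 0 < r \<longrightarrow> r < 1 \<longrightarrow>
     (\<exists>y. dist y x \<le> r \<and> (\<forall>s\<in>{0..r}. y + s *\<^sub>R b \<in> S)))"

text \<open>The base point is contracted in p by the factor \<open>1 - r\<close>, which leaves room
  for an edge of length \<open>r\<close> in every direction, since the p-component of a basis vector
  has norm at most 1.\<close>

lemma edge_thick_cylinder:
  "edge_thick ((UNIV :: 'a::euclidean_space set) \<times> ball (0 :: 'b::euclidean_space) 1)"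
  unfolding edge_thick_def
proof (intro ballI allI impI)
  fix x b :: "'a \<times> 'b" and r :: real
  assume x: "x \<in> UNIV \<times> ball 0 1" and b: "b \<in> Basis" and r: "0 < r" "r < 1"
  let ?y = "(fst x, (1 - r) *\<^sub>R snd x)"
  have n: "norm (snd x) < 1" using x by auto
  have "dist ?y x = r * norm (snd x)"
    using r by (cases x) (simp add: dist_Pair_Pair dist_norm algebra_simps)
  also have "\<dots> \<le> r" using n r by (simp add: mult_left_le)
  finally have 1: "dist ?y x \<le> r" .
  have "?y + s *\<^sub>R b \<in> UNIV \<times> ball 0 1" if s: "s \<in> {0..r}" for s
  proof -
    have "norm (snd b) \<le> 1" using b by (auto simp: Basis_prod_def)
    have "norm ((1 - r) *\<^sub>R snd x + s *\<^sub>R snd b) \<le> norm ((1 - r) *\<^sub>R snd x) + norm (s *\<^sub>R snd b)"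
      by (rule norm_triangle_ineq)
    also have "\<dots> = (1 - r) * norm (snd x) + s * norm (snd b)" using r s by simp
    also have "\<dots> \<le> (1 - r) * norm (snd x) + r * 1"
      using s r \<open>norm (snd b) \<le> 1\<close> by (intro add_mono mult_mono) auto
    also have "\<dots> < 1"
    proof -
      have "(1 - r) * norm (snd x) < (1 - r) * 1" using n r by (intro mult_strict_left_mono) auto
      thus ?thesis by simp
    qed
    finally show ?thesis by (auto simp: mem_Times_iff)
  qed
  with 1 show "\<exists>y. dist y x \<le> r \<and> (\<forall>s\<in>{0..r}. y + s *\<^sub>R b \<in> UNIV \<times> ball 0 1)" by blast
qed


text \<open>An inequality of Landau type: on an edge of length \<open>r\<close> the mean value
  theorem produces a point where the derivative is at most \<open>2 * \<delta> / r\<close>. This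
  point lies within \<open>2 * r\<close> of \<open>x\<close>, and the Lipschitz bound transports the
  estimate back.\<close>

lemma partial_interpolation:
  assumes S: "edge_thick S" "x \<in> S" and b: "b \<in> Basis" and r: "0 < r" "r < 1"
    and ex: "\<And>y. y \<in> S \<Longrightarrow> has_partial b f y"
    and lip: "bd_lip S K (partial b f)" and \<delta>: "\<And>y. y \<in> S \<Longrightarrow> \<bar>f y\<bar> \<le> \<delta>"
  shows "\<bar>partial b f x\<bar> \<le> 2 * \<delta> / r + 2 * K * r"
proof -
  have K: "0 \<le> K" using bd_lip_nonneg[OF lip S(2)] .
  obtain y where y: "dist y x \<le> r" "\<And>s. s \<in> {0..r} \<Longrightarrow> y + s *\<^sub>R b \<in> S"
    using S b r unfolding edge_thick_def by meson
  have "((\<lambda>s. f (y + s *\<^sub>R b)) has_real_derivative partial b f (y + s *\<^sub>R b)) (at s)"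
    if "0 \<le> s" "s \<le> r" for s
    using that by (intro has_partial_along ex y(2)) auto
  from MVT2[OF r(1) this] obtain s where s: "0 < s" "s < r"
    "f (y + r *\<^sub>R b) - f (y + 0 *\<^sub>R b) = (r - 0) * partial b f (y + s *\<^sub>R b)" by blast
  have "r * \<bar>partial b f (y + s *\<^sub>R b)\<bar> = \<bar>f (y + r *\<^sub>R b) - f (y + 0 *\<^sub>R b)\<bar>"
    unfolding s(3) using r by (simp add: abs_mult)
  also have "\<dots> \<le> 2 * \<delta>" using \<delta>[OF y(2), of r] \<delta>[OF y(2), of 0] r by auto
  finally have 1: "\<bar>partial b f (y + s *\<^sub>R b)\<bar> \<le> 2 * \<delta> / r"
    using r by (simp add: field_simps)
  have "\<bar>partial b f x - partial b f (y + s *\<^sub>R b)\<bar> \<le> K * dist x (y + s *\<^sub>R b)"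
    using lip y(2)[of s] s S(2) by (auto simp: bd_lip_def)
  also have "dist x (y + s *\<^sub>R b) \<le> dist x y + dist y (y + s *\<^sub>R b)" by (rule dist_triangle)
  also have "\<dots> \<le> r + r" using y(1) s b by (simp add: dist_norm norm_minus_commute)
  finally have "\<bar>partial b f x - partial b f (y + s *\<^sub>R b)\<bar> \<le> K * (r + r)"
    using K by (simp add: mult_left_mono)
  thus ?thesis using 1 by (simp add: algebra_simps)
qed

text \<open>Each order is interpolated between the sup norm of the preceding order and its own
  Lipschitz bound. At the top order \<open>m\<close> it is the Lipschitz part of
  \<open>CkLip\<close> that makes this possible.\<close>

lemma partials_tendsto_0:
  assumes S: "edge_thick S" and C: "\<forall>\<^sub>F t in Fl. CkLip m S K (f t)"
    and f0: "\<And>e. e > 0 \<Longrightarrow> \<forall>\<^sub>F t in Fl. \<forall>x\<in>S. \<bar>f t x\<bar> \<le> e"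
    and "bs \<in> multi_indices i" "i \<le> m" "e > 0"
  shows "\<forall>\<^sub>F t in Fl. \<forall>x\<in>S. \<bar>partials bs (f t) x\<bar> \<le> e"
  using assms(4-)
proof (induction bs arbitrary: i e)
  case Nil
  thus ?case using f0 by simp
next
  case (Cons b bs)
  then obtain j where j: "i = Suc j" "bs \<in> multi_indices j" "b \<in> Basis"
    by (cases i) (auto simp: multi_indices_def)
  \<comment> \<open>\<open>r\<close> makes the term \<open>2 * K * r\<close> at most
    \<open>e / 2\<close>; the derivative of the next lower order is then required to be below
    \<open>e * r / 4\<close>, which bounds the other term by \<open>e / 2\<close>. The denominator
    with \<open>\<bar>K\<bar> + 1\<close> is positive for every \<open>K\<close>.\<close>
  define r where "r = min (1/2) (e / (4 * (\<bar>K\<bar> + 1)))"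
  have r: "0 < r" "r < 1" "r \<le> e / (4 * (\<bar>K\<bar> + 1))" using Cons.prems by (auto simp: r_def)
  have "\<forall>\<^sub>F t in Fl. \<forall>x\<in>S. \<bar>partials bs (f t) x\<bar> \<le> e * r / 4"
    using Cons.prems j r by (intro Cons.IH[OF j(2)]) auto
  thus ?case using C
  proof eventually_elim
    fix t assume small: "\<forall>x\<in>S. \<bar>partials bs (f t) x\<bar> \<le> e * r / 4" and Ct: "CkLip m S K (f t)"
    have bbs: "b # bs \<in> multi_indices i" by fact
    show "\<forall>x\<in>S. \<bar>partials (b # bs) (f t) x\<bar> \<le> e"
    proof
      fix x assume x: "x \<in> S"
      have lip: "bd_lip S K (partial b (partials bs (f t)))"
        using CkLip_partials_bd_lip[OF Ct bbs] Cons.prems by simp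
      have "\<bar>partial b (partials bs (f t)) x\<bar> \<le> 2 * (e * r / 4) / r + 2 * K * r"
      proof (rule partial_interpolation[OF S x j(3) r(1,2) _ lip])
        show "has_partial b (partials bs (f t)) y" if "y \<in> S" for y
          using CkLip_has_partial[OF Ct j(2) _ j(3) that] j Cons.prems by simp
      qed (use small in auto)
      moreover have "2 * (e * r / 4) / r = e / 2" using r by simp
      moreover have "2 * K * r \<le> e / 2"
      proof -
        have "2 * K * r \<le> 2 * (\<bar>K\<bar> + 1) * r" using r by (intro mult_right_mono) auto
        also have "\<dots> \<le> 2 * (\<bar>K\<bar> + 1) * (e / (4 * (\<bar>K\<bar> + 1)))" using r by (intro mult_left_mono) auto
        also have "\<dots> = e / 2" by (simp add: field_simps)
        finally show ?thesis .
      qed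
      ultimately show "\<bar>partials (b # bs) (f t) x\<bar> \<le> e" by simp
    qed
  qed
qed

lemma bd_lip_limit:
  assumes "\<And>n. bd_lip S K (f n)" "\<And>x. x \<in> S \<Longrightarrow> (\<lambda>n::nat. f n x) \<longlonglongrightarrow> g x"
  shows "bd_lip S K g"
  unfolding bd_lip_def
proof (intro conjI ballI)
  fix x assume x: "x \<in> S"
  show "\<bar>g x\<bar> \<le> K"
    by (rule tendsto_upperbound[OF tendsto_rabs[OF assms(2)[OF x]]])
       (use assms(1) x in \<open>auto simp: bd_lip_def\<close>)
  fix y assume y: "y \<in> S"
  show "\<bar>g x - g y\<bar> \<le> K * dist x y"
    by (rule tendsto_upperbound[OF tendsto_rabs[OF tendsto_diff[OF assms(2)[OF x] assms(2)[OF y]]]])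
       (use assms(1) x y in \<open>auto simp: bd_lip_def\<close>)
qed

lemma CkLip_uminus: "open S \<Longrightarrow> CkLip m S K f \<Longrightarrow> CkLip m S K (\<lambda>x. - f x)"
proof (induction m arbitrary: f)
  case 0
  thus ?case by (auto simp: bd_lip_def abs_minus_commute)
next
  case (Suc m)
  note f = CkLip_SucD[OF Suc.prems(2)]
  have P: "has_partial b (\<lambda>x. - f x) x \<and> partial b (\<lambda>x. - f x) x = - partial b f x"
    if "b \<in> Basis" "x \<in> S" for b x
    using has_partial_diff[OF has_partial_const(1) f(4)[OF that], of 0] by (simp add: has_partial_const(2))
  hence "CkLip m S K (partial b (\<lambda>x. - f x))" if "b \<in> Basis" for b
    using that Suc.IH[OF Suc.prems(1) f(3)[OF that]]
    by (subst CkLip_cong[OF Suc.prems(1), of _ "\<lambda>x. - partial b f x"]) auto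
  moreover have "bd_lip S K (\<lambda>x. - f x)" using f(1) by (auto simp: bd_lip_def abs_minus_commute)
  ultimately show ?case using P by simp
qed

lemma CkLip_diff:
  assumes "open S" "CkLip m S K f" "CkLip m S L g"
  shows "CkLip m S (K + L) (\<lambda>x. f x - g x)"
  using CkLip_add[OF assms(1,2) CkLip_uminus[OF assms(1,3)]] by simp

text \<open>Interpolation between the small differences \<open>f n - f k\<close> and their common
  bound makes the first derivatives uniformly Cauchy. Uniform convergence of the values therefore
  carries the derivatives along, order by order and with the same constant.\<close>

lemma CkLip_limit:
  fixes f :: "nat \<Rightarrow> 'a::euclidean_space \<Rightarrow> real"
  assumes S: "edge_thick S" "open S" and "\<And>n. CkLip m S K (f n)" "uniform_limit S f g sequentially"
  shows "CkLip m S K g"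
  using assms(3,4)
proof (induction m arbitrary: f g)
  case 0
  thus ?case using bd_lip_limit[of S K f g] tendsto_uniform_limitI by fastforce
next
  case (Suc m)
  note fS = CkLip_SucD[OF Suc.prems(1)]
  have "(\<forall>x\<in>S. has_partial b g x) \<and> CkLip m S K (partial b g)" if b: "b \<in> Basis" for b
  proof -
    have "uniformly_Cauchy_on S (\<lambda>n. partial b (f n))"
      unfolding uniformly_Cauchy_on_def
    proof (intro allI impI)
      fix e :: real assume e: "e > 0"
      \<comment> \<open>The Cauchy condition concerns pairs of indices; with the product filter the
        interpolation statement, formulated for one filter, applies to the difference of two
        members.\<close>
      define Fl where "Fl = (sequentially \<times>\<^sub>F sequentially)"
      have ex: "\<forall>\<^sub>F p in Fl. \<forall>x\<in>S. \<bar>partials [b] (\<lambda>x. f (fst p) x - f (snd p) x) x\<bar> \<le> e / 2"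
      proof (rule partials_tendsto_0[OF S(1), where m=1 and i=1 and K="K + K"])
        show "\<forall>\<^sub>F p in Fl. CkLip 1 S (K + K) (\<lambda>x. f (fst p) x - f (snd p) x)"
        proof (rule always_eventually, rule allI)
          fix p :: "nat \<times> nat"
          have "CkLip 1 S K (f n)" for n
            using fS(1) fS(4) CkLip_bd_lip[OF fS(3)] by (auto simp: One_nat_def)
          thus "CkLip 1 S (K + K) (\<lambda>x. f (fst p) x - f (snd p) x)" by (intro CkLip_diff S(2))
        qed
        fix d :: real assume "d > 0"
        then obtain N where N: "\<And>n x. n \<ge> N \<Longrightarrow> x \<in> S \<Longrightarrow> dist (f n x) (g x) < d / 2"
          using uniform_limitD[OF Suc.prems(2), of "d / 2"] unfolding eventually_sequentially by auto
        have "\<bar>f n x - f k x\<bar> \<le> d" if "n \<ge> N" "k \<ge> N" "x \<in> S" for n k x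
          using N[OF that(1,3)] N[OF that(2,3)] unfolding dist_real_def by linarith
        thus "\<forall>\<^sub>F p in Fl. \<forall>x\<in>S. \<bar>f (fst p) x - f (snd p) x\<bar> \<le> d"
          unfolding Fl_def eventually_prod_sequentially by auto
      qed (use b e in \<open>auto simp: multi_indices_def\<close>)
      have "\<forall>\<^sub>F p in Fl. \<forall>x\<in>S. dist (partial b (f (fst p)) x) (partial b (f (snd p)) x) < e"
        using ex
      proof eventually_elim
        fix p :: "nat \<times> nat"
        assume small: "\<forall>x\<in>S. \<bar>partials [b] (\<lambda>x. f (fst p) x - f (snd p) x) x\<bar> \<le> e / 2"
        have "dist (partial b (f (fst p)) x) (partial b (f (snd p)) x) < e" if "x \<in> S" for x
        proof -
          have "\<bar>partial b (\<lambda>x. f (fst p) x - f (snd p) x) x\<bar> \<le> e / 2" using small that by simp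
          thus ?thesis
            using has_partial_diff(2)[OF fS(4)[OF b that] fS(4)[OF b that]] e by (simp add: dist_real_def)
        qed
        thus "\<forall>x\<in>S. dist (partial b (f (fst p)) x) (partial b (f (snd p)) x) < e" by blast
      qed
      then obtain N where "\<forall>n\<ge>N. \<forall>k\<ge>N. \<forall>x\<in>S. dist (partial b (f n) x) (partial b (f k) x) < e"
        unfolding Fl_def eventually_prod_sequentially by auto
      thus "\<exists>M. \<forall>x\<in>S. \<forall>m\<ge>M. \<forall>n\<ge>M. dist (partial b (f m) x) (partial b (f n) x) < e" by blast
    qed
    hence "uniformly_convergent_on S (\<lambda>n. partial b (f n))" by (rule Cauchy_uniformly_convergent)
    then obtain D where D: "uniform_limit S (\<lambda>n. partial b (f n)) D sequentially"
      unfolding uniformly_convergent_on_def by blast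
    have P: "has_partial b g x \<and> partial b g x = D x" if x: "x \<in> S" for x
    proof -
      from eventually_line_in_open[OF S(2) x, of b]
      obtain d where d: "d > 0" "\<And>s. \<bar>s\<bar> < d \<Longrightarrow> x + s *\<^sub>R b \<in> S"
        unfolding eventually_nhds_metric by (auto simp: dist_real_def)
      define U where "U = ball (0::real) d"
      have U: "x + s *\<^sub>R b \<in> S" if "s \<in> U" for s using d that by (auto simp: U_def)
      have lim: "(\<lambda>n. f n (x + s *\<^sub>R b)) \<longlonglongrightarrow> g (x + s *\<^sub>R b)" if "s \<in> U" for s
        using tendsto_uniform_limitI[OF Suc.prems(2) U[OF that]] .
      \<comment> \<open>Along the line through \<open>x\<close> in direction \<open>b\<close> the
        derivatives converge uniformly, so the limit may be differentiated; the limit function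
        \<open>G\<close> is afterwards identified with \<open>g\<close>.\<close>
      have "\<exists>G. \<forall>s\<in>U. (\<lambda>n. f n (x + s *\<^sub>R b)) \<longlonglongrightarrow> G s \<and> (G has_derivative (\<lambda>h. D (x + s *\<^sub>R b) * h)) (at s within U)"
      proof (rule has_derivative_sequence[where ?x0.0 = 0])
        show "((\<lambda>s. f n (x + s *\<^sub>R b)) has_derivative (\<lambda>h. partial b (f n) (x + s *\<^sub>R b) * h)) (at s within U)"
          if "s \<in> U" for n s
          using has_partial_along[OF fS(4)[OF b U[OF that]]]
          by (simp add: has_field_derivative_def has_derivative_at_withinI)
        show "\<forall>\<^sub>F n in sequentially. \<forall>s\<in>U. \<forall>h. norm (partial b (f n) (x + s *\<^sub>R b) * h - D (x + s *\<^sub>R b) * h) \<le> e * norm h"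
          if "e > 0" for e
          using uniform_limitD[OF D that]
        proof eventually_elim
          case (elim n)
          show ?case
          proof (intro ballI allI)
            fix s h :: real assume "s \<in> U"
            hence "\<bar>partial b (f n) (x + s *\<^sub>R b) - D (x + s *\<^sub>R b)\<bar> \<le> e"
              using elim U[of s] by (simp add: dist_real_def less_imp_le)
            hence "\<bar>partial b (f n) (x + s *\<^sub>R b) - D (x + s *\<^sub>R b)\<bar> * \<bar>h\<bar> \<le> e * \<bar>h\<bar>"
              by (rule mult_right_mono) simp
            thus "norm (partial b (f n) (x + s *\<^sub>R b) * h - D (x + s *\<^sub>R b) * h) \<le> e * norm h"
              by (simp add: left_diff_distrib[symmetric] abs_mult)
          qed
        qed
        show "(\<lambda>n. f n (x + 0 *\<^sub>R b)) \<longlonglongrightarrow> g (x + 0 *\<^sub>R b)" using lim[of 0] d by (simp add: U_def)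
      qed (use d in \<open>auto simp: U_def\<close>)
      then obtain G where G: "\<And>s. s \<in> U \<Longrightarrow> (\<lambda>n. f n (x + s *\<^sub>R b)) \<longlonglongrightarrow> G s"
        "\<And>s. s \<in> U \<Longrightarrow> (G has_derivative (\<lambda>h. D (x + s *\<^sub>R b) * h)) (at s within U)" by blast
      have 0: "0 \<in> U" "open U" using d by (auto simp: U_def)
      have eq: "G s = g (x + s *\<^sub>R b)" if "s \<in> U" for s
        using LIMSEQ_unique[OF G(1)[OF that] lim[OF that]] .
      have "(G has_field_derivative D x) (at 0)"
        using G(2)[OF 0(1)] at_within_open[OF 0] by (simp add: has_field_derivative_def)
      hence "((\<lambda>s. g (x + s *\<^sub>R b)) has_field_derivative D x) (at 0)"
        by (rule has_field_derivative_transform_within_open[OF _ 0(2,1)]) (rule eq)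
      from has_partialI[OF this] show ?thesis by blast
    qed
    have "CkLip m S K D" by (rule Suc.IH[OF fS(3)[OF b] D])
    thus ?thesis using P CkLip_cong[OF S(2), of "partial b g" D] by auto
  qed
  moreover have "bd_lip S K g"
    using bd_lip_limit[of S K f g] fS(1) tendsto_uniform_limitI[OF Suc.prems(2)] by blast
  ultimately show ?case by simp
qed

subsection \<open>Hoelder norms\<close>

text \<open>Quotients at distance at most \<open>r\<close> are bounded through the Lipschitz
  constant, those beyond \<open>r\<close> through the sup norm. For integer \<sigma> the norm
  contains no quotients and the bound holds a fortiori.\<close>

lemma hoelder_norm_le:
  fixes f :: "'a::euclidean_space \<Rightarrow> real"
  assumes C: "CkLip (nat \<lfloor>\<sigma>\<rfloor>) S K f" and r: "0 < r" "r \<le> 1" and "0 \<le> \<delta>" "0 \<le> K"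
    and small: "\<And>i bs x. i \<le> nat \<lfloor>\<sigma>\<rfloor> \<Longrightarrow> bs \<in> multi_indices i \<Longrightarrow> x \<in> S \<Longrightarrow> \<bar>partials bs f x\<bar> \<le> \<delta>"
  shows "hoelder_norm \<sigma> S f \<le> ennreal (\<delta> + (K * r powr (1 - frac \<sigma>) + 2 * \<delta> / r powr frac \<sigma>))"
proof -
  have 1: "(SUP i\<in>{..nat \<lfloor>\<sigma>\<rfloor>}. SUP bs\<in>multi_indices i. SUP x\<in>S. ennreal \<bar>partials bs f x\<bar>) \<le> ennreal \<delta>"
    using small by (intro SUP_least) (auto intro!: ennreal_leI)
  have 2: "(SUP bs\<in>multi_indices (nat \<lfloor>\<sigma>\<rfloor>). SUP x\<in>S. SUP y\<in>S - {x}.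
             ennreal (\<bar>partials bs f x - partials bs f y\<bar> / dist x y powr frac \<sigma>))
      \<le> ennreal (K * r powr (1 - frac \<sigma>) + 2 * \<delta> / r powr frac \<sigma>)"
  proof (intro SUP_least ennreal_leI)
    fix x y and bs :: "'a list" assume bs: "bs \<in> multi_indices (nat \<lfloor>\<sigma>\<rfloor>)" and xy: "x \<in> S" "y \<in> S - {x}"
    define d where "d = dist x y"
    have d: "d > 0" using xy by (auto simp: d_def)
    have lip: "\<bar>partials bs f x - partials bs f y\<bar> \<le> K * d"
      using CkLip_partials_bd_lip[OF C bs] xy by (auto simp: bd_lip_def d_def)
    have b: "\<bar>partials bs f x - partials bs f y\<bar> \<le> 2 * \<delta>"
      using small[OF _ bs, of x] small[OF _ bs, of y] xy by fastforce
    have f: "0 \<le> frac \<sigma>" "frac \<sigma> < 1" by (auto simp: frac_lt_1)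
    have n: "0 \<le> K * r powr (1 - frac \<sigma>)" "0 \<le> 2 * \<delta> / r powr frac \<sigma>" using assms by auto
    show "\<bar>partials bs f x - partials bs f y\<bar> / dist x y powr frac \<sigma>
      \<le> K * r powr (1 - frac \<sigma>) + 2 * \<delta> / r powr frac \<sigma>"
    proof (cases "d \<le> r")
      case True
      have "\<bar>partials bs f x - partials bs f y\<bar> / d powr frac \<sigma> \<le> K * d / d powr frac \<sigma>"
        using lip by (intro divide_right_mono) auto
      also have "\<dots> = K * d powr (1 - frac \<sigma>)" using d by (simp add: powr_diff)
      also have "\<dots> \<le> K * r powr (1 - frac \<sigma>)" using True d f \<open>0 \<le> K\<close> by (intro mult_left_mono powr_mono2) auto
      finally show ?thesis using n by (simp add: d_def)
    next
      case False
      have "\<bar>partials bs f x - partials bs f y\<bar> / d powr frac \<sigma> \<le> 2 * \<delta> / r powr frac \<sigma>"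
        using b False d f r by (intro frac_le powr_mono2) auto
      thus ?thesis using n by (simp add: d_def)
    qed
  qed
  have "hoelder_norm \<sigma> S f \<le> ennreal \<delta> + ennreal (K * r powr (1 - frac \<sigma>) + 2 * \<delta> / r powr frac \<sigma>)"
    unfolding hoelder_norm_def using 1 2 by (intro add_mono) auto
  thus ?thesis using assms by (simp add: ennreal_plus[symmetric] del: ennreal_plus)
qed

lemma CkLip_C_sigma:
  assumes "CkLip (nat \<lfloor>\<sigma>\<rfloor>) S K f" "0 \<le> K"
  shows "C_sigma \<sigma> S f"
proof -
  have "\<bar>partials bs f x\<bar> \<le> K" if "i \<le> nat \<lfloor>\<sigma>\<rfloor>" "bs \<in> multi_indices i" "x \<in> S" for i bs x
    using CkLip_partials_bd_lip[OF assms(1) that(2,1)] that(3) by (auto simp: bd_lip_def)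
  from hoelder_norm_le[OF assms(1) _ _ assms(2,2) this, of 1]
  have "hoelder_norm \<sigma> S f < \<infinity>"
    unfolding infinity_ennreal_def by (rule le_less_trans[OF _ ennreal_less_top]) simp_all
  thus ?thesis using CkLip_Ck_on[OF assms(1)] by (simp add: C_sigma_def)
qed

lemma hoelder_norm_tendsto_0:
  fixes f :: "'t \<Rightarrow> 'a::euclidean_space \<Rightarrow> real"
  assumes S: "edge_thick S" and C: "\<forall>\<^sub>F t in Fl. CkLip (nat \<lfloor>\<sigma>\<rfloor>) S K (f t)" and K: "0 \<le> K"
    and f0: "\<And>e. e > 0 \<Longrightarrow> \<forall>\<^sub>F t in Fl. \<forall>x\<in>S. \<bar>f t x\<bar> \<le> e"
  shows "((\<lambda>t. hoelder_norm \<sigma> S (f t)) \<longlongrightarrow> 0) Fl"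
proof (rule order_tendstoI)
  fix a :: ennreal assume "0 < a"
  then obtain c where c: "0 < c" "c < a" using dense by blast
  define e where "e = enn2real c"
  have "c < top" using c(2) by (rule less_le_trans) simp
  hence e: "0 < e" "ennreal e < a" using c by (auto simp: e_def enn2real_positive_iff)
  have fr: "0 \<le> frac \<sigma>" "frac \<sigma> < 1" by (auto simp: frac_lt_1)
  \<comment> \<open>\<open>r\<close> is determined by the contribution of nearby points, which
    becomes at most \<open>e / 2\<close>. Smallness of the derivatives, the number
    \<open>\<delta>\<close> below, is asked for afterwards and relative to \<open>r\<close>.\<close>
  define r where "r = min 1 ((e / (2 * (K + 1))) powr (1 / (1 - frac \<sigma>)))"
  have r: "0 < r" "r \<le> 1" using e K by (auto simp: r_def)
  have "K * r powr (1 - frac \<sigma>) \<le> e / 2"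
  proof -
    have "r powr (1 - frac \<sigma>) \<le> ((e / (2 * (K + 1))) powr (1 / (1 - frac \<sigma>))) powr (1 - frac \<sigma>)"
      using fr r(1) by (intro powr_mono2) (auto simp: r_def)
    also have "\<dots> = e / (2 * (K + 1))" using fr e K by (simp add: powr_powr)
    finally have "K * r powr (1 - frac \<sigma>) \<le> (K + 1) * (e / (2 * (K + 1)))"
      using K by (intro mult_mono) auto
    also have "\<dots> = e / 2" using K by (simp add: add_nonneg_eq_0_iff field_simps)
    finally show ?thesis .
  qed
  moreover define \<delta> where "\<delta> = e / 8 * r powr frac \<sigma>"
  have "r powr frac \<sigma> \<le> 1 powr frac \<sigma>" using r fr by (intro powr_mono2) auto
  hence \<delta>: "0 < \<delta>" "\<delta> \<le> e / 8" "2 * \<delta> / r powr frac \<sigma> = e / 4"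
    using e r by (auto simp: \<delta>_def mult_left_le)
  ultimately have sum: "\<delta> + (K * r powr (1 - frac \<sigma>) + 2 * \<delta> / r powr frac \<sigma>) \<le> e" using e by linarith
  have fin: "finite (multi_indices i :: 'a list set)" for i
    using finite_lists_length_eq[OF finite_Basis, of i] by (simp add: multi_indices_def)
  have "\<forall>\<^sub>F t in Fl. \<forall>i\<in>{..nat \<lfloor>\<sigma>\<rfloor>}. \<forall>bs\<in>multi_indices i. \<forall>x\<in>S. \<bar>partials bs (f t) x\<bar> \<le> \<delta>"
    using \<delta>(1) by (intro eventually_ball_finite fin ballI partials_tendsto_0[OF S C f0]) auto
  thus "\<forall>\<^sub>F t in Fl. hoelder_norm \<sigma> S (f t) < a"
    using C
  proof eventually_elim
    fix t assume small: "\<forall>i\<in>{..nat \<lfloor>\<sigma>\<rfloor>}. \<forall>bs\<in>multi_indices i. \<forall>x\<in>S. \<bar>partials bs (f t) x\<bar> \<le> \<delta>"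
      and Ct: "CkLip (nat \<lfloor>\<sigma>\<rfloor>) S K (f t)"
    have "hoelder_norm \<sigma> S (f t) \<le> ennreal (\<delta> + (K * r powr (1 - frac \<sigma>) + 2 * \<delta> / r powr frac \<sigma>))"
      using small \<delta>(1) by (intro hoelder_norm_le[OF Ct r _ K]) auto
    also have "\<dots> \<le> ennreal e" using sum by (rule ennreal_leI)
    also have "\<dots> < a" by (rule e(2))
    finally show "hoelder_norm \<sigma> S (f t) < a" .
  qed
qed simp

subsection \<open>Solutions converging to a prescribed linear motion\<close>

lemma at_within_Ici_eq:
  fixes t b :: real
  assumes "t < b" "a \<le> t"
  shows "at t within {a..} = at t within {a..b}"
  by (rule at_within_nhd[where S="{..<b}"]) (use assms in auto)

lemma tail_integrable:
  fixes f :: "real \<Rightarrow> 'a::euclidean_space"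
  assumes f: "continuous_on {1..} f" "\<And>t. t \<ge> 1 \<Longrightarrow> norm (f t) \<le> c * t powr e" and e: "e < -1" and s: "1 \<le> s"
  shows "f integrable_on {s..}"
proof (rule integrable_on_all_intervals_integrable_bound)
  show "(\<lambda>x. if x \<in> {s..} then f x else 0) integrable_on cbox a b" for a b
  proof -
    have "{s..} \<inter> {a..b} = {max s a..b}" by auto
    moreover have "f integrable_on {max s a..b}"
      by (rule integrable_continuous_real, rule continuous_on_subset[OF f(1)]) (use s in auto)
    ultimately show ?thesis unfolding integrable_restrict_Int by simp
  qed
  show "(\<lambda>t. c * t powr e) integrable_on {s..}"
    using has_integral_powr_to_inf[OF e, of s] s by (intro integrable_on_mult_right) (auto simp: integrable_on_def)
qed (use f s in auto)

lemma tail_bound: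
  fixes f :: "real \<Rightarrow> 'a::euclidean_space"
  assumes f: "continuous_on {1..} f" "\<And>t. t \<ge> 1 \<Longrightarrow> norm (f t) \<le> c * t powr e" and e: "e < -1" and s: "1 \<le> s"
  shows "norm (integral {s..} f) \<le> c / (- (e + 1)) * s powr (e + 1)"
proof -
  have I: "((\<lambda>t. c * t powr e) has_integral (c * (-(s powr (e+1)) / (e+1)))) {s..}"
    using has_integral_powr_to_inf[OF e, of s] s by (intro has_integral_mult_right) auto
  have "norm (integral {s..} f) \<le> integral {s..} (\<lambda>t. c * t powr e)"
    using f s I by (intro integral_norm_bound_integral tail_integrable[OF f e s]) auto
  also have "\<dots> = c * (-(s powr (e+1)) / (e+1))" by (rule integral_unique[OF I])
  also have "\<dots> = c / (- (e + 1)) * s powr (e + 1)" using e by (simp add: divide_simps) (simp add: algebra_simps)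
  finally show ?thesis .
qed

lemma tail_derivative:
  fixes f :: "real \<Rightarrow> 'a::euclidean_space"
  assumes f: "continuous_on {1..} f" "\<And>t. t \<ge> 1 \<Longrightarrow> norm (f t) \<le> c * t powr e" and e: "e < -1" and t: "1 \<le> t"
  shows "((\<lambda>s. integral {s..} f) has_vector_derivative - f t) (at t within {1..})"
proof -
  have eq: "integral {s..} f = integral {1..} f - integral {1..s} f" if s: "1 \<le> s" for s
  proof -
    have "f integrable_on {1..s}"
      by (rule integrable_continuous_real, rule continuous_on_subset[OF f(1)]) auto
    moreover have "negligible ({1..s} \<inter> {s..})"
      using s by (intro negligible_subset[OF negligible_sing[of s]]) auto
    ultimately have "(f has_integral (integral {1..s} f + integral {s..} f)) ({1..s} \<union> {s..})"
      using tail_integrable[OF f e s] by (intro has_integral_Un) (auto simp: integrable_integral)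
    moreover have "{1..s} \<union> {s..} = {1..}" using s by auto
    ultimately show ?thesis by (simp add: integral_unique)
  qed
  have "((\<lambda>s. integral {1..s} f) has_vector_derivative f t) (at t within {1..t+1})"
    by (rule integral_has_vector_derivative, rule continuous_on_subset[OF f(1)]) (use t in auto)
  hence "((\<lambda>s. integral {1..s} f) has_vector_derivative f t) (at t within {1..})"
    using at_within_Ici_eq[of t "t+1" 1] t by simp
  hence "((\<lambda>s. integral {1..} f - integral {1..s} f) has_vector_derivative 0 - f t) (at t within {1..})"
    by (intro derivative_intros)
  hence "((\<lambda>s. integral {1..} f - integral {1..s} f) has_vector_derivative - f t) (at t within {1..})"
    by simp
  thus ?thesis
  proof (rule has_vector_derivative_transform[rotated 2])
    show "integral {s..} f = integral {1..} f - integral {1..s} f" if "s \<in> {1..}" for s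
      using that by (intro eq) simp
  qed (use t in simp)
qed

lemma tail_continuous:
  fixes f :: "real \<Rightarrow> 'a::euclidean_space"
  assumes f: "continuous_on {1..} f" "\<And>t. t \<ge> 1 \<Longrightarrow> norm (f t) \<le> c * t powr e" and e: "e < -1"
  shows "continuous_on {1..} (\<lambda>s. integral {s..} f)"
  unfolding continuous_on_eq_continuous_within
proof
  fix t :: real assume "t \<in> {1..}"
  thus "continuous (at t within {1..}) (\<lambda>s. integral {s..} f)"
    by (intro has_vector_derivative_continuous[OF tail_derivative[OF f e]]) auto
qed

text \<open>The time variable is shifted to \<open>t \<ge> 1\<close>. The solution with asymptotic data \<open>(q, p)\<close> is
  \<open>q + (t - 1) \<omega>(p) + u(t)\<close>, \<open>p + v(t)\<close> with \<open>v\<close> of order \<open>\<rho> t powr (- l - 1)\<close>. The integral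
  operator preserves this order because \<open>b\<close> is smaller by a factor \<open>C \<rho>\<close>.\<close>

locale decaying_system =
  fixes a b :: "'v::euclidean_space \<Rightarrow> 'v \<Rightarrow> real \<Rightarrow> 'v" and B P :: "'v set" and \<omega> :: "'v \<Rightarrow> 'v"
    and l C \<rho> M \<kappa> :: real
  assumes l: "l > 1" and C: "0 \<le> C" and \<rho>: "0 < \<rho>"
    and M: "M = 4 * C / (l - 1) + 1" and \<kappa>: "\<kappa> = \<rho> * (C / (l - 1) + M * C)"
    and small: "\<kappa> \<le> 1 / 8" "C * \<rho> \<le> 1"
    and cont: "continuous_on (UNIV \<times> B \<times> {1..}) (\<lambda>(q, p, t). a q p t)"
      "continuous_on (UNIV \<times> B \<times> {1..}) (\<lambda>(q, p, t). b q p t)"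
    and PB: "\<And>p v. p \<in> P \<Longrightarrow> norm v \<le> \<rho> \<Longrightarrow> p + v \<in> B"
    and \<omega>_lip: "\<And>p p'. p \<in> P \<Longrightarrow> p' \<in> P \<Longrightarrow> norm (\<omega> p - \<omega> p') \<le> C * norm (p - p')"
    and a_bound: "\<And>q p v t. p \<in> P \<Longrightarrow> t \<ge> 1 \<Longrightarrow> norm v \<le> \<rho> * t powr (- l - 1) \<Longrightarrow>
      norm (a q (p + v) t - \<omega> p) \<le> C * \<rho> * t powr (- l - 1)"
    and b_bound: "\<And>q p v t. p \<in> P \<Longrightarrow> t \<ge> 1 \<Longrightarrow> norm v \<le> \<rho> * t powr (- l - 1) \<Longrightarrow>
      norm (b q (p + v) t) \<le> C * \<rho>\<^sup>2 * t powr (- l - 2)"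
    and a_lip: "\<And>q q' p p' v v' t. p \<in> P \<Longrightarrow> p' \<in> P \<Longrightarrow> t \<ge> 1 \<Longrightarrow>
      norm v \<le> \<rho> * t powr (- l - 1) \<Longrightarrow> norm v' \<le> \<rho> * t powr (- l - 1) \<Longrightarrow>
      norm ((a q (p + v) t - \<omega> p) - (a q' (p' + v') t - \<omega> p'))
        \<le> C * norm (v - v') + C * \<rho> * t powr (- l) * (norm (q - q') / t + norm (p - p'))"
    and b_lip: "\<And>q q' p p' v v' t. p \<in> P \<Longrightarrow> p' \<in> P \<Longrightarrow> t \<ge> 1 \<Longrightarrow>
      norm v \<le> \<rho> * t powr (- l - 1) \<Longrightarrow> norm v' \<le> \<rho> * t powr (- l - 1) \<Longrightarrow>
      norm (b q (p + v) t - b q' (p' + v') t)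
        \<le> C * \<rho> * t powr (- l - 1) * (norm (q - q') / t + norm (p - p') + norm (v - v'))"
begin

lemma C\<rho>: "0 \<le> C * \<rho>"
  using C \<rho> by simp

lemma divide_le_self: "0 \<le> x \<Longrightarrow> 1 \<le> y \<Longrightarrow> x / y \<le> (x::real)"
  by (simp add: divide_le_eq mult_le_cancel_left1)

text \<open>Only \<open>v\<close> is restricted in size: the estimates on the fields are uniform in
  q, whereas p has to stay within the distance of \<open>P\<close> for which they are
  available.\<close>

definition adm :: "(real \<Rightarrow> 'v) \<Rightarrow> (real \<Rightarrow> 'v) \<Rightarrow> bool" where
  "adm u v \<longleftrightarrow> continuous_on {1..} u \<and> continuous_on {1..} v \<and> (\<forall>t\<ge>1. norm (v t) \<le> \<rho> * t powr (- l - 1))"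

definition ap :: "'v \<times> 'v \<Rightarrow> (real \<Rightarrow> 'v) \<Rightarrow> (real \<Rightarrow> 'v) \<Rightarrow> real \<Rightarrow> 'v" where
  "ap x u v t = a (fst x + (t - 1) *\<^sub>R \<omega> (snd x) + u t) (snd x + v t) t - \<omega> (snd x)"

definition bp :: "'v \<times> 'v \<Rightarrow> (real \<Rightarrow> 'v) \<Rightarrow> (real \<Rightarrow> 'v) \<Rightarrow> real \<Rightarrow> 'v" where
  "bp x u v t = b (fst x + (t - 1) *\<^sub>R \<omega> (snd x) + u t) (snd x + v t) t"

lemma admD:
  assumes "adm u v" "t \<ge> 1"
  shows "norm (v t) \<le> \<rho> * t powr (- l - 1)" "norm (v t) \<le> \<rho>"
proof -
  show 1: "norm (v t) \<le> \<rho> * t powr (- l - 1)" using assms by (simp add: adm_def)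
  have "t powr (- l - 1) \<le> t powr 0" using assms l by (intro powr_mono) auto
  hence "\<rho> * t powr (- l - 1) \<le> \<rho> * 1" using \<rho> assms by (intro mult_left_mono) auto
  thus "norm (v t) \<le> \<rho>" using 1 by simp
qed

lemma ap_bp_continuous:
  assumes "adm u v" "snd x \<in> P"
  shows "continuous_on {1..} (ap x u v)" "continuous_on {1..} (bp x u v)"
proof -
  have in': "snd x + v t \<in> B" if "t \<ge> 1" for t using PB[OF assms(2) admD(2)[OF assms(1) that]] .
  have uv: "continuous_on {1..} u" "continuous_on {1..} v" using assms by (auto simp: adm_def)
  have c: "continuous_on {1..} (\<lambda>t. (fst x + (t - 1) *\<^sub>R \<omega> (snd x) + u t, snd x + v t, t))"
    using uv by (intro continuous_intros)
  show "continuous_on {1..} (ap x u v)"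
    using continuous_on_compose2[OF cont(1) c] in' unfolding ap_def[abs_def]
    by (intro continuous_on_diff) (auto simp: image_subset_iff)
  show "continuous_on {1..} (bp x u v)"
    using continuous_on_compose2[OF cont(2) c] in' unfolding bp_def[abs_def]
    by (auto simp: image_subset_iff)
qed

lemma ap_bp_bound:
  assumes "adm u v" "snd x \<in> P" "t \<ge> 1"
  shows "norm (ap x u v t) \<le> C * \<rho> * t powr (- l - 1)" "norm (bp x u v t) \<le> C * \<rho>\<^sup>2 * t powr (- l - 2)"
  unfolding ap_def bp_def
  using a_bound[OF assms(2,3) admD(1)[OF assms(1,3)]] b_bound[OF assms(2,3) admD(1)[OF assms(1,3)]] by auto

definition U_of :: "'v \<times> 'v \<Rightarrow> (real \<Rightarrow> 'v) \<Rightarrow> (real \<Rightarrow> 'v) \<Rightarrow> real \<Rightarrow> 'v" where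
  "U_of x u v s = - integral {s..} (ap x u v)"

definition V_of :: "'v \<times> 'v \<Rightarrow> (real \<Rightarrow> 'v) \<Rightarrow> (real \<Rightarrow> 'v) \<Rightarrow> real \<Rightarrow> 'v" where
  "V_of x u v s = - integral {s..} (bp x u v)"

lemma UV_bound:
  assumes "adm u v" "snd x \<in> P" "s \<ge> 1"
  shows "norm (U_of x u v s) \<le> C * \<rho> * s powr (- l)" "norm (V_of x u v s) \<le> \<rho> * s powr (- l - 1)"
proof -
  have "norm (U_of x u v s) \<le> C * \<rho> / (- (- l - 1 + 1)) * s powr (- l - 1 + 1)"
    unfolding U_of_def norm_minus_cancel using l
    by (intro tail_bound[OF ap_bp_continuous(1)[OF assms(1,2)] ap_bp_bound(1)[OF assms(1,2)] _ assms(3)]) auto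
  also have "\<dots> = C * \<rho> / l * s powr (- l)" by simp
  also have "\<dots> \<le> C * \<rho> * s powr (- l)" using l C\<rho> by (intro mult_right_mono divide_le_self) auto
  finally show "norm (U_of x u v s) \<le> C * \<rho> * s powr (- l)" .
  have "norm (V_of x u v s) \<le> C * \<rho>\<^sup>2 / (- (- l - 2 + 1)) * s powr (- l - 2 + 1)"
    unfolding V_of_def norm_minus_cancel using l
    by (intro tail_bound[OF ap_bp_continuous(2)[OF assms(1,2)] ap_bp_bound(2)[OF assms(1,2)] _ assms(3)]) auto
  also have "\<dots> = (C * \<rho>) * (\<rho> / (l + 1)) * s powr (- l - 1)"
  proof -
    have 1: "- l - 2 + 1 = - l - 1" by simp
    show ?thesis unfolding 1 by (simp add: power2_eq_square add.commute)
  qed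
  \<comment> \<open>One factor \<rho> of the quadratic bound is spent against \<open>C\<close>, so
    that the operator maps the set of admissible functions into itself.\<close>
  also have "\<dots> \<le> 1 * \<rho> * s powr (- l - 1)"
    using l C\<rho> \<rho> small by (intro mult_right_mono mult_mono divide_le_self) auto
  finally show "norm (V_of x u v s) \<le> \<rho> * s powr (- l - 1)" by simp
qed

lemma UV_continuous:
  assumes "adm u v" "snd x \<in> P"
  shows "continuous_on {1..} (U_of x u v)" "continuous_on {1..} (V_of x u v)"
  using tail_continuous[OF ap_bp_continuous(1)[OF assms] ap_bp_bound(1)[OF assms]]
    tail_continuous[OF ap_bp_continuous(2)[OF assms] ap_bp_bound(2)[OF assms]] l
  unfolding U_of_def[abs_def] V_of_def[abs_def] by (auto intro!: continuous_intros)

lemma UV_derivative: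
  assumes "adm u v" "snd x \<in> P" "t \<ge> 1"
  shows "(U_of x u v has_vector_derivative ap x u v t) (at t within {1..})"
    "(V_of x u v has_vector_derivative bp x u v t) (at t within {1..})"
  using has_vector_derivative_minus[OF tail_derivative[OF ap_bp_continuous(1)[OF assms(1,2)] ap_bp_bound(1)[OF assms(1,2)] _ assms(3)]]
    has_vector_derivative_minus[OF tail_derivative[OF ap_bp_continuous(2)[OF assms(1,2)] ap_bp_bound(2)[OF assms(1,2)] _ assms(3)]] l
  unfolding U_of_def[abs_def] V_of_def[abs_def] by auto

text \<open>The weights for differences are one power of t weaker than those in
  \<open>UV_bound\<close>. Motions with different p drift apart at rate
  \<open>C * norm (p - p')\<close>, so their positions differ by order t even without perturbation.
  The decay of the fields, reduced by this power, is still integrable.\<close>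

lemma UV_lip:
  assumes uv: "adm u v" "adm u' v'" and x: "snd x \<in> P" "snd x' \<in> P" and s: "s \<ge> 1"
    and U: "\<And>t. t \<ge> 1 \<Longrightarrow> norm (u t - u' t) \<le> U * t powr (1 - l)"
    and V: "\<And>t. t \<ge> 1 \<Longrightarrow> norm (v t - v' t) \<le> V * t powr (- l)"
  defines "D \<equiv> (1 + C) * (norm (fst x - fst x') + norm (snd x - snd x'))"
  shows "norm (U_of x u v s - U_of x' u' v' s) \<le> C / (l - 1) * (V + \<rho> * (D + U)) * s powr (1 - l)"
    "norm (V_of x u v s - V_of x' u' v' s) \<le> C * \<rho> * (D + U + V) * s powr (- l)"
proof -
  have U0: "U \<ge> 0" and V0: "V \<ge> 0"
    using order_trans[OF norm_ge_zero U[of 1]] order_trans[OF norm_ge_zero V[of 1]] by auto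
  have D: "D \<ge> 0" using C by (simp add: D_def)
  \<comment> \<open>Division by t compensates the linear drift: the differences of the q- and
    p-arguments, in the combination occurring in \<open>a_lip\<close> and \<open>b_lip\<close>, are
    bounded by \<open>D + U\<close> uniformly in time.\<close>
  have q: "norm ((fst x + (t - 1) *\<^sub>R \<omega> (snd x) + u t) - (fst x' + (t - 1) *\<^sub>R \<omega> (snd x') + u' t)) / t
      + norm (snd x - snd x') \<le> D + U" if t: "t \<ge> 1" for t
  proof -
    have "(fst x + (t - 1) *\<^sub>R \<omega> (snd x) + u t) - (fst x' + (t - 1) *\<^sub>R \<omega> (snd x') + u' t)
      = (fst x - fst x') + (t - 1) *\<^sub>R (\<omega> (snd x) - \<omega> (snd x')) + (u t - u' t)"
      by (simp add: algebra_simps)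
    also have "norm \<dots> \<le> norm (fst x - fst x') + norm ((t - 1) *\<^sub>R (\<omega> (snd x) - \<omega> (snd x'))) + norm (u t - u' t)"
      by (meson add_mono norm_triangle_ineq order_refl order_trans)
    also have "\<dots> \<le> t * norm (fst x - fst x') + t * (C * norm (snd x - snd x')) + t * U"
    proof (intro add_mono)
      show "norm (fst x - fst x') \<le> t * norm (fst x - fst x')" using t by (simp add: mult_le_cancel_right1)
      have "norm ((t - 1) *\<^sub>R (\<omega> (snd x) - \<omega> (snd x'))) = (t - 1) * norm (\<omega> (snd x) - \<omega> (snd x'))"
        using t by simp
      also have "\<dots> \<le> t * (C * norm (snd x - snd x'))"
        using \<omega>_lip[OF x] t by (intro mult_mono) auto
      finally show "norm ((t - 1) *\<^sub>R (\<omega> (snd x) - \<omega> (snd x'))) \<le> t * (C * norm (snd x - snd x'))" .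
      have "t powr (1 - l) \<le> t powr 1" using t l by (intro powr_mono) auto
      hence "U * t powr (1 - l) \<le> U * t" using U0 t by (intro mult_left_mono) auto
      thus "norm (u t - u' t) \<le> t * U" using U[OF t] by (simp add: mult.commute)
    qed
    also have "\<dots> = t * (norm (fst x - fst x') + C * norm (snd x - snd x') + U)" by (simp add: algebra_simps)
    finally have "norm ((fst x + (t - 1) *\<^sub>R \<omega> (snd x) + u t) - (fst x' + (t - 1) *\<^sub>R \<omega> (snd x') + u' t)) / t
      \<le> norm (fst x - fst x') + C * norm (snd x - snd x') + U"
      using t by (simp add: divide_le_eq mult.commute)
    moreover have "0 \<le> C * norm (fst x - fst x')" using C by simp
    ultimately show ?thesis by (simp add: D_def algebra_simps)
  qed
  note a1 = ap_bp_continuous(1)[OF uv(1) x(1)] and a2 = ap_bp_continuous(1)[OF uv(2) x(2)]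
    and b1 = ap_bp_continuous(2)[OF uv(1) x(1)] and b2 = ap_bp_continuous(2)[OF uv(2) x(2)]
  have e: "- l - 1 < -1" "- l - 2 < -1" "- l < -1" using l by auto
  have tA: "norm (ap x u v t - ap x' u' v' t) \<le> C * (V + \<rho> * (D + U)) * t powr (- l)" if t: "t \<ge> 1" for t
  proof -
    have "norm (ap x u v t - ap x' u' v' t) \<le> C * norm (v t - v' t) + C * \<rho> * t powr (- l) *
       (norm ((fst x + (t - 1) *\<^sub>R \<omega> (snd x) + u t) - (fst x' + (t - 1) *\<^sub>R \<omega> (snd x') + u' t)) / t + norm (snd x - snd x'))"
      unfolding ap_def by (rule a_lip[OF x t admD(1)[OF uv(1) t] admD(1)[OF uv(2) t]])
    also have "\<dots> \<le> C * (V * t powr (- l)) + C * \<rho> * t powr (- l) * (D + U)"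
      using C \<rho> by (intro add_mono[OF mult_left_mono[OF V[OF t]] mult_left_mono[OF q[OF t]]]) auto
    finally show ?thesis by (simp add: algebra_simps)
  qed
  have "U_of x u v s - U_of x' u' v' s = - integral {s..} (\<lambda>t. ap x u v t - ap x' u' v' t)"
    unfolding U_of_def
    by (subst integral_diff[OF tail_integrable[OF a1 ap_bp_bound(1)[OF uv(1) x(1)] e(1) s] 
           tail_integrable[OF a2 ap_bp_bound(1)[OF uv(2) x(2)] e(1) s]]) auto
  hence "norm (U_of x u v s - U_of x' u' v' s) \<le> C * (V + \<rho> * (D + U)) / (- (- l + 1)) * s powr (- l + 1)"
    using tail_bound[OF continuous_on_diff[OF a1 a2] tA e(3) s] by simp
  also have "\<dots> = C / (l - 1) * (V + \<rho> * (D + U)) * s powr (1 - l)" by simp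
  finally show "norm (U_of x u v s - U_of x' u' v' s) \<le> C / (l - 1) * (V + \<rho> * (D + U)) * s powr (1 - l)" .
  have tB: "norm (bp x u v t - bp x' u' v' t) \<le> C * \<rho> * (D + U + V) * t powr (- l - 1)" if t: "t \<ge> 1" for t
  proof -
    \<comment> \<open>No decay of the v-difference is used here, since the prefactor
      \<open>t powr (- l - 1)\<close> is integrable by itself.\<close>
    have "t powr (- l) \<le> t powr 0" using t l by (intro powr_mono) auto
    hence V1: "V * t powr (- l) \<le> V" using V0 t by (simp add: mult_left_le)
    have "norm (bp x u v t - bp x' u' v' t) \<le> C * \<rho> * t powr (- l - 1) *
       (norm ((fst x + (t - 1) *\<^sub>R \<omega> (snd x) + u t) - (fst x' + (t - 1) *\<^sub>R \<omega> (snd x') + u' t)) / t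
         + norm (snd x - snd x') + norm (v t - v' t))"
      unfolding bp_def by (rule b_lip[OF x t admD(1)[OF uv(1) t] admD(1)[OF uv(2) t]])
    also have "\<dots> \<le> C * \<rho> * t powr (- l - 1) * (D + U + V)"
      using C \<rho> by (intro mult_left_mono add_mono[OF q[OF t] order_trans[OF V[OF t] V1]]) auto
    finally show ?thesis by (simp add: algebra_simps)
  qed
  have "V_of x u v s - V_of x' u' v' s = - integral {s..} (\<lambda>t. bp x u v t - bp x' u' v' t)"
    unfolding V_of_def
    by (subst integral_diff[OF tail_integrable[OF b1 ap_bp_bound(2)[OF uv(1) x(1)] e(2) s] 
           tail_integrable[OF b2 ap_bp_bound(2)[OF uv(2) x(2)] e(2) s]]) auto
  hence "norm (V_of x u v s - V_of x' u' v' s) \<le> C * \<rho> * (D + U + V) / (- (- l - 1 + 1)) * s powr (- l - 1 + 1)"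
    using tail_bound[OF continuous_on_diff[OF b1 b2] tB e(1) s] by simp
  also have "\<dots> = C * \<rho> * (D + U + V) / l * s powr (- l)" by simp
  also have "\<dots> \<le> C * \<rho> * (D + U + V) * s powr (- l)"
    using l C \<rho> D U0 V0 by (intro mult_right_mono divide_le_self mult_nonneg_nonneg) auto
  finally show "norm (V_of x u v s - V_of x' u' v' s) \<le> C * \<rho> * (D + U + V) * s powr (- l)" .
qed

end

section \<open>The contraction in the weighted space, its fixed points and their dependence on the
  data\<close>

context decaying_system
begin

lemma M1: "1 \<le> M"
  using C l by (simp add: M)

definition uz :: "(real \<Rightarrow>\<^sub>C ('v \<times> 'v)) \<Rightarrow> real \<Rightarrow> 'v" where
  "uz Z t = t powr (1 - l) *\<^sub>R fst (apply_bcontfun Z t)"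

text \<open>Dividing by \<open>M\<close> means that the norm of the pair counts the v-component
  \<open>M\<close> times. The effect of v on the u-equation has the constant
  \<open>C / (l - 1)\<close>, free of \<rho>; the weight brings it below 1/4. The price is a factor
  \<open>M\<close> in the v-equation, which \<rho> pays for.\<close>

definition vz :: "(real \<Rightarrow>\<^sub>C ('v \<times> 'v)) \<Rightarrow> real \<Rightarrow> 'v" where
  "vz Z t = (t powr (- l) / M) *\<^sub>R snd (apply_bcontfun Z t)"

definition TT :: "'v \<times> 'v \<Rightarrow> (real \<Rightarrow>\<^sub>C ('v \<times> 'v)) \<Rightarrow> real \<Rightarrow> 'v \<times> 'v" where
  "TT x Z s = (s powr (l - 1) *\<^sub>R U_of x (uz Z) (vz Z) s, (M * s powr l) *\<^sub>R V_of x (uz Z) (vz Z) s)"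

text \<open>The Banach space consists of functions on the whole line. Evaluation at
  \<open>max 1 t\<close> extends the image constantly to times below 1, where no condition is
  imposed.\<close>

definition T :: "'v \<times> 'v \<Rightarrow> (real \<Rightarrow>\<^sub>C ('v \<times> 'v)) \<Rightarrow> (real \<Rightarrow>\<^sub>C ('v \<times> 'v))" where
  "T x Z = Bcontfun (\<lambda>t. TT x Z (max 1 t))"

text \<open>This is the bound of \<open>adm\<close> after rescaling:
  \<open>\<rho> * t powr (- l - 1)\<close> multiplied by \<open>M * t powr l\<close>.\<close>

definition Adm :: "(real \<Rightarrow>\<^sub>C ('v \<times> 'v)) set" where
  "Adm = {Z. \<forall>t\<ge>1. norm (snd (apply_bcontfun Z t)) \<le> M * \<rho> / t}"

lemma powr_split: "t \<ge> 1 \<Longrightarrow> t powr (- l - 1) = t powr (- l) / (t::real)"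
  by (simp add: powr_diff)

lemma adm_uz_vz:
  assumes "Z \<in> Adm" shows "adm (uz Z) (vz Z)"
  unfolding adm_def
proof (intro conjI allI impI)
  show "continuous_on {1..} (uz Z)" "continuous_on {1..} (vz Z)"
    unfolding uz_def[abs_def] vz_def[abs_def] using M1
    by (auto intro!: continuous_intros)
  fix t :: real assume t: "1 \<le> t"
  have "norm (vz Z t) = t powr (- l) / M * norm (snd (apply_bcontfun Z t))"
    using M1 by (simp add: vz_def)
  also have "\<dots> \<le> t powr (- l) / M * (M * \<rho> / t)"
    using assms t M1 by (intro mult_left_mono) (auto simp: Adm_def)
  also have "\<dots> = \<rho> * t powr (- l - 1)" using M1 t by (simp add: powr_split)
  finally show "norm (vz Z t) \<le> \<rho> * t powr (- l - 1)" .
qed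

lemma TT_bound:
  assumes Z: "Z \<in> Adm" and x: "snd x \<in> P" and s: "s \<ge> 1"
  shows "norm (fst (TT x Z s)) \<le> C * \<rho>" "norm (snd (TT x Z s)) \<le> M * \<rho> / s"
proof -
  note b = UV_bound[OF adm_uz_vz[OF Z] x s]
  have "norm (fst (TT x Z s)) \<le> s powr (l - 1) * (C * \<rho> * s powr (- l))"
    using b(1) by (simp add: TT_def mult_left_mono)
  also have "\<dots> = C * \<rho> * s powr (-1)" by (simp add: powr_add[symmetric] algebra_simps)
  also have "s powr (-1) \<le> s powr 0" using s by (intro powr_mono) auto
  finally show "norm (fst (TT x Z s)) \<le> C * \<rho>" using C\<rho> s by (simp add: mult_left_mono)
  have "norm (snd (TT x Z s)) \<le> M * s powr l * (\<rho> * s powr (- l - 1))"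
    using b(2) M1 by (simp add: TT_def mult_left_mono)
  also have "\<dots> = M * \<rho> * (s powr l * s powr (- l - 1))" by simp
  also have "s powr l * s powr (- l - 1) = 1 / s" using s by (simp add: powr_add[symmetric] powr_minus_divide)
  finally show "norm (snd (TT x Z s)) \<le> M * \<rho> / s" by simp
qed

lemma T_apply:
  assumes Z: "Z \<in> Adm" and x: "snd x \<in> P"
  shows "apply_bcontfun (T x Z) t = TT x Z (max 1 t)"
proof -
  have "(\<lambda>t. TT x Z (max 1 t)) \<in> bcontfun"
    unfolding bcontfun_def
  proof (intro CollectI conjI)
    have "continuous_on {1..} (TT x Z)"
      unfolding TT_def[abs_def] using UV_continuous[OF adm_uz_vz[OF Z] x]
      by (auto intro!: continuous_intros)
    thus "continuous_on UNIV (\<lambda>t. TT x Z (max 1 t))"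
      by (rule continuous_on_compose2) (auto intro!: continuous_intros)
    show "bounded (range (\<lambda>t. TT x Z (max 1 t)))"
    proof (rule boundedI)
      fix y assume "y \<in> range (\<lambda>t. TT x Z (max 1 t))"
      then obtain t where "y = TT x Z (max 1 t)" by auto
      then obtain s where s: "s \<ge> 1" "y = TT x Z s" using max.cobounded1 by blast
      have "norm y \<le> norm (fst y) + norm (snd y)" by (metis norm_Pair_le prod.collapse)
      also have "\<dots> \<le> C * \<rho> + M * \<rho>"
      proof (intro add_mono)
        show "norm (fst y) \<le> C * \<rho>" using TT_bound(1)[OF Z x s(1)] s by simp
        have "M * \<rho> / s \<le> M * \<rho>" using s M1 \<rho> by (intro divide_le_self) auto
        thus "norm (snd y) \<le> M * \<rho>" using TT_bound(2)[OF Z x s(1)] s by simp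
      qed
      finally show "norm y \<le> C * \<rho> + M * \<rho>" .
    qed
  qed
  thus ?thesis by (simp add: T_def Bcontfun_inverse)
qed

lemma T_Adm: "Z \<in> Adm \<Longrightarrow> snd x \<in> P \<Longrightarrow> T x Z \<in> Adm"
  using TT_bound(2) by (auto simp: Adm_def[of] T_apply max_def)

definition DD :: "'v \<times> 'v \<Rightarrow> 'v \<times> 'v \<Rightarrow> real" where
  "DD x x' = (1 + C) * (norm (fst x - fst x') + norm (snd x - snd x'))"

lemma \<kappa>0: "0 \<le> \<kappa>"
  using C \<rho> l M1 by (auto simp: \<kappa> intro!: mult_nonneg_nonneg add_nonneg_nonneg divide_nonneg_nonneg)

lemma T_lip:
  assumes Z: "Z \<in> Adm" "Z' \<in> Adm" and x: "snd x \<in> P" "snd x' \<in> P"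
  shows "dist (T x Z) (T x' Z') \<le> 1 / 2 * dist Z Z' + \<kappa> * DD x x'"
proof (rule dist_bound)
  fix t :: real
  define s where "s = max 1 t"
  have s: "s \<ge> 1" unfolding s_def by (rule max.cobounded1)
  define d where "d = dist Z Z'"
  have d: "norm (fst (apply_bcontfun Z r) - fst (apply_bcontfun Z' r)) \<le> d"
    "norm (snd (apply_bcontfun Z r) - snd (apply_bcontfun Z' r)) \<le> d" for r
    using dist_bounded[of Z r Z'] dist_fst_le[of "apply_bcontfun Z r" "apply_bcontfun Z' r"]
      dist_snd_le[of "apply_bcontfun Z r" "apply_bcontfun Z' r"] by (auto simp: d_def dist_norm)
  have d0: "d \<ge> 0" by (simp add: d_def)
  have D0: "DD x x' \<ge> 0" using C by (simp add: DD_def)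
  have U: "norm (uz Z r - uz Z' r) \<le> d * r powr (1 - l)" for r
    using mult_left_mono[OF d(1)[of r], of "r powr (1 - l)"]
    by (simp add: uz_def scaleR_diff_right[symmetric] mult.commute)
  have V: "norm (vz Z r - vz Z' r) \<le> (d / M) * r powr (- l)" for r
  proof -
    have "norm (vz Z r - vz Z' r) = r powr (- l) / M * norm (snd (apply_bcontfun Z r) - snd (apply_bcontfun Z' r))"
      using M1 by (simp add: vz_def scaleR_diff_right[symmetric])
    also have "\<dots> \<le> r powr (- l) / M * d" using d(2)[of r] M1 by (intro mult_left_mono) auto
    finally show ?thesis by (simp add: mult.commute)
  qed
  note L = UV_lip[OF adm_uz_vz[OF Z(1)] adm_uz_vz[OF Z(2)] x s U V]
  have "dist (T x Z t) (T x' Z' t) \<le> norm (fst (TT x Z s) - fst (TT x' Z' s)) + norm (snd (TT x Z s) - snd (TT x' Z' s))"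
    unfolding T_apply[OF Z(1) x(1)] T_apply[OF Z(2) x(2)] s_def[symmetric] dist_norm
    by (metis norm_Pair_le prod.collapse fst_diff snd_diff)
  also have "norm (fst (TT x Z s) - fst (TT x' Z' s)) \<le> C / (l - 1) * (d / M + \<rho> * (DD x x' + d))"
  proof -
    have "norm (fst (TT x Z s) - fst (TT x' Z' s)) = s powr (l - 1) * norm (U_of x (uz Z) (vz Z) s - U_of x' (uz Z') (vz Z') s)"
      by (simp add: TT_def scaleR_diff_right[symmetric])
    also have "\<dots> \<le> s powr (l - 1) * (C / (l - 1) * (d / M + \<rho> * (DD x x' + d)) * s powr (1 - l))"
      using L(1) unfolding DD_def by (intro mult_left_mono) auto
    also have "\<dots> = C / (l - 1) * (d / M + \<rho> * (DD x x' + d)) * (s powr (l - 1) * s powr (1 - l))" by simp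
    also have "s powr (l - 1) * s powr (1 - l) = 1" using s by (simp add: powr_add[symmetric])
    finally show ?thesis by simp
  qed
  also have "norm (snd (TT x Z s) - snd (TT x' Z' s)) \<le> M * (C * \<rho> * (DD x x' + d + d / M))"
  proof -
    have "norm (snd (TT x Z s) - snd (TT x' Z' s)) = M * s powr l * norm (V_of x (uz Z) (vz Z) s - V_of x' (uz Z') (vz Z') s)"
      using M1 by (simp add: TT_def scaleR_diff_right[symmetric])
    also have "\<dots> \<le> M * s powr l * (C * \<rho> * (DD x x' + d + d / M) * s powr (- l))"
      using L(2) M1 unfolding DD_def by (intro mult_left_mono) auto
    also have "\<dots> = M * (C * \<rho> * (DD x x' + d + d / M)) * (s powr l * s powr (- l))" by simp
    also have "s powr l * s powr (- l) = 1" using s by (simp add: powr_add[symmetric])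
    finally show ?thesis by simp
  qed
  also have "C / (l - 1) * (d / M + \<rho> * (DD x x' + d)) + M * (C * \<rho> * (DD x x' + d + d / M))
    \<le> (C / (l - 1) / M) * d + \<kappa> * (DD x x' + 2 * d)"
  proof -
    have "d / M \<le> d" using d0 M1 by (rule divide_le_self)
    hence "M * (C * \<rho> * (DD x x' + d + d / M)) \<le> M * (C * \<rho> * (DD x x' + 2 * d))"
      using M1 C\<rho> by (intro mult_left_mono) auto
    moreover have "C / (l - 1) * (\<rho> * (DD x x' + d)) \<le> C / (l - 1) * (\<rho> * (DD x x' + 2 * d))"
      using C l \<rho> d0 by (intro mult_left_mono divide_nonneg_nonneg) auto
    moreover have "\<kappa> * (DD x x' + 2 * d) = C / (l - 1) * (\<rho> * (DD x x' + 2 * d)) + M * (C * \<rho> * (DD x x' + 2 * d))"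
      by (simp add: \<kappa> algebra_simps)
    moreover have "C / (l - 1) * (d / M + \<rho> * (DD x x' + d)) = (C / (l - 1) / M) * d + C / (l - 1) * (\<rho> * (DD x x' + d))"
      by (simp add: algebra_simps)
    ultimately show ?thesis by linarith
  qed
  \<comment> \<open>One quarter comes from the weight \<open>M\<close>, the other from
    \<open>2 * \<kappa>\<close> with \<open>\<kappa> \<le> 1 / 8\<close>; together they give the
    contraction factor 1/2.\<close>
  also have "\<dots> \<le> 1 / 4 * d + (\<kappa> * DD x x' + 1 / 4 * d)"
  proof (intro add_mono)
    have "C / (l - 1) / M \<le> 1 / 4" using l C by (simp add: M divide_simps)
    thus "C / (l - 1) / M * d \<le> 1 / 4 * d" using d0 by (rule mult_right_mono)
    have "\<kappa> * d \<le> 1 / 8 * d" using small(1) d0 by (rule mult_right_mono)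
    thus "\<kappa> * (DD x x' + 2 * d) \<le> \<kappa> * DD x x' + 1 / 4 * d" by (simp add: algebra_simps)
  qed
  finally show "dist (T x Z t) (T x' Z' t) \<le> 1 / 2 * dist Z Z' + \<kappa> * DD x x'"
    by (simp add: d_def)
qed

lemma complete_Adm: "complete Adm"
proof -
  have eq: "Adm = (\<Inter>t\<in>{1..}. {Z. norm (snd (apply_bcontfun Z t)) \<le> M * \<rho> / t})"
    by (auto simp: Adm_def)
  have "continuous_on UNIV (\<lambda>Z :: real \<Rightarrow>\<^sub>C ('v \<times> 'v). apply_bcontfun Z t)" for t
  proof -
    have "1-lipschitz_on UNIV (\<lambda>Z :: real \<Rightarrow>\<^sub>C ('v \<times> 'v). apply_bcontfun Z t)"
      by (intro lipschitz_onI) (auto intro: dist_bounded)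
    thus ?thesis by (rule lipschitz_on_continuous_on)
  qed
  hence "closed Adm" unfolding eq
    by (intro closed_INT ballI closed_Collect_le continuous_on_norm continuous_on_snd continuous_on_const) auto
  thus ?thesis by (simp add: complete_eq_closed)
qed

lemma fixpoint:
  assumes x: "snd x \<in> P"
  shows "\<exists>!Z. Z \<in> Adm \<and> T x Z = Z"
proof -
  have "\<exists>!Z\<in>Adm. T x Z = Z"
  proof (rule Banach_fix[where c="1/2"])
    have "Bcontfun (\<lambda>_. 0) \<in> Adm"
      using M1 \<rho> by (auto simp: Adm_def Bcontfun_inverse const_bcontfun intro!: divide_nonneg_nonneg mult_nonneg_nonneg)
    thus "Adm \<noteq> {}" by blast
    show "T x ` Adm \<subseteq> Adm" using T_Adm x by blast
    show "dist (T x Z) (T x Z') \<le> 1 / 2 * dist Z Z'" if "Z \<in> Adm" "Z' \<in> Adm" for Z Z'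
      using T_lip[OF that x x] by (simp add: DD_def)
  qed (use complete_Adm in auto)
  thus ?thesis by simp
qed

definition sol :: "'v \<times> 'v \<Rightarrow> (real \<Rightarrow>\<^sub>C ('v \<times> 'v))" where
  "sol x = (THE Z. Z \<in> Adm \<and> T x Z = Z)"

lemma sol:
  assumes "snd x \<in> P"
  shows "sol x \<in> Adm" "T x (sol x) = sol x"
  using theI'[OF fixpoint[OF assms]] unfolding sol_def by auto

text \<open>The parameter term of \<open>T_lip\<close> is amplified by 1/(1 - 1/2) = 2 in passing to
  the fixed points.\<close>

lemma sol_lip:
  assumes "snd x \<in> P" "snd x' \<in> P"
  shows "dist (sol x) (sol x') \<le> 2 * \<kappa> * DD x x'"
  using T_lip[OF sol(1)[OF assms(1)] sol(1)[OF assms(2)] assms] unfolding sol(2)[OF assms(1)] sol(2)[OF assms(2)]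
  by simp

lemma sol_eq:
  assumes x: "snd x \<in> P" and t: "t \<ge> 1"
  shows "uz (sol x) t = U_of x (uz (sol x)) (vz (sol x)) t" "vz (sol x) t = V_of x (uz (sol x)) (vz (sol x)) t"
proof -
  have e: "apply_bcontfun (sol x) t = TT x (sol x) t"
    using T_apply[OF sol(1)[OF x] x, of t] t by (simp add: sol(2)[OF x] max_def)
  have "t powr (1 - l) * t powr (l - 1) = 1" "t powr (- l) * t powr l = 1"
    using t by (auto simp: powr_add[symmetric])
  thus "uz (sol x) t = U_of x (uz (sol x)) (vz (sol x)) t" "vz (sol x) t = V_of x (uz (sol x)) (vz (sol x)) t"
    using M1 unfolding uz_def[of "sol x" t] vz_def[of "sol x" t] e TT_def by auto
qed

definition orbit :: "'v \<times> 'v \<Rightarrow> real \<Rightarrow> 'v \<times> 'v" where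
  "orbit x t = (fst x + (t - 1) *\<^sub>R \<omega> (snd x) + uz (sol x) t, snd x + vz (sol x) t)"

lemma orbit_in_B: "snd x \<in> P \<Longrightarrow> t \<ge> 1 \<Longrightarrow> snd (orbit x t) \<in> B"
  using PB[OF _ admD(2)[OF adm_uz_vz[OF sol(1)]]] by (simp add: orbit_def)

lemma orbit_derivative:
  assumes x: "snd x \<in> P" and t: "t \<ge> 1"
  shows "(orbit x has_vector_derivative
     (a (fst (orbit x t)) (snd (orbit x t)) t, b (fst (orbit x t)) (snd (orbit x t)) t)) (at t within {1..})"
proof -
  let ?u = "uz (sol x)" and ?v = "vz (sol x)"
  note d = UV_derivative[OF adm_uz_vz[OF sol(1)[OF x]] x t]
  have du: "(?u has_vector_derivative ap x ?u ?v t) (at t within {1..})"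
    by (rule has_vector_derivative_transform[OF _ _ d(1)]) (use t sol_eq[OF x] in auto)
  have dv: "(?v has_vector_derivative bp x ?u ?v t) (at t within {1..})"
    by (rule has_vector_derivative_transform[OF _ _ d(2)]) (use t sol_eq[OF x] in auto)
  have "((\<lambda>t. (fst x + (t - 1) *\<^sub>R \<omega> (snd x) + ?u t, snd x + ?v t)) has_vector_derivative
      (\<omega> (snd x) + ap x ?u ?v t, bp x ?u ?v t)) (at t within {1..})"
    using du dv by (auto intro!: has_vector_derivative_Pair derivative_eq_intros)
  thus ?thesis by (simp add: orbit_def[abs_def] ap_def bp_def)
qed

lemma orbit_limit:
  assumes x: "snd x \<in> P"
  shows "((\<lambda>t. norm (orbit x t - (fst x + (t - 1) *\<^sub>R \<omega> (snd x), snd x))) \<longlongrightarrow> 0) at_top"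
proof (rule tendsto_sandwich[OF _ _ tendsto_const])
  have n: "norm (orbit x t - (fst x + (t - 1) *\<^sub>R \<omega> (snd x), snd x)) \<le> C * \<rho> * t powr (- l) + \<rho> * t powr (- l - 1)"
    if t: "t \<ge> 1" for t
  proof -
    have "norm (orbit x t - (fst x + (t - 1) *\<^sub>R \<omega> (snd x), snd x)) \<le> norm (uz (sol x) t) + norm (vz (sol x) t)"
      unfolding orbit_def by (simp add: norm_Pair_le)
    thus ?thesis
      using UV_bound(1)[OF adm_uz_vz[OF sol(1)[OF x]] x t] admD(1)[OF adm_uz_vz[OF sol(1)[OF x]] t] sol_eq(1)[OF x t]
      by simp
  qed
  show "\<forall>\<^sub>F t in at_top. norm (orbit x t - (fst x + (t - 1) *\<^sub>R \<omega> (snd x), snd x)) \<le> C * \<rho> * t powr (- l) + \<rho> * t powr (- l - 1)"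
    using eventually_ge_at_top[of 1] by eventually_elim (rule n)
  have "((\<lambda>t::real. t powr (- l)) \<longlongrightarrow> 0) at_top" "((\<lambda>t::real. t powr (- l - 1)) \<longlongrightarrow> 0) at_top"
    using l by (auto intro!: tendsto_neg_powr filterlim_ident)
  from tendsto_add[OF tendsto_mult_left[OF this(1), of "C * \<rho>"] tendsto_mult_left[OF this(2), of \<rho>]]
  show "((\<lambda>t. C * \<rho> * t powr (- l) + \<rho> * t powr (- l - 1)) \<longlongrightarrow> 0) at_top" by simp
qed auto

text \<open>At time 1 all powers of t equal 1, so the deviation from the identity is read off the
  fixed point itself. The factor 8 is 2 for the two components, 2 from \<open>sol_lip\<close>, and 2
  for the sum of the component norms in \<open>DD\<close> against the norm of the pair.\<close>

lemma orbit_initial_lip: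
  assumes x: "snd x \<in> P" "snd x' \<in> P"
  shows "norm ((orbit x 1 - x) - (orbit x' 1 - x')) \<le> 8 * \<kappa> * (1 + C) * norm (x - x')"
proof -
  have e: "orbit y 1 - y = (fst (apply_bcontfun (sol y) 1), (1 / M) *\<^sub>R snd (apply_bcontfun (sol y) 1))" for y
    by (simp add: orbit_def uz_def vz_def prod_eq_iff)
  let ?z = "apply_bcontfun (sol x) 1 - apply_bcontfun (sol x') 1"
  have "norm ((orbit x 1 - x) - (orbit x' 1 - x')) \<le> norm (fst ?z) + norm ((1 / M) *\<^sub>R snd ?z)"
    unfolding e by (simp add: norm_Pair_le scaleR_diff_right)
  also have "\<dots> \<le> norm ?z + norm ?z"
  proof (intro add_mono)
    show "norm (fst ?z) \<le> norm ?z" using dist_fst_le[of ?z 0] by simp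
    have "norm ((1 / M) *\<^sub>R snd ?z) = norm (snd ?z) / M" using M1 by simp
    also have "\<dots> \<le> norm (snd ?z)" using M1 by (intro divide_le_self) auto
    also have "\<dots> \<le> norm ?z" using dist_snd_le[of ?z 0] by simp
    finally show "norm ((1 / M) *\<^sub>R snd ?z) \<le> norm ?z" .
  qed
  also have "\<dots> \<le> 2 * (2 * \<kappa> * DD x x')"
    using order_trans[OF dist_bounded sol_lip[OF x], of 1] by (simp add: dist_norm)
  also have "\<dots> \<le> 2 * (2 * \<kappa> * ((1 + C) * (norm (x - x') + norm (x - x'))))"
    unfolding DD_def using \<kappa>0 C dist_fst_le[of "x - x'" 0] dist_snd_le[of "x - x'" 0]
    by (intro mult_left_mono add_mono) auto
  finally show ?thesis by simp
qed

text \<open>Periodicity makes the operators for \<open>x\<close> and \<open>x + (m, 0)\<close> agree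
  on \<open>Adm\<close>, so that they have the same fixed point; the translation survives only in
  the linear part of the orbit.\<close>

lemma orbit_periodic:
  assumes per: "\<And>q p t. p \<in> B \<Longrightarrow> a (q + m) p t = a q p t" "\<And>q p t. p \<in> B \<Longrightarrow> b (q + m) p t = b q p t"
    and x: "snd x \<in> P"
  shows "orbit (x + (m, 0)) t = orbit x t + (m, 0)"
proof -
  let ?x = "x + (m, 0)"
  have "ap ?x u v s = ap x u v s \<and> bp ?x u v s = bp x u v s" if "adm u v" "s \<ge> 1" for u v s
  proof -
    have B: "snd x + v s \<in> B" using PB[OF x admD(2)[OF that]] .
    have "fst ?x + (s - 1) *\<^sub>R \<omega> (snd ?x) + u s = (fst x + (s - 1) *\<^sub>R \<omega> (snd x) + u s) + m" by simp
    thus ?thesis unfolding ap_def bp_def by (simp only: per[OF B] snd_add snd_conv add_0_right)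
  qed
  hence "U_of ?x u v s = U_of x u v s \<and> V_of ?x u v s = V_of x u v s" if "adm u v" "s \<ge> 1" for u v s
    unfolding U_of_def V_of_def using that by (auto intro!: integral_cong)
  hence "TT ?x Z (max 1 t) = TT x Z (max 1 t)" if "Z \<in> Adm" for Z t
    unfolding TT_def using adm_uz_vz[OF that] max.cobounded1[of 1 t] by simp
  hence "T ?x Z = T x Z" if "Z \<in> Adm" for Z
    unfolding T_def using that by simp
  hence "(Z \<in> Adm \<and> T ?x Z = Z) = (Z \<in> Adm \<and> T x Z = Z)" for Z by metis
  hence "sol ?x = sol x" unfolding sol_def by simp
  thus ?thesis by (simp add: orbit_def)
qed

end

subsection \<open>Measure of images under maps close to the identity\<close>

lemma open_cover_lebesgue:
  fixes S :: "'a::euclidean_space set"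
  assumes S: "S \<in> lmeasurable" and "e > 0"
  obtains T where "open T" "S \<subseteq> T" "emeasure lebesgue T \<le> emeasure lebesgue S + ennreal e"
proof -
  obtain T where T: "open T" "S \<subseteq> T" "(T - S) \<in> lmeasurable" "emeasure lebesgue (T - S) < ennreal e"
    using sets_lebesgue_outer_open[of S e] fmeasurableD[OF S] \<open>e > 0\<close> by metis
  have "emeasure lebesgue T = emeasure lebesgue (S \<union> (T - S))" using T(2) by (simp add: Un_absorb1)
  also have "\<dots> \<le> emeasure lebesgue S + emeasure lebesgue (T - S)"
    using S T(3) by (intro emeasure_subadditive) auto
  finally have "emeasure lebesgue T \<le> emeasure lebesgue S + ennreal e"
    using T(4) by (meson add_left_mono less_imp_le order_trans)
  thus ?thesis using T that by blast
qed

text \<open>The indicator of the union is at most the sum of the indicators, and the two integrals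
  are exchanged. The counting measure is convenient because the index sets that occur, cubes and
  lattice vectors, come without an enumeration.\<close>

lemma emeasure_UN_countable_le:
  assumes I: "countable I" and X: "\<And>i. i \<in> I \<Longrightarrow> X i \<in> sets M"
  shows "emeasure M (\<Union>i\<in>I. X i) \<le> (\<integral>\<^sup>+i. emeasure M (X i) \<partial>count_space I)"
proof -
  have "emeasure M (\<Union>i\<in>I. X i) = (\<integral>\<^sup>+x. indicator (\<Union>i\<in>I. X i) x \<partial>M)"
    using I X by (intro nn_integral_indicator[symmetric] sets.countable_UN'') auto
  also have "\<dots> \<le> (\<integral>\<^sup>+x. \<integral>\<^sup>+i. indicator (if i \<in> I then X i else {}) x \<partial>count_space I \<partial>M)"
  proof (rule nn_integral_mono)
    fix x
    show "indicator (\<Union>i\<in>I. X i) x \<le> (\<integral>\<^sup>+i. indicator (if i \<in> I then X i else {}) x \<partial>count_space I)"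
    proof (cases "x \<in> (\<Union>i\<in>I. X i)")
      case True
      then obtain i where i: "i \<in> I" "x \<in> X i" by blast
      show ?thesis
        using nn_integral_ge_point[OF i(1), of "\<lambda>i. indicator (if i \<in> I then X i else {}) x"] i True by simp
    qed simp
  qed
  also have "\<dots> = (\<integral>\<^sup>+i. \<integral>\<^sup>+x. indicator (if i \<in> I then X i else {}) x \<partial>M \<partial>count_space I)"
    using I X by (intro nn_integral_count_space_nn_integral) auto
  also have "\<dots> = (\<integral>\<^sup>+i. emeasure M (X i) \<partial>count_space I)"
    using X by (intro nn_integral_cong) auto
  finally show ?thesis .
qed

text \<open>The image of a cube of side \<open>d\<close> has extent at most \<open>\<lambda> d\<close> in every coordinate direction, so that
  covering by cubes yields the sharp constant \<open>\<lambda> ^ DIM('a)\<close>.\<close>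

lemma emeasure_image_sup_Lipschitz:
  fixes g :: "'a::euclidean_space \<Rightarrow> 'a"
  assumes S: "S \<in> lmeasurable" "bounded S" and gS: "g ` S \<in> sets lebesgue" and "0 \<le> L"
    and lip: "\<And>x y r. x \<in> S \<Longrightarrow> y \<in> S \<Longrightarrow> (\<And>j. j \<in> Basis \<Longrightarrow> \<bar>(x - y) \<bullet> j\<bar> \<le> r) \<Longrightarrow>
       (\<And>j. j \<in> Basis \<Longrightarrow> \<bar>(g x - g y) \<bullet> j\<bar> \<le> L * r)"
  shows "emeasure lebesgue (g ` S) \<le> ennreal (L ^ DIM('a)) * emeasure lebesgue S"
proof (rule ennreal_le_epsilon)
  fix e0 :: real assume "0 < e0"
  \<comment> \<open>The excess \<open>e\<close> of the open cover will be multiplied by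
    \<open>L ^ DIM('a)\<close>; the added 1 keeps the quotient meaningful for
    \<open>L = 0\<close>.\<close>
  define e where "e = e0 / (L ^ DIM('a) + 1)"
  have e: "0 < e" using \<open>0 < e0\<close> \<open>0 \<le> L\<close> by (simp add: e_def add_nonneg_pos)
  obtain T where T: "open T" "S \<subseteq> T" "emeasure lebesgue T \<le> emeasure lebesgue S + ennreal e"
    using open_cover_lebesgue[OF S(1) e] .
  obtain R where R: "S \<subseteq> ball 0 R" "R > 0"
    using S(2) by (metis bounded_subset_ballD)
  define lo hi :: 'a where "lo = - R *\<^sub>R One" and "hi = R *\<^sub>R One"
  have sub: "S \<subseteq> cbox lo hi"
  proof
    fix x assume "x \<in> S"
    hence "norm x < R" using R by auto
    hence "\<bar>x \<bullet> j\<bar> \<le> R" if "j \<in> Basis" for j using Basis_le_norm[OF that, of x] by linarith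
    thus "x \<in> cbox lo hi" by (auto simp: mem_box lo_def hi_def abs_le_iff minus_le_iff)
  qed
  have ne: "box lo hi \<noteq> {}" using R by (auto simp: box_ne_empty lo_def hi_def)
  \<comment> \<open>At points of \<open>S\<close> the gauge is the open set \<open>T\<close>, which
    forces the boxes of the covering into \<open>T\<close>.\<close>
  obtain \<gamma> where \<gamma>: "\<And>x. x \<in> S \<Longrightarrow> x \<in> \<gamma> x \<and> \<gamma> x \<subseteq> T" "gauge \<gamma>"
  proof -
    have "gauge (\<lambda>x. if x \<in> T then T else UNIV)" using T(1) by (auto simp: gauge_def)
    moreover have "x \<in> (if x \<in> T then T else UNIV) \<and> (if x \<in> T then T else UNIV) \<subseteq> T" if "x \<in> S" for x
      using that T(2) by auto
    ultimately show ?thesis using that[of "\<lambda>x. if x \<in> T then T else UNIV"] by blast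
  qed
  obtain \<D> where \<D>: "countable \<D>" "\<Union>\<D> \<subseteq> cbox lo hi"
    "\<And>K. K \<in> \<D> \<Longrightarrow> interior K \<noteq> {} \<and> (\<exists>c d. K = cbox c d)"
    "pairwise (\<lambda>A B. interior A \<inter> interior B = {}) \<D>"
    "\<And>K. K \<in> \<D> \<Longrightarrow> \<exists>x \<in> S \<inter> K. K \<subseteq> \<gamma> x"
    "\<And>u v. cbox u v \<in> \<D> \<Longrightarrow> \<exists>n. \<forall>i \<in> Basis. v \<bullet> i - u \<bullet> i = (hi \<bullet> i - lo \<bullet> i) / 2 ^ n"
    "S \<subseteq> \<Union>\<D>"
    by (rule covering_lemma[OF sub ne \<gamma>(2)]) blast
  have box: "\<exists>c. g ` (S \<inter> K) \<subseteq> c \<and> c \<in> sets lebesgue \<and>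
      emeasure lebesgue c \<le> ennreal (L ^ DIM('a)) * emeasure lebesgue K" if K: "K \<in> \<D>" for K
  proof -
    obtain u v where uv: "K = cbox u v" "interior K \<noteq> {}" using \<D>(3)[OF K] by blast
    obtain n :: nat where n: "\<And>i. i \<in> Basis \<Longrightarrow> v \<bullet> i - u \<bullet> i = (hi \<bullet> i - lo \<bullet> i) / 2 ^ n"
      using \<D>(6)[of u v] K uv by blast
    \<comment> \<open>\<open>box lo hi\<close> is a cube of side \<open>2 * R\<close>, so each
      dyadic box of the covering is again a cube, here of side \<open>d\<close>. This is what turns
      a bound in the sup norm into a bound for volumes.\<close>
    define d where "d = 2 * R / 2 ^ n"
    have d: "d > 0" "\<And>i. i \<in> Basis \<Longrightarrow> v \<bullet> i - u \<bullet> i = d"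
      using R n by (auto simp: d_def lo_def hi_def)
    have eK: "emeasure lebesgue K = ennreal (d ^ DIM('a))"
    proof -
      have "u \<bullet> b \<le> v \<bullet> b" if "b \<in> Basis" for b using d(1) d(2)[OF that] by simp
      hence "emeasure lborel (cbox u v) = (\<Prod>b\<in>Basis. (v - u) \<bullet> b)" by (rule emeasure_lborel_cbox)
      also have "(\<Prod>b\<in>Basis. (v - u) \<bullet> b) = d ^ DIM('a)" using d(2) by (simp add: inner_diff_left)
      finally show ?thesis by (simp add: uv)
    qed
    \<comment> \<open>The coordinatewise infimum is the lower corner of the smallest box around the
      image; its extents being at most \<open>L * d\<close>, the cube of that side at
      \<open>c\<close> contains the image.\<close>
    define c where "c = (\<Sum>j\<in>Basis. (INF x\<in>S \<inter> K. g x \<bullet> j) *\<^sub>R j)"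
    have ext: "\<bar>(g x - g y) \<bullet> j\<bar> \<le> L * d" if "x \<in> S \<inter> K" "y \<in> S \<inter> K" "j \<in> Basis" for x y j
    proof (rule lip)
      fix i :: 'a assume i: "i \<in> Basis"
      have "u \<bullet> i \<le> x \<bullet> i" "x \<bullet> i \<le> v \<bullet> i" "u \<bullet> i \<le> y \<bullet> i" "y \<bullet> i \<le> v \<bullet> i"
        using that i uv by (auto simp: mem_box)
      thus "\<bar>(x - y) \<bullet> i\<bar> \<le> d" using d(2)[OF i] by (simp add: inner_diff_left)
    qed (use that in auto)
    have "g ` (S \<inter> K) \<subseteq> cbox c (c + (L * d) *\<^sub>R One)"
    proof (clarsimp simp: mem_box)
      fix x j assume x: "x \<in> S" "x \<in> K" and j: "j \<in> (Basis :: 'a set)"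
      have c: "c \<bullet> j = (INF x\<in>S \<inter> K. g x \<bullet> j)" using j by (simp add: c_def)
      have bb: "g x \<bullet> j - L * d \<le> g y \<bullet> j" if "y \<in> S \<inter> K" for y
        using ext[OF _ that j, of x] x by (simp add: inner_diff_left abs_le_iff)
      have "c \<bullet> j \<le> g x \<bullet> j" unfolding c
        using x bb by (intro cINF_lower) (auto simp: bdd_below_def)
      moreover have "g x \<bullet> j - L * d \<le> c \<bullet> j" unfolding c
        using x bb by (intro cINF_greatest) auto
      ultimately show "c \<bullet> j \<le> g x \<bullet> j \<and> g x \<bullet> j \<le> (c + (L * d) *\<^sub>R One) \<bullet> j"
        using j by (simp add: inner_add_left)
    qed
    moreover have "emeasure lebesgue (cbox c (c + (L * d) *\<^sub>R One)) = ennreal (L ^ DIM('a)) * emeasure lebesgue K"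
    proof -
      have "emeasure lborel (cbox c (c + (L * d) *\<^sub>R One)) = (\<Prod>b\<in>Basis. ((c + (L * d) *\<^sub>R One) - c) \<bullet> b)"
        using d \<open>0 \<le> L\<close> by (intro emeasure_lborel_cbox) (auto simp: inner_add_left)
      also have "\<dots> = ennreal ((L * d) ^ DIM('a))" by simp
      finally show ?thesis using eK d \<open>0 \<le> L\<close> by (simp add: power_mult_distrib ennreal_mult)
    qed
    ultimately show ?thesis by (intro exI[of _ "cbox c (c + (L * d) *\<^sub>R One)"]) auto
  qed
  then obtain c where c: "\<And>K. K \<in> \<D> \<Longrightarrow> g ` (S \<inter> K) \<subseteq> c K" "\<And>K. K \<in> \<D> \<Longrightarrow> c K \<in> sets lebesgue"
    "\<And>K. K \<in> \<D> \<Longrightarrow> emeasure lebesgue (c K) \<le> ennreal (L ^ DIM('a)) * emeasure lebesgue K" by metis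
  have "g ` S \<subseteq> (\<Union>K\<in>\<D>. c K)" using \<D>(7) c(1) by blast
  hence "emeasure lebesgue (g ` S) \<le> emeasure lebesgue (\<Union>K\<in>\<D>. c K)"
    using c(2) \<D>(1) by (intro emeasure_mono sets.countable_UN') auto
  also have "\<dots> \<le> (\<integral>\<^sup>+K. emeasure lebesgue (c K) \<partial>count_space \<D>)"
    using c(2) \<D>(1) by (intro emeasure_UN_countable_le) auto
  also have "\<dots> \<le> (\<integral>\<^sup>+K. ennreal (L ^ DIM('a)) * emeasure lebesgue K \<partial>count_space \<D>)"
    using c(3) by (intro nn_integral_mono) auto
  also have "\<dots> = ennreal (L ^ DIM('a)) * (\<integral>\<^sup>+K. emeasure lebesgue K \<partial>count_space \<D>)"
    by (rule nn_integral_cmult) auto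
  also have "(\<integral>\<^sup>+K. emeasure lebesgue K \<partial>count_space \<D>) \<le> emeasure lebesgue T"
  proof -
    have "(\<integral>\<^sup>+K. emeasure lebesgue K \<partial>count_space \<D>) = (\<integral>\<^sup>+K. emeasure lebesgue (interior K) \<partial>count_space \<D>)"
    proof (intro nn_integral_cong)
      fix K assume "K \<in> space (count_space \<D>)"
      then obtain u v where "K = cbox u v" using \<D>(3)[of K] by auto
      thus "emeasure lebesgue K = emeasure lebesgue (interior K)"
        by (simp add: emeasure_lborel_cbox_eq emeasure_lborel_box_eq)
    qed
    also have "\<dots> = emeasure lebesgue (\<Union>K\<in>\<D>. interior K)"
      using \<D>(1,4) by (intro emeasure_UN_countable[symmetric]) (auto simp: disjoint_family_on_def pairwise_def)
    also have "\<dots> \<le> emeasure lebesgue T"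
    proof (intro emeasure_mono)
      show "(\<Union>K\<in>\<D>. interior K) \<subseteq> T" using \<D>(5) \<gamma>(1) interior_subset by fast
    qed (use T(1) in auto)
    finally show ?thesis .
  qed
  also have "ennreal (L ^ DIM('a)) * emeasure lebesgue T \<le> ennreal (L ^ DIM('a)) * (emeasure lebesgue S + ennreal e)"
    using T(3) by (intro mult_left_mono) auto
  also have "\<dots> = ennreal (L ^ DIM('a)) * emeasure lebesgue S + ennreal (L ^ DIM('a) * e)"
    using \<open>0 \<le> L\<close> e by (simp add: distrib_left ennreal_mult)
  also have "\<dots> \<le> ennreal (L ^ DIM('a)) * emeasure lebesgue S + ennreal e0"
  proof (intro add_left_mono ennreal_leI)
    have p: "0 \<le> L ^ DIM('a)" using \<open>0 \<le> L\<close> by simp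
    have "L ^ DIM('a) * e0 \<le> (L ^ DIM('a) + 1) * e0" using \<open>0 < e0\<close> by (intro mult_right_mono) auto
    thus "L ^ DIM('a) * e \<le> e0" using p unfolding e_def by (simp add: divide_le_eq mult.commute)
  qed
  finally show "emeasure lebesgue (g ` S) \<le> ennreal (L ^ DIM('a)) * emeasure lebesgue S + ennreal e0"
    by (simp add: mult_left_mono)
qed

subsection \<open>Translations by the lattice\<close>

definition unit_cell :: "(real^'n) set" where
  "unit_cell = {q. \<forall>i. 0 \<le> q $ i \<and> q $ i < 1}"

lemma torus_leb_unit_cell: "torus_leb S = emeasure lebesgue (S \<inter> unit_cell \<times> UNIV)"
  by (simp add: torus_leb_def unit_cell_def)

lemma lattice_vecs_uminus: "m \<in> lattice_vecs \<Longrightarrow> - m \<in> lattice_vecs"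
  by (simp add: lattice_vecs_def)

lemma zero_in_lattice_vecs: "0 \<in> lattice_vecs"
  by (simp add: lattice_vecs_def)

lemma countable_lattice_vecs: "countable (lattice_vecs :: (real^'n::finite) set)"
proof -
  have "(lattice_vecs :: (real^'n) set) \<subseteq> (\<lambda>f. \<chi> i. of_int (f i)) ` (UNIV :: ('n \<Rightarrow> int) set)"
  proof
    fix m :: "real^'n" assume "m \<in> lattice_vecs"
    hence "m = (\<chi> i. of_int \<lfloor>m $ i\<rfloor>)" by (auto simp: lattice_vecs_def vec_eq_iff elim!: Ints_cases)
    thus "m \<in> (\<lambda>f. \<chi> i. of_int (f i)) ` UNIV"
      by (rule image_eqI[where x="\<lambda>i. \<lfloor>m $ i\<rfloor>"]) simp
  qed
  thus ?thesis by (rule countable_subset) simp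
qed

lemma unit_cell_representative:
  obtains m where "m \<in> lattice_vecs" "q - m \<in> unit_cell"
proof -
  have "(\<chi> i. of_int \<lfloor>q $ i\<rfloor>) \<in> lattice_vecs" by (simp add: lattice_vecs_def)
  moreover have "q - (\<chi> i. of_int \<lfloor>q $ i\<rfloor>) \<in> unit_cell"
    by (auto simp: unit_cell_def) linarith
  ultimately show ?thesis using that by blast
qed

lemma unit_cell_unique:
  assumes "q \<in> unit_cell" "q + m \<in> unit_cell" "m \<in> lattice_vecs"
  shows "m = 0"
proof -
  have "m $ i = 0" for i
  proof -
    obtain k :: int where k: "m $ i = of_int k" using assms(3) by (auto simp: lattice_vecs_def elim: Ints_cases)
    have "0 \<le> q $ i" "q $ i < 1" "0 \<le> q $ i + m $ i" "q $ i + m $ i < 1"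
      using assms(1,2) by (auto simp: unit_cell_def)
    hence "of_int (-1) < m $ i" "m $ i < of_int 1" by simp_all
    hence "-1 < k" "k < 1" unfolding k of_int_less_iff .
    thus ?thesis unfolding k by simp
  qed
  thus ?thesis by (simp add: vec_eq_iff)
qed

lemma box_subset_unit_cell: "box 0 1 \<subseteq> unit_cell" "unit_cell \<subseteq> cbox 0 (1 :: real^'n::finite)"
  by (auto simp: unit_cell_def mem_box_cart less_imp_le)

lemma unit_cell_borel [measurable]: "(unit_cell :: (real^'n::finite) set) \<in> sets borel"
proof -
  have "unit_cell = (\<Inter>i. {q :: real^'n. 0 \<le> q $ i} \<inter> {q. q $ i < 1})"
    by (auto simp: unit_cell_def)
  also have "\<dots> \<in> sets borel"
    by (intro sets.countable_INT'' sets.Int borel_closed borel_open closed_Collect_le open_Collect_less continuous_intros) auto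
  finally show ?thesis .
qed

lemma emeasure_unit_cell: "emeasure lborel (unit_cell :: (real^'n::finite) set) = 1"
proof (rule antisym)
  have 1: "(\<Prod>b\<in>Basis. ((1 :: real^'n) - 0) \<bullet> b) = 1"
    by (rule prod.neutral) (auto simp: Basis_vec_def inner_axis)
  have le: "(0 :: real^'n) \<bullet> b \<le> 1 \<bullet> b" if "b \<in> Basis" for b
    using that by (auto simp: Basis_vec_def inner_axis)
  have "emeasure lborel (unit_cell :: (real^'n) set) \<le> emeasure lborel (cbox 0 (1 :: real^'n))"
    by (intro emeasure_mono box_subset_unit_cell) auto
  also have "\<dots> = 1" using emeasure_lborel_cbox[OF le] 1 by simp
  finally show "emeasure lborel (unit_cell :: (real^'n) set) \<le> 1" .
  have "1 = emeasure lborel (box 0 (1 :: real^'n))" using emeasure_lborel_box[OF le] 1 by simp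
  also have "\<dots> \<le> emeasure lborel (unit_cell :: (real^'n) set)"
    by (intro emeasure_mono box_subset_unit_cell) auto
  finally show "1 \<le> emeasure lborel (unit_cell :: (real^'n) set)" .
qed

lemma emeasure_unit_cell_times:
  fixes P :: "(real^'n::finite) set"
  assumes "P \<in> sets borel"
  shows "emeasure lebesgue (unit_cell \<times> P :: 'n phase set) = emeasure lebesgue P"
proof -
  have "emeasure lebesgue (unit_cell \<times> P :: 'n phase set) = emeasure (lborel \<Otimes>\<^sub>M lborel) (unit_cell \<times> P :: 'n phase set)"
    using assms by (simp add: lborel_prod borel_Times)
  also have "\<dots> = emeasure lborel (unit_cell :: (real^'n) set) * emeasure lborel P"
    using assms by (intro lborel.emeasure_pair_measure_Times) auto
  also have "\<dots> = emeasure lebesgue P" using assms by (simp add: emeasure_unit_cell)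
  finally show ?thesis .
qed

text \<open>The part of \<open>E\<close> in the unit cell is cut according to a lattice translation
  that leads into \<open>G\<close>. Shifted back, the pieces lie in \<open>G\<close>, and they are
  disjoint because two points of the unit cell never differ by a nonzero lattice vector. Overlaps
  before the shift only increase the estimate.\<close>

lemma emeasure_fundamental_domain:
  fixes E G :: "'n::finite phase set"
  assumes G: "G \<in> sets borel" and cover: "\<And>x. x \<in> E \<Longrightarrow> \<exists>m\<in>lattice_vecs. x - (m, 0) \<in> G"
    and E: "E \<in> sets borel"
  shows "emeasure lebesgue (E \<inter> unit_cell \<times> UNIV) \<le> emeasure lebesgue G"
proof -
  define F where "F = (unit_cell \<times> UNIV :: 'n phase set)"
  have F: "F \<in> sets borel" unfolding F_def by (intro borel_Times) auto
  define A where "A m = F \<inter> (\<lambda>x. x - (m, 0)) -` G" for m :: "real^'n"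
  define A' where "A' m = (\<lambda>x. x + (m, 0)) -` A m" for m
  have bm: "(\<lambda>x. x - y) \<in> borel_measurable borel" "(\<lambda>x. x + y) \<in> borel_measurable borel" for y :: "'n phase"
    by (auto intro!: borel_measurable_continuous_onI continuous_intros)
  have A: "A m \<in> sets borel" for m
    unfolding A_def using F measurable_sets[OF bm(1) G] by auto
  have A': "A' m \<in> sets borel" for m
    unfolding A'_def using measurable_sets[OF bm(2) A] by auto
  have eA: "emeasure lebesgue (A' m) = emeasure lebesgue (A m)" for m
  proof -
    have "A' m = (\<lambda>x. 1 *\<^sub>R x + - (m, 0)) ` A m"
    proof (intro equalityI subsetI)
      fix x assume "x \<in> A' m"
      hence "x + (m, 0) \<in> A m" by (simp add: A'_def)
      thus "x \<in> (\<lambda>x. 1 *\<^sub>R x + - (m, 0)) ` A m" by (rule image_eqI[rotated]) (simp add: prod_eq_iff)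
    next
      fix x assume "x \<in> (\<lambda>x. 1 *\<^sub>R x + - (m, 0)) ` A m"
      then obtain y where "y \<in> A m" "x = 1 *\<^sub>R y + - (m, 0)" by blast
      hence "x + (m, 0) = y" by (simp add: prod_eq_iff)
      thus "x \<in> A' m" using \<open>y \<in> A m\<close> by (simp add: A'_def)
    qed
    thus ?thesis using emeasure_lebesgue_affine[of 1 "- (m, 0)" "A m"] by (simp only:) simp
  qed
  have "E \<inter> F \<subseteq> (\<Union>m\<in>lattice_vecs. A m)"
    using cover by (auto simp: A_def)
  hence "emeasure lebesgue (E \<inter> F) \<le> emeasure lebesgue (\<Union>m\<in>lattice_vecs. A m)"
    using A countable_lattice_vecs by (intro emeasure_mono sets.countable_UN'') auto
  also have "\<dots> \<le> (\<integral>\<^sup>+m. emeasure lebesgue (A m) \<partial>count_space lattice_vecs)"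
    using A by (intro emeasure_UN_countable_le countable_lattice_vecs) auto
  also have "\<dots> = (\<integral>\<^sup>+m. emeasure lebesgue (A' m) \<partial>count_space lattice_vecs)"
    by (simp add: eA)
  also have "\<dots> = emeasure lebesgue (\<Union>m\<in>lattice_vecs. A' m)"
  proof (rule emeasure_UN_countable[symmetric])
    show "disjoint_family_on A' lattice_vecs"
      unfolding disjoint_family_on_def
    proof (intro ballI impI equals0I)
      fix m k x assume mk: "m \<in> lattice_vecs" "k \<in> lattice_vecs" "m \<noteq> k" and "x \<in> A' m \<inter> A' k"
      hence "x + (m, 0) \<in> F" "x + (k, 0) \<in> F" by (auto simp: A'_def A_def)
      hence "fst x + m \<in> unit_cell" "fst x + k \<in> unit_cell" by (simp_all add: F_def mem_Times_iff)
      moreover have "k - m \<in> lattice_vecs" using mk by (simp add: lattice_vecs_def)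
      ultimately show False using unit_cell_unique[of "fst x + m" "k - m"] mk by (simp add: algebra_simps)
    qed
  qed (use A' countable_lattice_vecs in auto)
  also have "\<dots> \<le> emeasure lebesgue G"
    using G by (intro emeasure_mono) (auto simp: A'_def A_def)
  finally show ?thesis by (simp add: F_def)
qed

section \<open>Volume of the image of a lattice-equivariant map close to the identity\<close>

locale near_identity =
  fixes \<Phi> :: "'n::finite phase \<Rightarrow> 'n phase" and P :: "(real^'n) set" and \<delta> :: real
  assumes P: "compact P" and \<delta>: "0 \<le> \<delta>" "\<delta> * real DIM('n phase) < 1"
    and near: "\<And>x y. x \<in> UNIV \<times> P \<Longrightarrow> y \<in> UNIV \<times> P \<Longrightarrow> norm ((\<Phi> x - x) - (\<Phi> y - y)) \<le> \<delta> * norm (x - y)"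
    and equivariant: "\<And>x m. x \<in> UNIV \<times> P \<Longrightarrow> m \<in> lattice_vecs \<Longrightarrow> \<Phi> (x + (m, 0)) = \<Phi> x + (m, 0)"
begin

abbreviation "E \<equiv> (UNIV \<times> P :: 'n phase set)"

lemma \<delta>1: "\<delta> < 1"
proof -
  have "1 \<le> DIM('n phase)" using DIM_positive[where 'a = "'n phase"] by linarith
  hence "real 1 \<le> real DIM('n phase)" by (rule of_nat_mono)
  hence "\<delta> * 1 \<le> \<delta> * real DIM('n phase)" using \<delta>(1) by (intro mult_left_mono) simp_all
  thus ?thesis using \<delta>(2) by simp
qed

lemma norm_lower:
  assumes "x \<in> E" "y \<in> E" shows "(1 - \<delta>) * norm (x - y) \<le> norm (\<Phi> x - \<Phi> y)"
proof -
  have "norm (x - y) \<le> norm (\<Phi> x - \<Phi> y) + norm ((\<Phi> x - x) - (\<Phi> y - y))"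
    using norm_triangle_ineq4[of "\<Phi> x - \<Phi> y" "(\<Phi> x - x) - (\<Phi> y - y)"] by simp
  thus ?thesis using near[OF assms] by (simp add: algebra_simps)
qed

lemma inj: "inj_on \<Phi> E"
proof (rule inj_onI)
  fix x y assume "x \<in> E" "y \<in> E" "\<Phi> x = \<Phi> y"
  hence "(1 - \<delta>) * norm (x - y) \<le> 0" using norm_lower[of x y] by simp
  thus "x = y" using \<delta>1 by (simp add: mult_le_0_iff)
qed

lemma continuous: "continuous_on E \<Phi>"
proof -
  have "(1 + \<delta>)-lipschitz_on E \<Phi>"
  proof (rule lipschitz_onI)
    fix x y assume xy: "x \<in> E" "y \<in> E"
    have "norm (\<Phi> x - \<Phi> y) \<le> norm (x - y) + norm ((\<Phi> x - x) - (\<Phi> y - y))"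
      using norm_triangle_ineq[of "x - y" "(\<Phi> x - x) - (\<Phi> y - y)"] by simp
    thus "dist (\<Phi> x) (\<Phi> y) \<le> (1 + \<delta>) * dist x y" using near[OF xy] by (simp add: dist_norm algebra_simps)
  qed (use \<delta> in simp)
  thus ?thesis by (rule lipschitz_on_continuous_on)
qed

lemma closed_E: "closed E"
  by (rule closed_Times[OF closed_UNIV compact_imp_closed[OF P]])

text \<open>\<open>E\<close> extends over all of q-space, so compactness is not at hand. Instead
  \<open>norm_lower\<close> makes the preimages of a convergent sequence a Cauchy sequence.\<close>

lemma closed_image: "closed (\<Phi> ` E)"
  unfolding closed_sequential_limits
proof (intro allI impI)
  fix y l assume "(\<forall>n. y n \<in> \<Phi> ` E) \<and> y \<longlonglongrightarrow> l"
  hence y: "\<And>n. y n \<in> \<Phi> ` E" "y \<longlonglongrightarrow> l" by blast+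
  hence "\<forall>n. \<exists>x. x \<in> E \<and> y n = \<Phi> x" by blast
  then obtain x where x: "\<And>n. x n \<in> E" "\<And>n. y n = \<Phi> (x n)" by metis
  have "Cauchy x"
  proof (rule metric_CauchyI)
    fix e :: real assume "e > 0"
    hence "(1 - \<delta>) * e > 0" using \<delta>1 by simp
    then obtain N where N: "\<And>m n. m \<ge> N \<Longrightarrow> n \<ge> N \<Longrightarrow> dist (y m) (y n) < (1 - \<delta>) * e"
      using LIMSEQ_imp_Cauchy[OF y(2)] unfolding Cauchy_def by meson
    have "dist (x m) (x n) < e" if "m \<ge> N" "n \<ge> N" for m n
    proof -
      have "(1 - \<delta>) * dist (x m) (x n) < (1 - \<delta>) * e"
        using norm_lower[OF x(1) x(1), of m n] N[OF that] by (simp add: x(2) dist_norm)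
      thus ?thesis using \<delta>1 by simp
    qed
    thus "\<exists>M. \<forall>m\<ge>M. \<forall>n\<ge>M. dist (x m) (x n) < e" by blast
  qed
  then obtain x0 where x0: "x \<longlonglongrightarrow> x0" using Cauchy_convergent_iff convergent_def by blast
  have "x0 \<in> E" using closed_sequentially[OF closed_E] x x0 by blast
  have "(\<lambda>n. \<Phi> (x n)) \<longlonglongrightarrow> \<Phi> x0"
    using continuous_on_tendsto_compose[OF continuous x0 \<open>x0 \<in> E\<close>] x by simp
  moreover have "y = (\<lambda>n. \<Phi> (x n))" using x(2) by blast
  ultimately have "l = \<Phi> x0" using LIMSEQ_unique[OF y(2)] by metis
  thus "l \<in> \<Phi> ` E" using \<open>x0 \<in> E\<close> by blast
qed

lemma image_translate: "z \<in> \<Phi> ` E \<Longrightarrow> m \<in> lattice_vecs \<Longrightarrow> z + (m, 0) \<in> \<Phi> ` E"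
proof -
  assume "z \<in> \<Phi> ` E" and m: "m \<in> lattice_vecs"
  then obtain x where x: "x \<in> E" "z = \<Phi> x" by blast
  have "x + (m, 0) \<in> E" using x by auto
  thus ?thesis using equivariant[OF x(1) m] x by (metis image_eqI)
qed

text \<open>Cubes are measured in the sup norm while \<open>near\<close> is Euclidean. The change of
  norm costs the factor \<open>DIM('n phase)\<close>, which is absorbed because
  \<open>\<delta> * real DIM('n phase) < 1\<close>. Read for the inverse of \<open>\<Phi>\<close>,
  this is the Lipschitz bound needed for volumes.\<close>

lemma sup_lower:
  assumes xy: "x \<in> E" "y \<in> E" and r: "\<And>j. j \<in> Basis \<Longrightarrow> \<bar>(\<Phi> x - \<Phi> y) \<bullet> j\<bar> \<le> r" and j: "j \<in> Basis"
  shows "\<bar>(x - y) \<bullet> j\<bar> \<le> 1 / (1 - \<delta> * real DIM('n phase)) * r"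
proof -
  let ?d = "real DIM('n phase)"
  define N where "N = Max ((\<lambda>j. \<bar>(x - y) \<bullet> j\<bar>) ` Basis)"
  have N: "\<bar>(x - y) \<bullet> j\<bar> \<le> N" if "j \<in> Basis" for j using that unfolding N_def by (intro Max_ge) auto
  have "norm (x - y) \<le> (\<Sum>j\<in>(Basis :: 'n phase set). \<bar>(x - y) \<bullet> j\<bar>)" by (rule norm_le_l1)
  also have "\<dots> \<le> ?d * N" using N by (intro sum_bounded_above[where K=N, simplified]) auto
  finally have nN: "norm (x - y) \<le> ?d * N" .
  have "N \<in> (\<lambda>j. \<bar>(x - y) \<bullet> j\<bar>) ` Basis" unfolding N_def by (intro Max_in) auto
  then obtain i where i: "i \<in> Basis" "N = \<bar>(x - y) \<bullet> i\<bar>" by blast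
  have "(x - y) \<bullet> i = (\<Phi> x - \<Phi> y) \<bullet> i - ((\<Phi> x - x) - (\<Phi> y - y)) \<bullet> i" by (simp add: inner_diff_left)
  hence "N \<le> \<bar>(\<Phi> x - \<Phi> y) \<bullet> i\<bar> + \<bar>((\<Phi> x - x) - (\<Phi> y - y)) \<bullet> i\<bar>" unfolding i(2) by linarith
  also have "\<dots> \<le> r + \<delta> * (?d * N)"
    using r[OF i(1)] Basis_le_norm[OF i(1), of "(\<Phi> x - x) - (\<Phi> y - y)"] near[OF xy]
      mult_left_mono[OF nN \<delta>(1)] by linarith
  finally have "N * (1 - \<delta> * ?d) \<le> r" by (simp add: algebra_simps)
  hence "N \<le> 1 / (1 - \<delta> * ?d) * r" using \<delta>(2) by (simp add: field_simps)
  thus ?thesis using N[OF j] by linarith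
qed

text \<open>The Lipschitz bound for volumes is applied to the inverse of \<open>\<Phi>\<close> and
  thus estimates the image from below. By equivariance the preimage \<open>G\<close> of the part of
  the image over the unit cell meets every lattice class of \<open>E\<close>, hence is at least as
  large as \<open>P\<close>.\<close>

lemma emeasure_image:
  assumes "bounded (snd ` \<Phi> ` E)"
  shows "emeasure lebesgue P \<le> ennreal ((1 / (1 - \<delta> * real DIM('n phase))) ^ DIM('n phase)) * torus_leb (\<Phi> ` E)"
proof -
  define F where "F = (unit_cell \<times> UNIV :: 'n phase set)"
  have F: "F \<in> sets borel" unfolding F_def by (intro borel_Times) auto
  have EB: "E \<in> sets borel" using closed_E by auto
  define G where "G = {x \<in> E. \<Phi> x \<in> F}"
  \<comment> \<open>\<open>\<Phi>\<close> is known to be continuous on \<open>E\<close> only, so it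
    is cut off by the indicator before measurability is invoked.\<close>
  have "(\<lambda>x. indicator E x *\<^sub>R \<Phi> x) \<in> borel_measurable borel"
    by (rule borel_measurable_continuous_on_indicator[OF EB continuous])
  from measurable_sets[OF this F] have "E \<inter> (\<lambda>x. indicator E x *\<^sub>R \<Phi> x) -` F \<in> sets borel"
    using EB by auto
  moreover have "E \<inter> (\<lambda>x. indicator E x *\<^sub>R \<Phi> x) -` F = G" by (auto simp: G_def)
  ultimately have G: "G \<in> sets borel" by simp
  define S where "S = \<Phi> ` E \<inter> F"
  have S: "S \<in> sets borel" unfolding S_def using closed_image F by auto
  have bS: "bounded S"
  proof -
    have "S \<subseteq> cbox 0 1 \<times> (snd ` \<Phi> ` E)"
    proof
      fix z assume "z \<in> S"
      hence z: "z \<in> \<Phi> ` E" "fst z \<in> unit_cell" by (auto simp: S_def F_def mem_Times_iff)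
      have "snd z \<in> snd ` \<Phi> ` E" using z(1) by (rule imageI)
      thus "z \<in> cbox 0 1 \<times> (snd ` \<Phi> ` E)"
        using subsetD[OF box_subset_unit_cell(2) z(2)] by (simp only: mem_Times_iff)
    qed
    thus ?thesis by (rule bounded_subset[OF bounded_Times[OF bounded_cbox assms]])
  qed
  define \<Psi> where "\<Psi> = inv_into E \<Phi>"
  have \<Psi>: "\<Psi> z \<in> E" "\<Phi> (\<Psi> z) = z" if "z \<in> S" for z
    using that inv_into_into[of z \<Phi> E] f_inv_into_f[of z \<Phi> E] unfolding \<Psi>_def S_def by blast+
  have img: "\<Psi> ` S = G"
  proof
    have "\<Psi> z \<in> G" if "z \<in> S" for z using \<Psi>[OF that] that unfolding G_def S_def by simp
    thus "\<Psi> ` S \<subseteq> G" by blast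
    show "G \<subseteq> \<Psi> ` S"
    proof
      fix x assume x: "x \<in> G"
      hence "x \<in> E" "\<Phi> x \<in> F" by (simp_all add: G_def)
      hence "\<Psi> (\<Phi> x) = x" "\<Phi> x \<in> S" using inv_into_f_f[OF inj, of x] unfolding \<Psi>_def S_def by blast+
      thus "x \<in> \<Psi> ` S" by (metis image_eqI)
    qed
  qed
  have "emeasure lebesgue P = emeasure lebesgue (E \<inter> F)"
    using emeasure_unit_cell_times[of P] compact_imp_closed[OF P] by (simp add: F_def Times_Int_Times borel_closed)
  also have "\<dots> \<le> emeasure lebesgue G"
    unfolding F_def
  proof (rule emeasure_fundamental_domain[OF G _ EB])
    fix x assume x: "x \<in> E"
    obtain m where m: "m \<in> lattice_vecs" "fst (\<Phi> x) - m \<in> unit_cell" by (rule unit_cell_representative)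
    have "\<Phi> (x + (- m, 0)) = \<Phi> x + (- m, 0)" using equivariant[OF x lattice_vecs_uminus[OF m(1)]] .
    moreover have "x + (- m, 0) = x - (m, 0)" by (simp add: prod_eq_iff)
    ultimately have "x - (m, 0) \<in> G" using m x by (simp add: G_def F_def mem_Times_iff)
    thus "\<exists>m\<in>lattice_vecs. x - (m, 0) \<in> G" using m by blast
  qed
  also have "\<dots> \<le> ennreal ((1 / (1 - \<delta> * real DIM('n phase))) ^ DIM('n phase)) * emeasure lebesgue S"
    unfolding img[symmetric]
  proof (rule emeasure_image_sup_Lipschitz)
    show "S \<in> lmeasurable" using S bS by (intro bounded_set_imp_lmeasurable) auto
    show "\<Psi> ` S \<in> sets lebesgue" using G by (simp add: img)
    show "0 \<le> 1 / (1 - \<delta> * real DIM('n phase))" using \<delta>(2) by (intro divide_nonneg_nonneg) linarith+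
    show "\<bar>(\<Psi> x - \<Psi> y) \<bullet> j\<bar> \<le> 1 / (1 - \<delta> * real DIM('n phase)) * r"
      if "x \<in> S" "y \<in> S" "\<And>j. j \<in> Basis \<Longrightarrow> \<bar>(x - y) \<bullet> j\<bar> \<le> r" "j \<in> Basis" for x y r j
    proof (rule sup_lower[OF \<Psi>(1)[OF that(1)] \<Psi>(1)[OF that(2)] _ that(4)])
      show "\<bar>(\<Phi> (\<Psi> x) - \<Phi> (\<Psi> y)) \<bullet> i\<bar> \<le> r" if "i \<in> Basis" for i
        unfolding \<Psi>(2)[OF \<open>x \<in> S\<close>] \<Psi>(2)[OF \<open>y \<in> S\<close>] using \<open>\<And>j. j \<in> Basis \<Longrightarrow> \<bar>(x - y) \<bullet> j\<bar> \<le> r\<close> that .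
    qed
  qed (rule bS)
  finally show ?thesis by (simp add: S_def F_def torus_leb_unit_cell)
qed

end

subsection \<open>Decay estimates\<close>

lemma ennreal_mult_le_imp:
  assumes "x * ennreal w \<le> ennreal \<epsilon>" "0 < w" "0 \<le> \<epsilon>" "ennreal y \<le> x"
  shows "y \<le> \<epsilon> / w"
proof (cases "y \<le> 0")
  case True
  have "0 \<le> \<epsilon> / w" using assms by simp
  thus ?thesis using True by linarith
next
  case False
  have "ennreal (y * w) = ennreal y * ennreal w" using False assms(2) by (simp add: ennreal_mult)
  also have "\<dots> \<le> x * ennreal w" using assms(4) by (rule mult_right_mono) simp
  also have "\<dots> \<le> ennreal \<epsilon>" by (rule assms(1))
  finally have "y * w \<le> \<epsilon>" using assms(3) by (simp add: ennreal_le_iff)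
  thus ?thesis using assms(2) by (simp add: field_simps)
qed

lemma hoelder_norm_upper:
  assumes "bs \<in> multi_indices i" "i \<le> nat \<lfloor>\<sigma>\<rfloor>" "x \<in> S"
  shows "ennreal \<bar>partials bs f x\<bar> \<le> hoelder_norm \<sigma> S f"
proof -
  have "ennreal \<bar>partials bs f x\<bar> \<le> (SUP i\<in>{..nat \<lfloor>\<sigma>\<rfloor>}. SUP bs\<in>multi_indices i. SUP x\<in>S. ennreal \<bar>partials bs f x\<bar>)"
    using assms by (intro SUP_upper2[of i] SUP_upper2[of bs] SUP_upper2[of x] order_refl) auto
  also have "\<dots> \<le> hoelder_norm \<sigma> S f" unfolding hoelder_norm_def by (rule add_increasing2) auto
  finally show ?thesis .
qed

lemma lip_norm_upper:
  assumes "z \<in> E" "x \<in> A" "y \<in> A" "x \<noteq> y"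
  shows "ennreal (\<bar>F z x - F z y\<bar> / dist x y) \<le> lip_norm E A F"
proof -
  have "ennreal (\<bar>F z x - F z y\<bar> / dist x y) \<le> (SUP z\<in>E. SUP x\<in>A. SUP y\<in>A - {x}. ennreal (\<bar>F z x - F z y\<bar> / dist x y))"
    using assms by (intro SUP_upper2[of z] SUP_upper2[of x] SUP_upper2[of y] order_refl) auto
  also have "\<dots> \<le> lip_norm E A F" unfolding lip_norm_def by (rule add_increasing2) auto
  finally show ?thesis .
qed

lemma D_norm_bounds:
  assumes D: "D_norm \<sigma> l A g \<le> ennreal \<epsilon>" and "l \<noteq> 0" "0 \<le> \<epsilon>" and p: "p \<in> A"
  shows "bs \<in> multi_indices i \<Longrightarrow> i \<le> nat \<lfloor>\<sigma>\<rfloor> \<Longrightarrow> \<bar>partials bs (\<lambda>q. g q p t) q\<bar> \<le> \<epsilon> / (1 + \<bar>t\<bar> powr l)"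
    and "p' \<in> A \<Longrightarrow> \<bar>g q p t - g q p' t\<bar> \<le> \<epsilon> / (1 + \<bar>t\<bar> powr (l - 1)) * dist p p'"
proof -
  have w: "0 < 1 + \<bar>t\<bar> powr s" for s by (simp add: add_pos_nonneg)
  have eq: "D_norm \<sigma> l A g = (SUP p\<in>A. SUP t. hoelder_norm \<sigma> UNIV (\<lambda>q. g q p t) * ennreal (1 + \<bar>t\<bar> powr l)) +
        (SUP t. lip_norm UNIV A (\<lambda>q p. g q p t) * ennreal (1 + \<bar>t\<bar> powr (l - 1)))"
    using assms(2) by (simp add: D_norm_def)
  have "hoelder_norm \<sigma> UNIV (\<lambda>q. g q p t) * ennreal (1 + \<bar>t\<bar> powr l) \<le>
      (SUP p\<in>A. SUP t. hoelder_norm \<sigma> UNIV (\<lambda>q. g q p t) * ennreal (1 + \<bar>t\<bar> powr l))"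
    using p by (intro SUP_upper2[of p] SUP_upper2[of t] order_refl) auto
  also have "\<dots> \<le> D_norm \<sigma> l A g" unfolding eq by (rule add_increasing2) auto
  finally have h: "hoelder_norm \<sigma> UNIV (\<lambda>q. g q p t) * ennreal (1 + \<bar>t\<bar> powr l) \<le> ennreal \<epsilon>"
    using D by (rule order_trans)
  have "lip_norm UNIV A (\<lambda>q p. g q p t) * ennreal (1 + \<bar>t\<bar> powr (l - 1)) \<le>
      (SUP t. lip_norm UNIV A (\<lambda>q p. g q p t) * ennreal (1 + \<bar>t\<bar> powr (l - 1)))"
    by (intro SUP_upper2[of t] order_refl) auto
  also have "\<dots> \<le> D_norm \<sigma> l A g" unfolding eq by (rule add_increasing) auto
  finally have L: "lip_norm UNIV A (\<lambda>q p. g q p t) * ennreal (1 + \<bar>t\<bar> powr (l - 1)) \<le> ennreal \<epsilon>"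
    using D by (rule order_trans)
  show "\<bar>partials bs (\<lambda>q. g q p t) q\<bar> \<le> \<epsilon> / (1 + \<bar>t\<bar> powr l)"
    if "bs \<in> multi_indices i" "i \<le> nat \<lfloor>\<sigma>\<rfloor>"
    by (rule ennreal_mult_le_imp[OF h w assms(3) hoelder_norm_upper[OF that]]) simp
  show "\<bar>g q p t - g q p' t\<bar> \<le> \<epsilon> / (1 + \<bar>t\<bar> powr (l - 1)) * dist p p'" if p': "p' \<in> A"
  proof (cases "p = p'")
    case False
    have "\<bar>g q p t - g q p' t\<bar> / dist p p' \<le> \<epsilon> / (1 + \<bar>t\<bar> powr (l - 1))"
      by (rule ennreal_mult_le_imp[OF L w assms(3) lip_norm_upper[OF _ p p' False]]) simp
    thus ?thesis using False by (simp add: divide_le_eq)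
  qed simp
qed

text \<open>The estimate rests on \<open>1 + \<bar>t\<bar> \<le> 2 * max 1 \<bar>t\<bar>\<close>.
  The separate exponent \<open>s'\<close> allows one constant for all decay rates in use.\<close>

lemma weight_bound:
  fixes s s' t :: real
  assumes "0 \<le> s" "s \<le> s'"
  shows "1 / (1 + \<bar>t\<bar> powr s) \<le> 2 powr s' * (1 + \<bar>t\<bar>) powr (- s)"
proof -
  have "(1 + \<bar>t\<bar>) powr s \<le> (2 * max 1 \<bar>t\<bar>) powr s" using assms by (intro powr_mono2) auto
  also have "\<dots> = 2 powr s * max 1 \<bar>t\<bar> powr s" by (rule powr_mult)
  also have "\<dots> \<le> 2 powr s' * (1 + \<bar>t\<bar> powr s)"
    using assms by (intro mult_mono powr_mono) (auto simp: max_def)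
  finally have "(1 + \<bar>t\<bar>) powr s \<le> 2 powr s' * (1 + \<bar>t\<bar> powr s)" .
  moreover have "0 < 1 + \<bar>t\<bar> powr s" "0 < (1 + \<bar>t\<bar>) powr s" by (simp_all add: add_pos_nonneg)
  moreover have "1 / w \<le> c / v" if "0 < w" "0 < v" "v \<le> c * w" for w v c :: real
    using that by (simp add: field_simps)
  ultimately have "1 / (1 + \<bar>t\<bar> powr s) \<le> 2 powr s' / (1 + \<bar>t\<bar>) powr s" by blast
  thus ?thesis by (simp add: powr_minus divide_inverse)
qed

text \<open>The anisotropy is that of the weighted norms: differences in q decay like the function
  itself, differences in p one power more slowly.\<close>

definition decays :: "(real^'n) set \<Rightarrow> real \<Rightarrow> real \<Rightarrow> 'n observable \<Rightarrow> bool" where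
  "decays B s E g \<longleftrightarrow> (\<forall>q. \<forall>p\<in>B. \<forall>t. \<bar>g q p t\<bar> \<le> E * (1 + \<bar>t\<bar>) powr (- s)) \<and>
     (\<forall>q q'. \<forall>p\<in>B. \<forall>p'\<in>B. \<forall>t. \<bar>g q p t - g q' p' t\<bar> \<le>
        E * (1 + \<bar>t\<bar>) powr (- s) * norm (q - q') + E * (1 + \<bar>t\<bar>) powr (1 - s) * norm (p - p'))"

text \<open>As \<sigma> is at least 1, the Hoelder part of the norm bounds the q-gradient with the
  full weight; the factor \<open>CARD('n)\<close> arises in passing from the partial derivatives to
  a Lipschitz bound. The p-differences are read off the Lipschitz part of the norm.\<close>

lemma D_norm_decays:
  fixes g :: "'n::finite observable"
  assumes D: "D_norm \<sigma> s A g \<le> ennreal \<epsilon>" and s: "1 < s" "s \<le> s'" and \<sigma>: "1 \<le> \<sigma>" and "0 \<le> \<epsilon>"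
    and reg: "\<And>p t. p \<in> A \<Longrightarrow> Ck_on 1 UNIV (\<lambda>q. g q p t)"
  shows "decays A s (2 powr s' * real CARD('n) * \<epsilon>) g"
proof -
  have s0: "s \<noteq> 0" using s by simp
  note b = D_norm_bounds[OF D s0 \<open>0 \<le> \<epsilon>\<close>]
  have n: "1 \<le> real CARD('n)" by (simp add: Suc_leI)
  define E where "E = 2 powr s' * real CARD('n) * \<epsilon>"
  have floor: "1 \<le> nat \<lfloor>\<sigma>\<rfloor>" using \<sigma> by linarith
  have E1: "\<epsilon> / (1 + \<bar>t\<bar> powr r) * real CARD('n) \<le> E * (1 + \<bar>t\<bar>) powr (- r)" if "0 \<le> r" "r \<le> s" for r t
  proof -
    have "\<epsilon> / (1 + \<bar>t\<bar> powr r) * real CARD('n) = (\<epsilon> * real CARD('n)) * (1 / (1 + \<bar>t\<bar> powr r))" by simp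
    also have "\<dots> \<le> (\<epsilon> * real CARD('n)) * (2 powr s' * (1 + \<bar>t\<bar>) powr (- r))"
      using that s \<open>0 \<le> \<epsilon>\<close> by (intro mult_left_mono weight_bound) auto
    finally show ?thesis by (simp add: E_def mult_ac)
  qed
  have le: "x \<le> x * real CARD('n)" if "0 \<le> x" for x :: real using n that by (simp add: mult_le_cancel_left1)
  have \<epsilon>w: "0 \<le> \<epsilon> / (1 + \<bar>t\<bar> powr r)" for r t using \<open>0 \<le> \<epsilon>\<close> by (simp add: add_nonneg_nonneg)
  have 1: "\<bar>g q p t\<bar> \<le> E * (1 + \<bar>t\<bar>) powr (- s)" if "p \<in> A" for q p t
    using b(1)[OF that Nil_in_multi_indices, of t q] le[OF \<epsilon>w, of t s] E1[of s t] s by auto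
  have 2: "\<bar>g q p t - g q' p t\<bar> \<le> E * (1 + \<bar>t\<bar>) powr (- s) * norm (q - q')" if "p \<in> A" for q q' p t
  proof -
    have "\<bar>g q p t - g q' p t\<bar> \<le> real DIM(real^'n) * (\<epsilon> / (1 + \<bar>t\<bar> powr s)) * dist q q'"
    proof (rule Lipschitz_of_partial_bound[where k=0 and S=UNIV])
      show "Ck_on (Suc 0) UNIV (\<lambda>q. g q p t)" using reg[OF that, of t] by simp
      show "\<bar>partial c (\<lambda>q. g q p t) x\<bar> \<le> \<epsilon> / (1 + \<bar>t\<bar> powr s)" if "c \<in> Basis" for c x
        using b(1)[OF \<open>p \<in> A\<close>, of "[c]" 1 t x] that floor by (simp add: multi_indices_def)
    qed auto
    also have "\<dots> \<le> E * (1 + \<bar>t\<bar>) powr (- s) * norm (q - q')"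
      using mult_right_mono[OF E1[of s t], of "dist q q'"] s by (simp add: dist_norm mult_ac)
    finally show ?thesis .
  qed
  have 3: "\<bar>g q p t - g q p' t\<bar> \<le> E * (1 + \<bar>t\<bar>) powr (1 - s) * norm (p - p')" if "p \<in> A" "p' \<in> A" for q p p' t
  proof -
    have "\<epsilon> / (1 + \<bar>t\<bar> powr (s - 1)) \<le> E * (1 + \<bar>t\<bar>) powr (- (s - 1))"
      using le[OF \<epsilon>w, of t "s - 1"] E1[of "s - 1" t] s by linarith
    from mult_right_mono[OF this, of "dist p p'"] b(2)[OF that, of q t]
    show ?thesis by (simp add: dist_norm)
  qed
  have "\<bar>g q p t - g q' p' t\<bar> \<le>
        E * (1 + \<bar>t\<bar>) powr (- s) * norm (q - q') + E * (1 + \<bar>t\<bar>) powr (1 - s) * norm (p - p')"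
    if "p \<in> A" "p' \<in> A" for q q' p p' t
    using 2[OF that(1), of q t q'] 3[OF that, of q' t] by linarith
  thus ?thesis using 1 unfolding decays_def E_def by blast
qed

lemma floor_add_nat: "1 \<le> \<sigma> \<Longrightarrow> nat \<lfloor>\<sigma> + real k\<rfloor> = nat \<lfloor>\<sigma>\<rfloor> + k"
  by (simp add: nat_add_distrib)

lemma C_sigma_Ck_on: "C_sigma (\<sigma> + real k) S f \<Longrightarrow> 1 \<le> \<sigma> \<Longrightarrow> j \<le> nat \<lfloor>\<sigma>\<rfloor> + k \<Longrightarrow> Ck_on j S f"
  unfolding C_sigma_def using Ck_on_mono floor_add_nat by metis

text \<open>One of the \<open>k\<close> additional derivatives is spent on the Lipschitz bound of
  top order. As \<epsilon> is at most 1 and the weights are at least 1, the constant is the same for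
  all times.\<close>

lemma D_norm_CkLip:
  fixes g :: "'n::finite observable"
  assumes D: "D_norm (\<sigma> + real k) s A g \<le> ennreal \<epsilon>" and s: "s \<noteq> 0" and \<sigma>: "1 \<le> \<sigma>" and e: "0 \<le> \<epsilon>" "\<epsilon> \<le> 1"
    and p: "p \<in> A" and k: "1 \<le> k" and reg: "C_sigma (\<sigma> + real k) UNIV (\<lambda>q. g q p t)"
  shows "CkLip (nat \<lfloor>\<sigma>\<rfloor>) UNIV (real CARD('n)) (\<lambda>q. g q p t)"
proof -
  have "CkLip (nat \<lfloor>\<sigma>\<rfloor>) UNIV (real DIM(real^'n) * 1) (\<lambda>q. g q p t)"
  proof (rule CkLipI)
    show "Ck_on (Suc (nat \<lfloor>\<sigma>\<rfloor>)) UNIV (\<lambda>q. g q p t)" using C_sigma_Ck_on[OF reg \<sigma>] k by simp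
    fix i x and bs :: "(real^'n) list" assume i: "i \<le> Suc (nat \<lfloor>\<sigma>\<rfloor>)" "bs \<in> multi_indices i"
    have "i \<le> nat \<lfloor>\<sigma> + real k\<rfloor>" unfolding floor_add_nat[OF \<sigma>] using i k by simp
    from D_norm_bounds(1)[OF D s e(1) p i(2) this]
    have "\<bar>partials bs (\<lambda>q. g q p t) x\<bar> \<le> \<epsilon> / (1 + \<bar>t\<bar> powr s)" .
    also have "\<dots> \<le> \<epsilon> / 1" using e by (intro divide_left_mono) (auto intro: add_pos_nonneg)
    finally show "\<bar>partials bs (\<lambda>q. g q p t) x\<bar> \<le> 1" using e by simp
  qed auto
  thus ?thesis by simp
qed

subsection \<open>Hamiltonian vector fields\<close>

lemma partial_snd_slice:
  "has_partial (0, e) G (q, p) \<longleftrightarrow> has_partial e (\<lambda>p. G (q, p)) p"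
  "partial (0, e) G (q, p) = partial e (\<lambda>p. G (q, p)) p"
  by (simp_all add: has_partial_def partial_def)

lemma decays_bound:
  assumes "decays B s C g" "p \<in> B"
  shows "\<bar>g q p t\<bar> \<le> C * (1 + \<bar>t\<bar>) powr (- s)"
  using assms(1)[unfolded decays_def, THEN conjunct1, rule_format, OF assms(2)] .

lemma decays_lip:
  assumes "decays B s C g" "p \<in> B" "p' \<in> B"
  shows "\<bar>g q p t - g q' p' t\<bar> \<le>
    C * (1 + \<bar>t\<bar>) powr (- s) * norm (q - q') + C * (1 + \<bar>t\<bar>) powr (1 - s) * norm (p - p')"
  using assms(1)[unfolded decays_def, THEN conjunct2, rule_format, OF assms(2,3)] .

lemma dq_Nil: "dq [] g = g"
  by (simp add: dq_def)

lemma D_bar_spaceD: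
  "g \<in> D_bar_space \<sigma> k A \<Longrightarrow> bs \<in> multi_indices i \<Longrightarrow> i \<le> k \<Longrightarrow> dq bs g \<in> D_space (\<sigma> + real (k - i)) A"
  by (auto simp: D_bar_space_def)

lemma phase_basis_cases:
  assumes "b \<in> (Basis :: 'n::finite phase set)"
  obtains i where "b = (axis i 1, 0)" | i where "b = (0, axis i 1)"
  using assms by (auto simp: Basis_prod_def Basis_vec_def)

lemma axis_in_Basis: "axis i (1::real) \<in> (Basis :: (real^'n::finite) set)"
  by (auto simp: Basis_vec_def)

lemma ham_field_inner:
  "ham_field G z t \<bullet> (axis i 1, 0) = dp [axis i 1] G (fst z) (snd z) t"
  "ham_field G z t \<bullet> (0, axis i 1) = - dq [axis i 1] G (fst z) (snd z) t"
  by (cases z; simp add: ham_field_def inner_axis)+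

lemma ham_field_periodic:
  fixes G :: "'n::finite observable"
  assumes "open B" "q_periodic B G"
  shows "q_periodic B (\<lambda>q p. ham_field G (q, p))"
  unfolding q_periodic_def
proof (intro allI ballI ext)
  fix q p t and m :: "real^'n" assume p: "p \<in> B" and m: "m \<in> lattice_vecs"
  have per: "G (q + m) p = G q p" if "p \<in> B" for q p using assms(2) that m by (simp add: q_periodic_def)
  have "dp [axis i 1] G (q + m) p t = dp [axis i 1] G q p t" for i
    unfolding dp_def partials.simps using per by (intro partial_cong_open(2)[OF assms(1) p]) simp
  moreover have "dq [axis i 1] G (q + m) p t = dq [axis i 1] G q p t" for i
  proof -
    have "(\<lambda>s. G (q + m + s *\<^sub>R axis i 1) p t) = (\<lambda>s. G (q + s *\<^sub>R axis i 1) p t)"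
      using per[OF p, of "q + s *\<^sub>R axis i 1" for s] by (simp add: algebra_simps)
    thus ?thesis by (simp add: dq_def partial_def)
  qed
  ultimately show "ham_field G (q + m, p) t = ham_field G (q, p) t" by (simp add: ham_field_def)
qed

section \<open>The Hamiltonian: decay of the perturbation, bounds on the Hessian, regularity of the
  field\<close>

locale perturbed_hamiltonian =
  fixes \<sigma> \<Upsilon> l \<epsilon> :: real and h :: "real^'n::finite \<Rightarrow> real" and R :: "real^'n \<Rightarrow> real^'n \<Rightarrow> real"
    and f H :: "'n observable" and D :: "(real^'n) set"
  assumes \<sigma>: "\<sigma> \<ge> 1" and \<Upsilon>: "\<Upsilon> \<ge> 1" and l: "l > 1" and \<epsilon>: "0 < \<epsilon>" "\<epsilon> < 1"
    and H_ham: "hamiltonian_on (ball 0 1) H"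
    and H_split: "\<forall>q. \<forall>p\<in>ball 0 1. \<forall>t. H q p t = h p + R q p + f q p t"
    and f_space: "f \<in> D_bar_space \<sigma> 2 (ball 0 1)"
    and f_C1: "\<forall>q t. Ck_on 1 (ball 0 1) (\<lambda>p. f q p t)"
    and fp_space: "\<forall>b\<in>Basis. dp [b] f \<in> D_bar_space \<sigma> 2 (ball 0 1)"
    and f_norm: "D_norm (\<sigma> + 2) 0 (ball 0 1) f
        + (SUP b\<in>Basis. D_bar_norm \<sigma> 1 (l + 2) (ball 0 1) (dq [b] f))
        + (SUP b\<in>Basis. D_bar_norm \<sigma> 2 (l + 1) (ball 0 1) (dp [b] f)) < ennreal \<epsilon>"
    and D: "D \<subseteq> ball 0 1"
    and R_periodic: "q_periodic (ball 0 1) R"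
    and R_C2: "C_sigma 2 (UNIV \<times> ball 0 1) (\<lambda>(q, p). R q p)"
    and R_zero: "\<forall>q. \<forall>p\<in>D. R q p = 0 \<and> (\<forall>b\<in>Basis. partial b (R q) p = 0)"
    and H_C2: "\<forall>q t. Ck_on 2 (ball 0 1) (\<lambda>p. H q p t)"
    and Hpp_reg: "\<forall>b\<in>Basis. \<forall>c\<in>Basis. \<forall>t.
         C_sigma (\<sigma> + 2) (UNIV \<times> ball 0 1) (\<lambda>(q, p). dp [b, c] H q p t)"
    and Hpp_norm: "(SUP t. SUP b\<in>Basis. SUP c\<in>Basis.
         hoelder_norm (\<sigma> + 2) (UNIV \<times> ball 0 1) (\<lambda>(q, p). dp [b, c] H q p t)) \<le> ennreal \<Upsilon>"
begin

abbreviation "BB \<equiv> (ball 0 1 :: (real^'n) set)"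

definition E where "E = 2 powr (l + 2) * real CARD('n) * \<epsilon>"

lemma D_norm_dq:
  assumes "b \<in> Basis" "bs \<in> multi_indices i" "i \<le> 1"
  shows "D_norm (\<sigma> + real (1 - i)) (l + 2) BB (dq bs (dq [b] f)) \<le> ennreal \<epsilon>"
proof -
  have "D_norm (\<sigma> + real (1 - i)) (l + 2) BB (dq bs (dq [b] f)) \<le> (SUP b\<in>Basis. D_bar_norm \<sigma> 1 (l + 2) BB (dq [b] f))"
    unfolding D_bar_norm_def using assms
    by (intro SUP_upper2[of b] SUP_upper2[of i] SUP_upper2[of bs] order_refl) auto
  also have "\<dots> \<le> D_norm (\<sigma> + 2) 0 BB f + \<dots> + (SUP b\<in>Basis. D_bar_norm \<sigma> 2 (l + 1) BB (dp [b] f))"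
    by (intro add_increasing2 add_increasing order_refl) auto
  finally show ?thesis using f_norm by (meson less_imp_le order_trans)
qed

lemma D_norm_dp:
  assumes "b \<in> Basis" "bs \<in> multi_indices i" "i \<le> 2"
  shows "D_norm (\<sigma> + real (2 - i)) (l + 1) BB (dq bs (dp [b] f)) \<le> ennreal \<epsilon>"
proof -
  have "D_norm (\<sigma> + real (2 - i)) (l + 1) BB (dq bs (dp [b] f)) \<le> (SUP b\<in>Basis. D_bar_norm \<sigma> 2 (l + 1) BB (dp [b] f))"
    unfolding D_bar_norm_def using assms
    by (intro SUP_upper2[of b] SUP_upper2[of i] SUP_upper2[of bs] order_refl) auto
  also have "\<dots> \<le> D_norm (\<sigma> + 2) 0 BB f + (SUP b\<in>Basis. D_bar_norm \<sigma> 1 (l + 2) BB (dq [b] f)) + \<dots>"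
    by (intro add_increasing order_refl) auto
  finally show ?thesis using f_norm by (meson less_imp_le order_trans)
qed

lemma single_multi_index: "b \<in> Basis \<Longrightarrow> [b] \<in> multi_indices 1"
  by (simp add: multi_indices_def)

lemma f_in: "f \<in> D_space (\<sigma> + 2) BB"
  using D_bar_spaceD[OF f_space Nil_in_multi_indices] by (simp add: dq_Nil)

lemma fq_in: "e \<in> Basis \<Longrightarrow> dq [e] f \<in> D_space (\<sigma> + 1) BB"
  using D_bar_spaceD[OF f_space single_multi_index] by simp

lemma fp_in: "c \<in> Basis \<Longrightarrow> dp [c] f \<in> D_space (\<sigma> + 2) BB"
  using D_bar_spaceD[OF bspec[OF fp_space] Nil_in_multi_indices] by (simp add: dq_Nil)

lemma fqp_in: "e \<in> Basis \<Longrightarrow> c \<in> Basis \<Longrightarrow> dq [e] (dp [c] f) \<in> D_space (\<sigma> + 1) BB"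
  using D_bar_spaceD[OF bspec[OF fp_space] single_multi_index] by simp

lemma D_space_Ck:
  assumes "g \<in> D_space (\<sigma> + real k) BB" "p \<in> BB" "j \<le> nat \<lfloor>\<sigma>\<rfloor> + k"
  shows "Ck_on j UNIV (\<lambda>q. g q p t)"
proof -
  have "C_sigma (\<sigma> + real k) UNIV (\<lambda>q. g q p t)" using assms(1,2) unfolding D_space_def by blast
  thus ?thesis using \<sigma> assms(3) by (rule C_sigma_Ck_on)
qed

lemma m1: "1 \<le> nat \<lfloor>\<sigma>\<rfloor>"
  using \<sigma> by linarith

lemma decaysI:
  assumes "D_norm (\<sigma> + real k) s BB g \<le> ennreal \<epsilon>" "g \<in> D_space (\<sigma> + real k) BB" "1 < s" "s \<le> l + 2"
  shows "decays BB s E g"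
  unfolding E_def
proof (rule D_norm_decays[OF assms(1,3,4)])
  show "Ck_on 1 UNIV (\<lambda>q. g q p t)" if "p \<in> BB" for p t
    using D_space_Ck[OF assms(2) that] m1 by simp
qed (use \<sigma> \<epsilon> in auto)

lemma decays_q:
  assumes "e \<in> Basis" shows "decays BB (l + 2) E (dq [e] f)"
proof (rule decaysI[where k=1])
  show "D_norm (\<sigma> + real 1) (l + 2) BB (dq [e] f) \<le> ennreal \<epsilon>"
    using D_norm_dq[OF assms Nil_in_multi_indices] by (simp add: dq_Nil)
qed (use fq_in[OF assms] l in simp_all)

lemma decays_p:
  assumes "c \<in> Basis" shows "decays BB (l + 1) E (dp [c] f)"
proof (rule decaysI[where k=2])
  show "D_norm (\<sigma> + real 2) (l + 1) BB (dp [c] f) \<le> ennreal \<epsilon>"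
    using D_norm_dp[OF assms Nil_in_multi_indices] by (simp add: dq_Nil)
qed (use fp_in[OF assms] l in simp_all)

lemma decays_qp:
  assumes "e \<in> Basis" "c \<in> Basis" shows "decays BB (l + 1) E (dq [e] (dp [c] f))"
proof (rule decaysI[where k=1])
  show "D_norm (\<sigma> + real 1) (l + 1) BB (dq [e] (dp [c] f)) \<le> ennreal \<epsilon>"
    using D_norm_dp[OF assms(2) single_multi_index[OF assms(1)]] by simp
qed (use fqp_in[OF assms] l in simp_all)

text \<open>\<open>2 * real CARD('n)\<close> is the dimension of phase space, the factor by which
  bounds on partial derivatives become Lipschitz bounds.\<close>

definition K where "K = 2 * real CARD('n) * \<Upsilon>"

lemma K0: "0 \<le> K"
  using \<Upsilon> by (simp add: K_def)

definition Ht :: "real \<Rightarrow> 'n phase \<Rightarrow> real" where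
  "Ht t z = H (fst z) (snd z) t"

definition F :: "real \<Rightarrow> real^'n \<Rightarrow> real^'n \<Rightarrow> 'n phase \<Rightarrow> real" where
  "F t b c z = partial b (partial c (\<lambda>p. H (fst z) p t)) (snd z)"

lemma F_eq: "F t b c = (\<lambda>(q, p). dp [b, c] H q p t)"
  by (auto simp: F_def dp_def)

lemma F_bound:
  assumes "b \<in> Basis" "c \<in> Basis" "bs \<in> multi_indices i" "i \<le> nat \<lfloor>\<sigma>\<rfloor> + 2" "z \<in> UNIV \<times> BB"
  shows "\<bar>partials bs (F t b c) z\<bar> \<le> \<Upsilon>"
proof -
  have "i \<le> nat \<lfloor>\<sigma> + 2\<rfloor>" using floor_add_nat[OF \<sigma>, of 2] assms(4) by simp
  from hoelder_norm_upper[OF assms(3) this assms(5), of "F t b c"]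
  have "ennreal \<bar>partials bs (F t b c) z\<bar> \<le> hoelder_norm (\<sigma> + 2) (UNIV \<times> BB) (F t b c)" .
  also have "\<dots> \<le> (SUP t. SUP b\<in>Basis. SUP c\<in>Basis.
         hoelder_norm (\<sigma> + 2) (UNIV \<times> BB) (\<lambda>(q, p). dp [b, c] H q p t))"
    using assms(1,2) unfolding F_eq
    by (intro SUP_upper2[of t] SUP_upper2[of b] SUP_upper2[of c] order_refl) auto
  also have "\<dots> \<le> ennreal \<Upsilon>" by (rule Hpp_norm)
  finally show ?thesis using \<Upsilon> by (simp add: ennreal_le_iff)
qed

lemma open_S: "open (UNIV \<times> BB)"
  by (intro open_Times) auto

text \<open>Of the two orders beyond \<sigma> one is used for the Lipschitz condition; the other
  remains for the q-derivative of the Hessian in the force.\<close>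

lemma F_CkLip:
  assumes "b \<in> Basis" "c \<in> Basis"
  shows "CkLip (Suc (nat \<lfloor>\<sigma>\<rfloor>)) (UNIV \<times> BB) K (F t b c)"
proof -
  have "CkLip (Suc (nat \<lfloor>\<sigma>\<rfloor>)) (UNIV \<times> BB) (real DIM('n phase) * \<Upsilon>) (F t b c)"
  proof (rule CkLipI[OF open_S])
    have "C_sigma (\<sigma> + real 2) (UNIV \<times> BB) (F t b c)" using Hpp_reg assms unfolding F_eq by simp
    from C_sigma_Ck_on[OF this \<sigma>]
    show "Ck_on (Suc (Suc (nat \<lfloor>\<sigma>\<rfloor>))) (UNIV \<times> BB) (F t b c)" by simp
  qed (auto intro!: F_bound assms convex_Times)
  thus ?thesis by (simp add: K_def)
qed

lemma R_partial:
  assumes "p \<in> BB" "e \<in> Basis"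
  shows "has_partial e (\<lambda>q. R q p) q" "has_partial e (R q) p"
proof -
  have C: "Ck_on (Suc 1) (UNIV \<times> BB) (\<lambda>(q, p). R q p)" using R_C2 by (simp add: C_sigma_def numeral_2_eq_2)
  show "has_partial e (\<lambda>q. R q p) q"
    using Ck_on_Suc(2)[OF C, of "(e, 0)" "(q, p)"] assms by (simp add: partial_fst_slice Basis_prod_def)
  show "has_partial e (R q) p"
    using Ck_on_Suc(2)[OF C, of "(0, e)" "(q, p)"] assms by (simp add: partial_snd_slice Basis_prod_def)
qed

lemma f_partial:
  assumes "p \<in> BB" "e \<in> Basis"
  shows "has_partial e (\<lambda>q. f q p t) q" "has_partial e (\<lambda>p. f q p t) p"
proof -
  have "f \<in> D_space (\<sigma> + real 2) BB" using f_in by simp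
  from D_space_Ck[OF this assms(1), of 1] have "Ck_on (Suc 0) UNIV (\<lambda>q. f q p t)" by simp
  from Ck_on_Suc(2)[OF this assms(2)] show "has_partial e (\<lambda>q. f q p t) q" by simp
  have "Ck_on (Suc 0) BB (\<lambda>p. f q p t)" using f_C1 by simp
  from Ck_on_Suc(2)[OF this assms(2,1)] show "has_partial e (\<lambda>p. f q p t) p" .
qed

text \<open>The derivative of \<open>h\<close> is obtained by subtraction from those of
  \<open>H\<close>, \<open>R\<close> and \<open>f\<close> at q = 0 and t = 0.\<close>

lemma h_partial:
  assumes "p \<in> BB" "e \<in> Basis"
  shows "has_partial e h p"
proof -
  have "Ck_on (Suc 1) BB (\<lambda>p. H 0 p 0)" using H_C2 by (simp add: numeral_2_eq_2)
  from Ck_on_Suc(2)[OF this assms(2,1)] have "has_partial e (\<lambda>p. H 0 p 0) p" .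
  hence d: "has_partial e (\<lambda>p. H 0 p 0 - R 0 p - f 0 p 0) p"
    using R_partial(2)[OF assms] f_partial(2)[OF assms] by (intro has_partial_diff)
  have eq: "h y = H 0 y 0 - R 0 y - f 0 y 0" if "y \<in> BB" for y using H_split that by simp
  show ?thesis by (rule iffD2[OF partial_cong_open(1)[OF open_ball assms(1) eq] d])
qed

text \<open>Keeping \<open>R\<close> makes \<open>H - htilde\<close> equal to \<open>f\<close>,
  whose first derivatives decay over the whole ball and not only over \<open>D\<close>; over
  \<open>D\<close> the field is nevertheless that of \<open>h\<close>.\<close>

definition htilde :: "'n observable" where
  "htilde q p t = h p + R q p"

lemma dp_htilde:
  assumes "p \<in> BB" "c \<in> Basis"
  shows "dp [c] htilde q p t = partial c h p + partial c (R q) p"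
proof -
  have "partial c (\<lambda>p. h p + R q p) p = partial c h p + partial c (R q) p"
    by (rule has_partial_add(2)[OF h_partial[OF assms] R_partial(2)[OF assms]])
  thus ?thesis by (simp only: dp_def htilde_def partials.simps)
qed

lemma dq_htilde:
  assumes "p \<in> BB" "e \<in> Basis"
  shows "dq [e] htilde q p t = partial e (\<lambda>q. R q p) q"
proof -
  have "partial e (\<lambda>q. h p + R q p) q = partial e (\<lambda>q. h p) q + partial e (\<lambda>q. R q p) q"
    by (rule has_partial_add(2)[OF has_partial_const(1) R_partial(1)[OF assms]])
  thus ?thesis by (simp only: dq_def htilde_def partials.simps has_partial_const(2) add_0)
qed

lemma dp_H:
  assumes "p \<in> BB" "c \<in> Basis"
  shows "dp [c] H q p t = dp [c] htilde q p t + dp [c] f q p t"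
proof -
  have "dp [c] H q p t = partial c (\<lambda>p. (h p + R q p) + f q p t) p"
    unfolding dp_def partials.simps using H_split by (intro partial_cong_open(2)[OF open_ball assms(1)]) simp
  also have "\<dots> = (partial c h p + partial c (R q) p) + partial c (\<lambda>p. f q p t) p"
    unfolding has_partial_add(2)[OF h_partial[OF assms] R_partial(2)[OF assms], symmetric]
    by (rule has_partial_add(2)[OF has_partial_add(1)[OF h_partial[OF assms] R_partial(2)[OF assms]] f_partial(2)[OF assms]])
  finally show ?thesis unfolding dp_htilde[OF assms] by (simp add: dp_def)
qed

lemma dq_H:
  assumes "p \<in> BB" "e \<in> Basis"
  shows "dq [e] H q p t = dq [e] htilde q p t + dq [e] f q p t"
proof -
  have "dq [e] H q p t = partial e (\<lambda>q. (h p + R q p) + f q p t) q"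
    unfolding dq_def partials.simps using H_split assms(1) by simp
  also have "\<dots> = partial e (\<lambda>q. h p + R q p) q + partial e (\<lambda>q. f q p t) q"
    by (rule has_partial_add(2)[OF has_partial_add(1)[OF has_partial_const(1) R_partial(1)[OF assms]] f_partial(1)[OF assms]])
  also have "partial e (\<lambda>q. h p + R q p) q = partial e (\<lambda>q. h p) q + partial e (\<lambda>q. R q p) q"
    by (rule has_partial_add(2)[OF has_partial_const(1) R_partial(1)[OF assms]])
  also have "partial e (\<lambda>q. h p) q = 0" by (rule has_partial_const(2))
  finally show ?thesis unfolding dq_htilde[OF assms] by (simp add: dq_def)
qed

text \<open>Over \<open>D\<close> both \<open>R\<close> and its p-gradient vanish for every q. The
  data of the expansion reduce there to \<open>h\<close> and \<open>f\<close>, and their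
  q-derivatives see \<open>f\<close> alone.\<close>

lemma hessian_data:
  assumes p: "p \<in> D"
  shows "hessian_lip (Ht t) BB p (nat \<lfloor>\<sigma>\<rfloor>) K (F t)
      (\<lambda>q. h p + f q p t) (\<lambda>c q. partial c (\<lambda>p. Ht t (q, p)) p)"
    and "c \<in> Basis \<Longrightarrow> partial c (\<lambda>p. Ht t (q, p)) p = partial c h p + dp [c] f q p t"
    and "c \<in> Basis \<Longrightarrow> e \<in> Basis \<Longrightarrow> partial e (\<lambda>q. partial c (\<lambda>p. Ht t (q, p)) p) q = dq [e] (dp [c] f) q p t"
    and "e \<in> Basis \<Longrightarrow> partial e (\<lambda>q. h p + f q p t) q = dq [e] f q p t"
proof -
  have pB: "p \<in> BB" using p D by auto
  show 1: "partial c (\<lambda>p. Ht t (q, p)) p = partial c h p + dp [c] f q p t" if "c \<in> Basis" for c q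
  proof -
    have "partial c (\<lambda>p. Ht t (q, p)) p = dp [c] H q p t" by (simp add: Ht_def dp_def)
    thus ?thesis using R_zero p that by (simp add: dp_H[OF pB that] dp_htilde[OF pB that])
  qed
  have b: "(\<lambda>q. partial c (\<lambda>p. Ht t (q, p)) p) = (\<lambda>q. partial c h p + dp [c] f q p t)" if "c \<in> Basis" for c
    using 1[OF that] by blast
  have P: "has_partial e (\<lambda>q. dp [c] f q p t) q" if "c \<in> Basis" "e \<in> Basis" for c e q
  proof -
    have "dp [c] f \<in> D_space (\<sigma> + real 2) BB" using fp_in[OF that(1)] by simp
    from D_space_Ck[OF this pB, of 1] have "Ck_on (Suc 0) UNIV (\<lambda>q. dp [c] f q p t)" by simp
    from Ck_on_Suc(2)[OF this that(2)] show ?thesis by simp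
  qed
  show "partial e (\<lambda>q. partial c (\<lambda>p. Ht t (q, p)) p) q = dq [e] (dp [c] f) q p t"
    if "c \<in> Basis" "e \<in> Basis" for c e q
    unfolding b[OF that(1)] has_partial_add(2)[OF has_partial_const(1) P[OF that]]
    by (simp add: has_partial_const(2) dq_def)
  show "partial e (\<lambda>q. h p + f q p t) q = dq [e] f q p t" if "e \<in> Basis" for e q
    unfolding has_partial_add(2)[OF has_partial_const(1) f_partial(1)[OF pB that]]
    by (simp add: has_partial_const(2) dq_def)
  show "hessian_lip (Ht t) BB p (nat \<lfloor>\<sigma>\<rfloor>) K (F t)
      (\<lambda>q. h p + f q p t) (\<lambda>c q. partial c (\<lambda>p. Ht t (q, p)) p)"
  proof
    show "open BB" "convex BB" "p \<in> BB" using pB by auto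
    show "Ck_on 2 BB (\<lambda>p. Ht t (q, p))" for q using H_C2 by (simp add: Ht_def)
    show "CkLip (Suc (nat \<lfloor>\<sigma>\<rfloor>)) (UNIV \<times> BB) K (F t b c)" if "b \<in> Basis" "c \<in> Basis" for b c
      using F_CkLip[OF that] .
    show "has_partial e (\<lambda>q. h p + f q p t) q" if "e \<in> Basis" for e q
      by (rule has_partial_add(1)[OF has_partial_const(1) f_partial(1)[OF pB that]])
    show "has_partial e (\<lambda>q. partial c (\<lambda>p. Ht t (q, p)) p) q" if "e \<in> Basis" "c \<in> Basis" for e c q
      unfolding b[OF that(2)] by (rule has_partial_add(1)[OF has_partial_const(1) P[OF that(2,1)]])
    show "F t = (\<lambda>b c z. partial b (partial c (\<lambda>p. Ht t (fst z, p))) (snd z))"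
      by (intro ext) (simp add: F_def Ht_def)
    show "(\<lambda>q. h p + f q p t) = (\<lambda>q. Ht t (q, p))"
      using H_split pB R_zero p by (simp add: Ht_def)
  qed simp
qed

text \<open>A single base point in \<open>D\<close> yields bounds over the whole ball, uniform in
  time, since the Hessian is bounded on the ball and the derivatives of \<open>f\<close> over the
  base point are bounded. The constant involves the gradient of \<open>h\<close> at
  \<open>p0\<close>; it enters only regularity and convergence statements.\<close>

lemma field_CkLip:
  assumes "D \<noteq> {}"
  obtains C where "0 \<le> C"
    "\<And>t c. c \<in> Basis \<Longrightarrow> CkLip (nat \<lfloor>\<sigma>\<rfloor>) (UNIV \<times> BB) C (\<lambda>z. dp [c] H (fst z) (snd z) t)"
    "\<And>t c. c \<in> Basis \<Longrightarrow> CkLip (nat \<lfloor>\<sigma>\<rfloor>) (UNIV \<times> BB) C (\<lambda>z. dq [c] H (fst z) (snd z) t)"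
proof -
  let ?m = "nat \<lfloor>\<sigma>\<rfloor>"
  obtain p0 where p0: "p0 \<in> D" using assms by blast
  have pB: "p0 \<in> BB" using p0 D by auto
  define L where "L = real CARD('n) + (\<Sum>c\<in>Basis. \<bar>partial c h p0\<bar>)"
  have L0: "0 \<le> L" by (simp add: L_def sum_nonneg)
  define C1 where "C1 = L + real DIM(real^'n) * (2 ^ (?m + 1) * 2 * K)"
  define C2 where "C2 = L + real DIM(real^'n) * (2 ^ (?m + 1) * 2 * L) +
       real DIM(real^'n) * (real DIM(real^'n) * (2 ^ (?m + 1) * (2 ^ (?m + 1) * 2 * 2) * K))"
  have C0: "0 \<le> C1" "0 \<le> C2" using L0 K0 by (simp_all add: C1_def C2_def)
  have *: "CkLip ?m (UNIV \<times> BB) C1 (\<lambda>z. dp [c] H (fst z) (snd z) t) \<and>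
      CkLip ?m (UNIV \<times> BB) C2 (\<lambda>z. dq [c] H (fst z) (snd z) t)" if c: "c \<in> Basis" for t c
  proof -
    interpret hessian_lip "Ht t" BB p0 ?m K "F t" "\<lambda>q. h p0 + f q p0 t" "\<lambda>c q. partial c (\<lambda>p. Ht t (q, p)) p0"
      by (rule hessian_data(1)[OF p0])
    have bd: "\<bar>(p - p0) \<bullet> b\<bar> \<le> 2" if "p \<in> BB" "b \<in> Basis" for p b
    proof -
      have "\<bar>(p - p0) \<bullet> b\<bar> \<le> norm (p - p0)" using that(2) by (rule Basis_le_norm)
      also have "\<dots> \<le> norm p + norm p0" by (rule norm_triangle_ineq4)
      also have "\<dots> \<le> 2" using that pB by simp
      finally show ?thesis .
    qed
    have S: "real CARD('n) + \<bar>partial c h p0\<bar> \<le> L" if "c \<in> Basis" for c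
      unfolding L_def using member_le_sum[of c Basis "\<lambda>c. \<bar>partial c h p0\<bar>"] that by simp
    have nL: "real CARD('n) \<le> L" unfolding L_def by (simp add: sum_nonneg)
    have \<beta>: "CkLip ?m UNIV L (\<lambda>q. partial c (\<lambda>p. Ht t (q, p)) p0)" if c: "c \<in> Basis" for c
    proof -
      have "CkLip ?m UNIV (real CARD('n)) (\<lambda>q. dp [c] f q p0 t)"
        using D_norm_dp[OF c Nil_in_multi_indices] fp_in[OF c] l \<sigma> \<epsilon> pB
        by (intro D_norm_CkLip[where k=2 and s="l + 1" and \<epsilon>=\<epsilon> and A=BB]) (auto simp: dq_Nil D_space_def)
      from CkLip_add[OF open_UNIV this CkLip_const[OF order_refl, of _ _ "partial c h p0"]]
      have "CkLip ?m UNIV L (\<lambda>q. dp [c] f q p0 t + partial c h p0)" using S[OF c] by (rule CkLip_mono)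
      thus ?thesis unfolding hessian_data(2)[OF p0 c] by (simp add: add.commute)
    qed
    have \<alpha>: "CkLip ?m UNIV L (partial e (\<lambda>q. h p0 + f q p0 t))" if e: "e \<in> Basis" for e
    proof -
      have "CkLip ?m UNIV (real CARD('n)) (\<lambda>q. dq [e] f q p0 t)"
        using D_norm_dq[OF e Nil_in_multi_indices] fq_in[OF e] l \<sigma> \<epsilon> pB
        by (intro D_norm_CkLip[where k=1 and s="l + 2" and \<epsilon>=\<epsilon> and A=BB]) (auto simp: dq_Nil D_space_def)
      hence "CkLip ?m UNIV L (\<lambda>q. dq [e] f q p0 t)" using nL by (rule CkLip_mono)
      moreover have "partial e (\<lambda>q. h p0 + f q p0 t) = (\<lambda>q. dq [e] f q p0 t)"
        using hessian_data(4)[OF p0 e] by blast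
      ultimately show ?thesis by (simp only:)
    qed
    have \<beta>e: "CkLip ?m UNIV L (partial e (\<lambda>q. partial c (\<lambda>p. Ht t (q, p)) p0))"
      if c: "c \<in> Basis" and e: "e \<in> Basis" for c e
    proof -
      have "CkLip ?m UNIV (real CARD('n)) (\<lambda>q. dq [e] (dp [c] f) q p0 t)"
        using D_norm_dp[OF c single_multi_index[OF e]] fqp_in[OF e c] l \<sigma> \<epsilon> pB
        by (intro D_norm_CkLip[where k=1 and s="l + 1" and \<epsilon>=\<epsilon> and A=BB]) (auto simp: D_space_def)
      hence "CkLip ?m UNIV L (\<lambda>q. dq [e] (dp [c] f) q p0 t)" using nL by (rule CkLip_mono)
      moreover have "partial e (\<lambda>q. partial c (\<lambda>p. Ht t (q, p)) p0) = (\<lambda>q. dq [e] (dp [c] f) q p0 t)"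
        using hessian_data(3)[OF p0 c e] by blast
      ultimately show ?thesis by (simp only:)
    qed
    have "CkLip ?m (UNIV \<times> BB) C1 (\<lambda>z. partial c (\<lambda>p. Ht t (fst z, p)) (snd z))"
      unfolding C1_def using CkLip_p_derivative[OF bd K0 L0 \<beta> \<alpha> \<beta>e c] .
    moreover have "CkLip ?m (UNIV \<times> BB) C2 (\<lambda>z. partial c (\<lambda>q. Ht t (q, snd z)) (fst z))"
      unfolding C2_def using CkLip_q_derivative[OF bd K0 L0 \<beta> \<alpha> \<beta>e c] .
    ultimately show ?thesis by (simp add: Ht_def dp_def dq_def)
  qed
  show ?thesis
  proof (rule that[of "max C1 C2"])
    show "0 \<le> max C1 C2" using C0 by simp
  qed (use * in \<open>auto intro: CkLip_mono[OF _ max.cobounded1] CkLip_mono[OF _ max.cobounded2]\<close>)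
qed

lemma dp_f_small: "p \<in> BB \<Longrightarrow> c \<in> Basis \<Longrightarrow> \<bar>dp [c] f q p t\<bar> \<le> E * (1 + \<bar>t\<bar>) powr (- (l + 1))"
  by (rule decays_bound[OF decays_p])

lemma dq_f_small: "p \<in> BB \<Longrightarrow> c \<in> Basis \<Longrightarrow> \<bar>dq [c] f q p t\<bar> \<le> E * (1 + \<bar>t\<bar>) powr (- (l + 2))"
  by (rule decays_bound[OF decays_q])

lemma weight_tendsto_0:
  assumes "0 < s"
  shows "((\<lambda>t::real. E * (1 + \<bar>t\<bar>) powr (- s)) \<longlongrightarrow> 0) at_top"
    "((\<lambda>t::real. E * (1 + \<bar>t\<bar>) powr (- s)) \<longlongrightarrow> 0) at_bot"
proof -
  have 1: "filterlim (\<lambda>t::real. 1 + \<bar>t\<bar>) at_top at_top"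
    by (rule filterlim_at_top_mono[OF filterlim_ident], rule always_eventually, rule allI, arith)
  have 2: "filterlim (\<lambda>t::real. 1 + \<bar>t\<bar>) at_top at_bot"
    by (rule filterlim_at_top_mono[OF filterlim_uminus_at_top_at_bot], rule always_eventually, rule allI, arith)
  have "((\<lambda>t. (1 + \<bar>t\<bar>) powr (- s)) \<longlongrightarrow> 0) at_top" "((\<lambda>t. (1 + \<bar>t\<bar>) powr (- s)) \<longlongrightarrow> 0) at_bot"
    using assms 1 2 by (auto intro!: tendsto_neg_powr)
  from tendsto_mult_left[OF this(1), of E] tendsto_mult_left[OF this(2), of E]
  show "((\<lambda>t::real. E * (1 + \<bar>t\<bar>) powr (- s)) \<longlongrightarrow> 0) at_top"
    "((\<lambda>t::real. E * (1 + \<bar>t\<bar>) powr (- s)) \<longlongrightarrow> 0) at_bot" by simp_all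
qed

end

section \<open>The field of \<open>htilde\<close> as the limit of the field of
  \<open>H\<close>\<close>

context perturbed_hamiltonian
begin

lemma difference_uniformly_small:
  assumes z: "z \<in> UNIV \<times> BB" and c: "c \<in> Basis"
  shows "\<bar>dp [c] H (fst z) (snd z) t - dp [c] htilde (fst z) (snd z) t\<bar> \<le> E * (1 + \<bar>t\<bar>) powr (- (l + 1))"
    "\<bar>dq [c] H (fst z) (snd z) t - dq [c] htilde (fst z) (snd z) t\<bar> \<le> E * (1 + \<bar>t\<bar>) powr (- (l + 1))"
proof -
  have zB: "snd z \<in> BB" using z by (simp add: mem_Times_iff)
  show "\<bar>dp [c] H (fst z) (snd z) t - dp [c] htilde (fst z) (snd z) t\<bar> \<le> E * (1 + \<bar>t\<bar>) powr (- (l + 1))"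
    unfolding dp_H[OF zB c] using dp_f_small[OF zB c, of "fst z" t] by simp
  have "E * (1 + \<bar>t\<bar>) powr (- (l + 2)) \<le> E * (1 + \<bar>t\<bar>) powr (- (l + 1))"
    using \<epsilon> by (intro mult_left_mono powr_mono) (auto simp: E_def)
  thus "\<bar>dq [c] H (fst z) (snd z) t - dq [c] htilde (fst z) (snd z) t\<bar> \<le> E * (1 + \<bar>t\<bar>) powr (- (l + 1))"
    unfolding dq_H[OF zB c] using dq_f_small[OF zB c, of "fst z" t] by simp
qed

lemma htilde_indep: "dp bs htilde q p t = dp bs htilde q p s" "dq bs htilde q p t = dq bs htilde q p s"
  by (simp_all add: dp_def dq_def htilde_def)

lemma small_at_infinity:
  assumes "Fl = at_top \<or> Fl = at_bot" "e > 0"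
  shows "\<forall>\<^sub>F t in Fl. E * (1 + \<bar>t\<bar>) powr (- (l + 1)) < e"
proof -
  have "0 < l + 1" using l by simp
  from weight_tendsto_0[OF this] have "((\<lambda>t. E * (1 + \<bar>t\<bar>) powr (- (l + 1))) \<longlongrightarrow> 0) Fl"
    using assms(1) by blast
  from order_tendstoD(2)[OF this assms(2)] show ?thesis .
qed

lemma edge_thick_S: "edge_thick (UNIV \<times> BB :: 'n phase set)"
  by (rule edge_thick_cylinder)

text \<open>\<open>htilde\<close> is autonomous and its first derivatives are the uniform limits of
  those of \<open>H\<close> at the times n, so the bounds pass from \<open>H\<close> to
  \<open>htilde\<close>. Regularity of \<open>h + R\<close> matching \<sigma> is obtained in this
  way.\<close>

lemma CkLip_htilde:
  assumes c: "c \<in> Basis"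
  shows "(\<And>t. CkLip m (UNIV \<times> BB) C (\<lambda>z. dp [c] H (fst z) (snd z) t)) \<Longrightarrow>
      CkLip m (UNIV \<times> BB) C (\<lambda>z. dp [c] htilde (fst z) (snd z) t)"
    "(\<And>t. CkLip m (UNIV \<times> BB) C (\<lambda>z. dq [c] H (fst z) (snd z) t)) \<Longrightarrow>
      CkLip m (UNIV \<times> BB) C (\<lambda>z. dq [c] htilde (fst z) (snd z) t)"
proof -
  have ev: "\<forall>\<^sub>F n in sequentially. E * (1 + \<bar>real n\<bar>) powr (- (l + 1)) < e" if "e > 0" for e
    using small_at_infinity[OF disjI1[OF refl] that] filterlim_real_sequentially
    unfolding filterlim_iff by blast
  have 1: "uniform_limit (UNIV \<times> BB) (\<lambda>n z. dp [c] H (fst z) (snd z) (real n)) (\<lambda>z. dp [c] htilde (fst z) (snd z) t) sequentially"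
  proof (rule uniform_limitI)
    fix e :: real assume "e > 0"
    show "\<forall>\<^sub>F n in sequentially. \<forall>z\<in>UNIV \<times> BB. dist (dp [c] H (fst z) (snd z) (real n)) (dp [c] htilde (fst z) (snd z) t) < e"
      using ev[OF \<open>e > 0\<close>]
    proof eventually_elim
      case (elim n)
      show ?case
      proof
        fix z :: "'n phase" assume z: "z \<in> UNIV \<times> BB"
        show "dist (dp [c] H (fst z) (snd z) (real n)) (dp [c] htilde (fst z) (snd z) t) < e"
          using difference_uniformly_small(1)[OF z c, of "real n"] elim
          unfolding dist_real_def htilde_indep(1)[of _ _ _ t "real n"] by linarith
      qed
    qed
  qed
  have 2: "uniform_limit (UNIV \<times> BB) (\<lambda>n z. dq [c] H (fst z) (snd z) (real n)) (\<lambda>z. dq [c] htilde (fst z) (snd z) t) sequentially"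
  proof (rule uniform_limitI)
    fix e :: real assume "e > 0"
    show "\<forall>\<^sub>F n in sequentially. \<forall>z\<in>UNIV \<times> BB. dist (dq [c] H (fst z) (snd z) (real n)) (dq [c] htilde (fst z) (snd z) t) < e"
      using ev[OF \<open>e > 0\<close>]
    proof eventually_elim
      case (elim n)
      show ?case
      proof
        fix z :: "'n phase" assume z: "z \<in> UNIV \<times> BB"
        show "dist (dq [c] H (fst z) (snd z) (real n)) (dq [c] htilde (fst z) (snd z) t) < e"
          using difference_uniformly_small(2)[OF z c, of "real n"] elim
          unfolding dist_real_def htilde_indep(2)[of _ _ _ t "real n"] by linarith
      qed
    qed
  qed
  show "CkLip m (UNIV \<times> BB) C (\<lambda>z. dp [c] htilde (fst z) (snd z) t)"
    if "\<And>t. CkLip m (UNIV \<times> BB) C (\<lambda>z. dp [c] H (fst z) (snd z) t)"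
    by (rule CkLip_limit[OF edge_thick_S open_S that 1])
  show "CkLip m (UNIV \<times> BB) C (\<lambda>z. dq [c] htilde (fst z) (snd z) t)"
    if "\<And>t. CkLip m (UNIV \<times> BB) C (\<lambda>z. dq [c] H (fst z) (snd z) t)"
    by (rule CkLip_limit[OF edge_thick_S open_S that 2])
qed

lemma ham_field_CkLip:
  assumes "b \<in> Basis"
    and "\<And>c. c \<in> Basis \<Longrightarrow> CkLip m (UNIV \<times> BB) C (\<lambda>z. dp [c] G (fst z) (snd z) t)"
    and "\<And>c. c \<in> Basis \<Longrightarrow> CkLip m (UNIV \<times> BB) C (\<lambda>z. dq [c] G (fst z) (snd z) t)"
  shows "CkLip m (UNIV \<times> BB) C (\<lambda>z. ham_field G z t \<bullet> b)"
  using assms(1)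
proof (cases rule: phase_basis_cases)
  case (1 i)
  show ?thesis unfolding 1 ham_field_inner by (rule assms(2)[OF axis_in_Basis])
next
  case (2 i)
  show ?thesis unfolding 2 ham_field_inner by (rule CkLip_uminus[OF open_S assms(3)[OF axis_in_Basis]])
qed

lemma htilde_periodic: "q_periodic BB htilde"
  using R_periodic by (auto simp: q_periodic_def htilde_def)

lemma H_periodic: "q_periodic BB H"
  using H_ham by (simp add: hamiltonian_on_def)

text \<open>Convergence of the fields in the sup norm is part of the hypotheses; convergence in the Hoelder
  norm follows by interpolation.\<close>

lemma fields:
  assumes "D \<noteq> {}"
  shows "C_sigma_field \<sigma> BB (ham_field H)" "C_sigma_field \<sigma> BB (ham_field htilde)"
    "Fl = at_top \<or> Fl = at_bot \<Longrightarrow>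
     ((\<lambda>t. field_norm \<sigma> BB (\<lambda>z. ham_field H z t - ham_field htilde z t)) \<longlongrightarrow> 0) Fl"
    "continuous_on (UNIV \<times> BB) (\<lambda>z. ham_field htilde z t)"
proof -
  obtain C where C: "0 \<le> C"
    "\<And>t c. c \<in> Basis \<Longrightarrow> CkLip (nat \<lfloor>\<sigma>\<rfloor>) (UNIV \<times> BB) C (\<lambda>z. dp [c] H (fst z) (snd z) t)"
    "\<And>t c. c \<in> Basis \<Longrightarrow> CkLip (nat \<lfloor>\<sigma>\<rfloor>) (UNIV \<times> BB) C (\<lambda>z. dq [c] H (fst z) (snd z) t)"
    by (rule field_CkLip[OF assms]) blast
  have XH: "CkLip (nat \<lfloor>\<sigma>\<rfloor>) (UNIV \<times> BB) C (\<lambda>z. ham_field H z t \<bullet> b)" if "b \<in> Basis" for b t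
    using that C(2,3) by (rule ham_field_CkLip)
  have Xh: "CkLip (nat \<lfloor>\<sigma>\<rfloor>) (UNIV \<times> BB) C (\<lambda>z. ham_field htilde z t \<bullet> b)" if "b \<in> Basis" for b t
    using that CkLip_htilde(1)[OF _ C(2)] CkLip_htilde(2)[OF _ C(3)] by (rule ham_field_CkLip)
  show "C_sigma_field \<sigma> BB (ham_field H)" "C_sigma_field \<sigma> BB (ham_field htilde)"
    using ham_field_periodic[OF open_ball H_periodic] ham_field_periodic[OF open_ball htilde_periodic]
      CkLip_C_sigma[OF XH C(1)] CkLip_C_sigma[OF Xh C(1)]
    by (simp_all add: C_sigma_field_def)
  have "continuous_on (UNIV \<times> BB) (\<lambda>z. \<Sum>b\<in>Basis. (ham_field htilde z t \<bullet> b) *\<^sub>R b)"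
    by (intro continuous_on_sum continuous_on_scaleR continuous_on_const bd_lip_continuous[OF CkLip_bd_lip[OF Xh]])
  thus "continuous_on (UNIV \<times> BB) (\<lambda>z. ham_field htilde z t)" by (simp add: euclidean_representation)
  assume Fl: "Fl = at_top \<or> Fl = at_bot"
  have comp: "((\<lambda>t. hoelder_norm \<sigma> (UNIV \<times> BB) (\<lambda>z. (ham_field H z t - ham_field htilde z t) \<bullet> b)) \<longlongrightarrow> 0) Fl"
    if b: "b \<in> Basis" for b
  proof (rule hoelder_norm_tendsto_0[OF edge_thick_S, where K="C + C"])
    have "CkLip (nat \<lfloor>\<sigma>\<rfloor>) (UNIV \<times> BB) (C + C) (\<lambda>z. (ham_field H z t - ham_field htilde z t) \<bullet> b)" for t
      unfolding inner_diff_left by (rule CkLip_diff[OF open_S XH[OF b] Xh[OF b]])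
    thus "\<forall>\<^sub>F t in Fl. CkLip (nat \<lfloor>\<sigma>\<rfloor>) (UNIV \<times> BB) (C + C) (\<lambda>z. (ham_field H z t - ham_field htilde z t) \<bullet> b)"
      by (rule always_eventually[OF allI])
    show "0 \<le> C + C" using C(1) by simp
    fix e :: real assume "e > 0"
    show "\<forall>\<^sub>F t in Fl. \<forall>z\<in>UNIV \<times> BB. \<bar>(ham_field H z t - ham_field htilde z t) \<bullet> b\<bar> \<le> e"
      using small_at_infinity[OF Fl \<open>e > 0\<close>]
    proof eventually_elim
      case (elim t)
      show ?case
      proof
        fix z :: "'n phase" assume z: "z \<in> UNIV \<times> BB"
        have "\<bar>(ham_field H z t - ham_field htilde z t) \<bullet> b\<bar> \<le> E * (1 + \<bar>t\<bar>) powr (- (l + 1))"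
          using b
        proof (cases rule: phase_basis_cases)
          case (1 i)
          show ?thesis unfolding 1 inner_diff_left ham_field_inner
            by (rule difference_uniformly_small(1)[OF z axis_in_Basis])
        next
          case (2 i)
          show ?thesis unfolding 2 inner_diff_left ham_field_inner
            using difference_uniformly_small(2)[OF z axis_in_Basis, of i t] by simp
        qed
        thus "\<bar>(ham_field H z t - ham_field htilde z t) \<bullet> b\<bar> \<le> e" using elim by linarith
      qed
    qed
  qed
  have "((\<lambda>t. \<Sum>b\<in>Basis. hoelder_norm \<sigma> (UNIV \<times> BB) (\<lambda>z. (ham_field H z t - ham_field htilde z t) \<bullet> b)) \<longlongrightarrow> 0) Fl"
    using tendsto_sum[OF comp] by simp
  thus "((\<lambda>t. field_norm \<sigma> BB (\<lambda>z. ham_field H z t - ham_field htilde z t)) \<longlongrightarrow> 0) Fl"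
  proof (rule tendsto_sandwich[OF _ _ tendsto_const, rotated 2])
    show "\<forall>\<^sub>F t in Fl. field_norm \<sigma> BB (\<lambda>z. ham_field H z t - ham_field htilde z t) \<le>
        (\<Sum>b\<in>Basis. hoelder_norm \<sigma> (UNIV \<times> BB) (\<lambda>z. (ham_field H z t - ham_field htilde z t) \<bullet> b))"
      unfolding field_norm_def by (intro always_eventually allI SUP_least member_le_sum) auto
  qed simp
qed

text \<open>Continuity is that of \<open>H - f\<close>. The partial derivatives exist because those
  of \<open>h\<close> and \<open>R\<close> do, and they are continuous by the bounds inherited from
  \<open>H\<close>.\<close>

lemma htilde_hamiltonian:
  assumes "D \<noteq> {}"
  shows "hamiltonian_on BB htilde"
proof -
  have "continuous_on (UNIV \<times> BB \<times> UNIV) (\<lambda>x. H (fst x) (fst (snd x)) (snd (snd x)) - f (fst x) (fst (snd x)) (snd (snd x)))"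
    using H_ham f_in by (intro continuous_on_diff) (simp_all add: hamiltonian_on_def D_space_def case_prod_unfold)
  hence "continuous_on (UNIV \<times> BB \<times> UNIV) (\<lambda>(q, p, t). htilde q p t)"
    by (rule continuous_on_eq) (use H_split in \<open>auto simp: htilde_def\<close>)
  moreover have "Ck_on 1 (UNIV \<times> BB) (\<lambda>(q, p). htilde q p t)" for t
  proof -
    obtain C where C: "0 \<le> C"
      "\<And>t c. c \<in> Basis \<Longrightarrow> CkLip (nat \<lfloor>\<sigma>\<rfloor>) (UNIV \<times> BB) C (\<lambda>z. dp [c] H (fst z) (snd z) t)"
      "\<And>t c. c \<in> Basis \<Longrightarrow> CkLip (nat \<lfloor>\<sigma>\<rfloor>) (UNIV \<times> BB) C (\<lambda>z. dq [c] H (fst z) (snd z) t)"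
      by (rule field_CkLip[OF assms]) blast
    let ?g = "\<lambda>(q, p). htilde q p t"
    have der: "has_partial b ?g z \<and> (b = (c, 0) \<longrightarrow> partial b ?g z = dq [c] htilde (fst z) (snd z) t) \<and>
        (b = (0, c) \<longrightarrow> partial b ?g z = dp [c] htilde (fst z) (snd z) t)"
      if c: "c \<in> Basis" "b = (c, 0) \<or> b = (0, c)" and z: "z \<in> UNIV \<times> BB" for b c z
    proof -
      obtain q p where qp: "z = (q, p)" by fastforce
      have p: "p \<in> BB" using z qp by simp
      have 1: "has_partial c (\<lambda>q. htilde q p t) q"
        unfolding htilde_def by (rule has_partial_add(1)[OF has_partial_const(1) R_partial(1)[OF p c(1)]])
      have 2: "has_partial c (\<lambda>p. htilde q p t) p"
        unfolding htilde_def by (rule has_partial_add(1)[OF h_partial[OF p c(1)] R_partial(2)[OF p c(1)]])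
      show ?thesis using 1 2 c(2) by (auto simp: qp partial_fst_slice partial_snd_slice dq_def dp_def)
    qed
    have cont: "continuous_on (UNIV \<times> BB) (partial b ?g)" if b: "b \<in> Basis" for b
      using b
    proof (cases rule: phase_basis_cases)
      case (1 i)
      have "continuous_on (UNIV \<times> BB) (\<lambda>z. dq [axis i 1] htilde (fst z) (snd z) t)"
        by (rule bd_lip_continuous[OF CkLip_bd_lip[OF CkLip_htilde(2)[OF axis_in_Basis C(3)[OF axis_in_Basis]]]])
      thus ?thesis by (rule continuous_on_eq) (use der[OF axis_in_Basis, of b i] 1 in auto)
    next
      case (2 i)
      have "continuous_on (UNIV \<times> BB) (\<lambda>z. dp [axis i 1] htilde (fst z) (snd z) t)"
        by (rule bd_lip_continuous[OF CkLip_bd_lip[OF CkLip_htilde(1)[OF axis_in_Basis C(2)[OF axis_in_Basis]]]])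
      thus ?thesis by (rule continuous_on_eq) (use der[OF axis_in_Basis, of b i] 2 in auto)
    qed
    have ex: "has_partial b ?g z" if "b \<in> Basis" "z \<in> UNIV \<times> BB" for b z
      using that(1) by (cases rule: phase_basis_cases) (use der[OF axis_in_Basis _ that(2)] in blast)+
    have "continuous_on (UNIV \<times> BB) ?g"
      using C1_has_derivative[OF open_S _ ex cont] has_derivative_continuous
      by (fastforce simp: continuous_on_eq_continuous_at[OF open_S])
    thus ?thesis
      using ex cont by (auto simp: Ck_on_def multi_indices_def le_Suc_eq length_Suc_conv)
  qed
  ultimately show ?thesis using htilde_periodic by (simp add: hamiltonian_on_def)
qed

end

section \<open>Size and Lipschitz estimates for the field of \<open>H\<close> near points of
  \<open>D\<close>\<close>

lemma abs_mult_diff_le: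
  fixes x y x' y' :: real
  assumes "\<bar>y\<bar> \<le> Y" "\<bar>x'\<bar> \<le> X" "\<bar>x - x'\<bar> \<le> dx" "\<bar>y - y'\<bar> \<le> dy"
  shows "\<bar>x * y - x' * y'\<bar> \<le> dx * Y + X * dy"
proof -
  have "x * y - x' * y' = (x - x') * y + x' * (y - y')" by (simp add: algebra_simps)
  hence "\<bar>x * y - x' * y'\<bar> \<le> \<bar>x - x'\<bar> * \<bar>y\<bar> + \<bar>x'\<bar> * \<bar>y - y'\<bar>"
    by (metis abs_mult abs_triangle_ineq)
  also have "\<dots> \<le> dx * Y + X * dy" using assms by (intro add_mono mult_mono) auto
  finally show ?thesis .
qed

lemma sum_diff_le:
  fixes f g :: "'a \<Rightarrow> real"
  assumes "\<And>i. i \<in> A \<Longrightarrow> \<bar>f i - g i\<bar> \<le> c"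
  shows "\<bar>(\<Sum>i\<in>A. f i) - (\<Sum>i\<in>A. g i)\<bar> \<le> real (card A) * c"
proof -
  have "\<bar>\<Sum>i\<in>A. f i - g i\<bar> \<le> (\<Sum>i\<in>A. \<bar>f i - g i\<bar>)" by (rule sum_abs)
  also have "\<dots> \<le> real (card A) * c" by (rule sum_bounded_above) (rule assms)
  finally show ?thesis by (simp add: sum_subtractf)
qed

lemma norm_vec_le:
  fixes x :: "real^'n::finite"
  assumes "\<And>i. \<bar>x $ i\<bar> \<le> c"
  shows "norm x \<le> real CARD('n) * c"
proof -
  have "norm x \<le> (\<Sum>i\<in>UNIV. \<bar>x $ i\<bar>)" by (rule norm_le_l1_cart)
  also have "\<dots> \<le> real CARD('n) * c" by (rule sum_bounded_above) (rule assms)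
  finally show ?thesis .
qed

context perturbed_hamiltonian
begin

text \<open>A common upper bound for the constants of the four field estimates and for the Lipschitz
  constant of the gradient of \<open>h\<close>, as collected in \<open>c1_ge\<close>.
  \<open>Cdyn\<close> adds the passage from components to the norm.\<close>

definition "c1 = 2 + real CARD('n) + 2 * real CARD('n) * K + 3 * real CARD('n) * real CARD('n) * K"

definition "Cdyn = real CARD('n) * c1"

definition XP :: "real^'n \<Rightarrow> real^'n \<Rightarrow> real \<Rightarrow> real^'n" where
  "XP q p t = (\<chi> i. dp [axis i 1] H q p t)"

definition XQ :: "real^'n \<Rightarrow> real^'n \<Rightarrow> real \<Rightarrow> real^'n" where
  "XQ q p t = (\<chi> i. dq [axis i 1] H q p t)"

definition freq :: "real^'n \<Rightarrow> real^'n" where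
  "freq p = (\<chi> i. partial (axis i 1) h p)"

definition JP :: "real \<Rightarrow> real^'n \<Rightarrow> real^'n \<Rightarrow> real^'n \<Rightarrow> real^'n \<Rightarrow> real^'n \<Rightarrow> real" where
  "JP t b c p q v = seg_int (\<lambda>s. 1) p (F t b c) (q, p + v)"

definition JQ :: "real \<Rightarrow> real^'n \<Rightarrow> real^'n \<Rightarrow> real^'n \<Rightarrow> real^'n \<Rightarrow> real^'n \<Rightarrow> real^'n \<Rightarrow> real" where
  "JQ t e b c p q v = seg_int (\<lambda>s. 1 - s) p (partial (e, 0) (F t b c)) (q, p + v)"

lemma dp_H_expansion:
  assumes p: "p \<in> D" "p + v \<in> BB" and c: "c \<in> Basis"
  shows "dp [c] H q (p + v) t - partial c h p = dp [c] f q p t + (\<Sum>b\<in>Basis. (v \<bullet> b) * JP t b c p q v)"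
  using hessian_lip.p_derivative[OF hessian_data(1)[OF p(1)] p(2) c, of t q] hessian_data(2)[OF p(1) c, of t q]
  by (simp add: Ht_def dp_def JP_def)

lemma dq_H_expansion:
  assumes p: "p \<in> D" "p + v \<in> BB" and e: "e \<in> Basis"
  shows "dq [e] H q (p + v) t = dq [e] f q p t + (\<Sum>c\<in>Basis. (v \<bullet> c) * dq [e] (dp [c] f) q p t) +
      (\<Sum>c\<in>Basis. \<Sum>b\<in>Basis. (v \<bullet> c) * (v \<bullet> b) * JQ t e b c p q v)"
proof -
  have "dq [e] H q (p + v) t = partial e (\<lambda>q. Ht t (q, p + v)) q" by (simp add: Ht_def dq_def)
  also have "\<dots> = partial e (\<lambda>q. h p + f q p t) q + (\<Sum>c\<in>Basis. (v \<bullet> c) * partial e (\<lambda>q. partial c (\<lambda>p. Ht t (q, p)) p) q) +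
      (\<Sum>c\<in>Basis. \<Sum>b\<in>Basis. (v \<bullet> c) * (v \<bullet> b) * JQ t e b c p q v)"
    using hessian_lip.q_derivative(2)[OF hessian_data(1)[OF p(1)] p(2) e, of t q] by (simp add: JQ_def)
  also have "\<dots> = dq [e] f q p t + (\<Sum>c\<in>Basis. (v \<bullet> c) * dq [e] (dp [c] f) q p t) +
      (\<Sum>c\<in>Basis. \<Sum>b\<in>Basis. (v \<bullet> c) * (v \<bullet> b) * JQ t e b c p q v)"
    using hessian_data(3)[OF p(1) _ e] hessian_data(4)[OF p(1) e] by simp
  finally show ?thesis .
qed

lemma seg_int_shift_bounds:
  assumes G: "bd_lip (UNIV \<times> BB) K G" and w: "continuous_on {0..1} w" "\<And>s. s \<in> {0..1} \<Longrightarrow> \<bar>w s\<bar> \<le> 1"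
    and p: "p \<in> BB" "p + v \<in> BB" "p' \<in> BB" "p' + v' \<in> BB"
  shows "\<bar>seg_int w p G (q, p + v)\<bar> \<le> K"
    "\<bar>seg_int w p G (q, p + v) - seg_int w p' G (q', p' + v')\<bar> \<le> K * (norm (q - q') + norm (p - p') + norm (v - v'))"
proof -
  show "\<bar>seg_int w p G (q, p + v)\<bar> \<le> K"
    using p by (intro seg_int_bound[OF _ _ _ G w]) auto
  have "dist (seg p s (q, p + v)) (seg p' s (q', p' + v')) \<le> norm (q - q') + norm (p - p') + norm (v - v')"
    if "s \<in> {0..1}" for s
  proof -
    have "dist (seg p s (q, p + v)) (seg p' s (q', p' + v')) = norm (q - q', (p - p') + s *\<^sub>R (v - v'))"
      by (simp add: seg_def dist_norm algebra_simps)
    also have "\<dots> \<le> norm (q - q') + norm ((p - p') + s *\<^sub>R (v - v'))" by (rule norm_Pair_le)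
    also have "\<dots> \<le> norm (q - q') + (norm (p - p') + norm (s *\<^sub>R (v - v')))"
      by (intro add_left_mono norm_triangle_ineq)
    also have "norm (s *\<^sub>R (v - v')) \<le> norm (v - v')" using that by (simp add: mult_left_le_one_le)
    finally show ?thesis by simp
  qed
  thus "\<bar>seg_int w p G (q, p + v) - seg_int w p' G (q', p' + v')\<bar> \<le> K * (norm (q - q') + norm (p - p') + norm (v - v'))"
    using p by (intro seg_int_diff_bound[OF _ _ _ _ _ G w]) auto
qed

lemma JP_bounds:
  assumes "b \<in> Basis" "c \<in> Basis" "p \<in> BB" "p + v \<in> BB" "p' \<in> BB" "p' + v' \<in> BB"
  shows "\<bar>JP t b c p q v\<bar> \<le> K"
    "\<bar>JP t b c p q v - JP t b c p' q' v'\<bar> \<le> K * (norm (q - q') + norm (p - p') + norm (v - v'))"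
  unfolding JP_def
  using seg_int_shift_bounds[OF CkLip_bd_lip[OF F_CkLip[OF assms(1,2)]], of "\<lambda>s. 1"] assms(3-) by auto

lemma JQ_bounds:
  assumes "e \<in> Basis" "b \<in> Basis" "c \<in> Basis" "p \<in> BB" "p + v \<in> BB" "p' \<in> BB" "p' + v' \<in> BB"
  shows "\<bar>JQ t e b c p q v\<bar> \<le> K"
    "\<bar>JQ t e b c p q v - JQ t e b c p' q' v'\<bar> \<le> K * (norm (q - q') + norm (p - p') + norm (v - v'))"
proof -
  have "(e, 0) \<in> Basis" using assms(1) by (simp add: Basis_prod_def)
  note G = CkLip_bd_lip[OF CkLip_SucD(3)[OF F_CkLip[OF assms(2,3)] this]]
  have w: "continuous_on {0..1} (\<lambda>s::real. 1 - s)" "\<And>s::real. s \<in> {0..1} \<Longrightarrow> \<bar>1 - s\<bar> \<le> 1"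
    by (auto intro!: continuous_intros)
  show "\<bar>JQ t e b c p q v\<bar> \<le> K"
    "\<bar>JQ t e b c p q v - JQ t e b c p' q' v'\<bar> \<le> K * (norm (q - q') + norm (p - p') + norm (v - v'))"
    unfolding JQ_def using seg_int_shift_bounds[OF G w] assms(4-) by blast+
qed

text \<open>With \<open>a = \<tau> powr (- l)\<close> and \<open>i = 1 / \<tau>\<close>, \<open>\<tau> = 1 + \<bar>t\<bar>\<close>, all weights are monomials in \<open>a\<close> and \<open>i\<close>.\<close>

definition "wa t = (1 + \<bar>t\<bar>) powr (- l)"

definition "wi t = 1 / (1 + \<bar>t::real\<bar>)"

text \<open>\<open>E \<le> \<rho>\<^sup>2\<close> puts the perturbation on the level of the
  quadratic Taylor remainder for displacements of size \<rho>. Points of \<open>P\<close> keep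
  enough distance from the boundary for the displaced points to stay in the ball.\<close>

context
  fixes \<rho> :: real and P :: "(real^'n) set"
  assumes \<rho>: "0 < \<rho>" "\<rho> \<le> 1" and E\<rho>: "E \<le> \<rho>\<^sup>2"
    and PD: "P \<subseteq> D" and PB: "\<And>p v. p \<in> P \<Longrightarrow> norm v \<le> \<rho> \<Longrightarrow> p + v \<in> BB"
begin

lemma E_bounds: "0 \<le> E" "E \<le> \<rho>" "E \<le> 1"
proof -
  show "0 \<le> E" using \<epsilon> by (simp add: E_def)
  have "\<rho>\<^sup>2 \<le> \<rho> * 1" unfolding power2_eq_square using \<rho> by (intro mult_left_mono) auto
  thus "E \<le> \<rho>" "E \<le> 1" using E\<rho> \<rho> by auto
qed

lemma weights:
  "(1 + \<bar>t\<bar>) powr (- (l + 1)) = wa t * wi t" "(1 + \<bar>t\<bar>) powr (- (l + 2)) = wa t * wi t * wi t"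
  "(1 + \<bar>t\<bar>) powr (- l - 1) = wa t * wi t" "(1 + \<bar>t\<bar>) powr (- l - 2) = wa t * wi t * wi t"
  "(1 + \<bar>t\<bar>) powr (1 - (l + 1)) = wa t" "(1 + \<bar>t\<bar>) powr (1 - (l + 2)) = wa t * wi t"
proof -
  have pos: "0 < 1 + \<bar>t\<bar>" by simp
  have 1: "(1 + \<bar>t\<bar>) powr (- l - 1) = wa t * wi t"
    using pos by (simp add: wa_def wi_def powr_diff)
  have 2: "(1 + \<bar>t\<bar>) powr (- l - 2) = wa t * wi t * wi t"
    using pos by (simp add: wa_def wi_def powr_diff power2_eq_square)
  have e: "- (l + 1) = - l - 1" "- (l + 2) = - l - 2" "1 - (l + 1) = - l" "1 - (l + 2) = - l - 1" by auto
  show "(1 + \<bar>t\<bar>) powr (- (l + 1)) = wa t * wi t" "(1 + \<bar>t\<bar>) powr (- (l + 2)) = wa t * wi t * wi t"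
    "(1 + \<bar>t\<bar>) powr (- l - 1) = wa t * wi t" "(1 + \<bar>t\<bar>) powr (- l - 2) = wa t * wi t * wi t"
    "(1 + \<bar>t\<bar>) powr (1 - (l + 1)) = wa t" "(1 + \<bar>t\<bar>) powr (1 - (l + 2)) = wa t * wi t"
    unfolding e using 1 2 by (simp_all add: wa_def)
qed

lemma weights_range: "0 < wa t" "wa t \<le> 1" "0 < wi t" "wi t \<le> 1"
proof -
  have pos: "0 < 1 + \<bar>t\<bar>" by simp
  have "(1 + \<bar>t\<bar>) powr (- l) \<le> (1 + \<bar>t\<bar>) powr 0" using l by (intro powr_mono) auto
  also have "\<dots> = 1" using pos by (simp only: powr_zero_eq_one if_False less_imp_neq[symmetric])
  finally show "wa t \<le> 1" by (simp add: wa_def)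
  have "0 < 1 + \<bar>t\<bar>" by simp
  thus "0 < wa t" by (simp add: wa_def)
qed (auto simp: wi_def)

lemma v_small:
  assumes "norm v \<le> \<rho> * (wa t * wi t)" shows "norm v \<le> \<rho>"
proof -
  have "wa t * wi t \<le> 1 * 1" using weights_range[of t] by (intro mult_mono) auto
  hence "\<rho> * (wa t * wi t) \<le> \<rho> * 1" using \<rho> by (intro mult_left_mono) auto
  thus ?thesis using assms by simp
qed

lemma inner_Basis_le: "b \<in> Basis \<Longrightarrow> norm v \<le> x \<Longrightarrow> \<bar>v \<bullet> b\<bar> \<le> x"
  using Basis_le_norm[of b v] by linarith

lemma c1_ge: "1 + real CARD('n) * K \<le> c1" "1 + real CARD('n) + real CARD('n) * real CARD('n) * K \<le> c1" "2 * real CARD('n) * K \<le> c1" "1 + real CARD('n) * (2 * K) \<le> c1" "1 + real CARD('n) + 3 * real CARD('n) * real CARD('n) * K \<le> c1" "0 \<le> c1"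
proof -
  have "0 \<le> real CARD('n) * K" "0 \<le> real CARD('n) * real CARD('n) * K" using K0 by simp_all
  thus "1 + real CARD('n) * K \<le> c1" "1 + real CARD('n) + real CARD('n) * real CARD('n) * K \<le> c1" "2 * real CARD('n) * K \<le> c1" "1 + real CARD('n) * (2 * K) \<le> c1" "1 + real CARD('n) + 3 * real CARD('n) * real CARD('n) * K \<le> c1" "0 \<le> c1"
    unfolding c1_def by (simp_all add: algebra_simps)
qed

lemma dp_bound:
  assumes p: "p \<in> P" and v: "norm v \<le> \<rho> * (wa t * wi t)" and c: "c \<in> Basis"
  shows "\<bar>dp [c] H q (p + v) t - partial c h p\<bar> \<le> c1 * \<rho> * (wa t * wi t)"
proof -
  let ?w = "wa t * wi t"
  have w: "0 \<le> ?w" using weights_range[of t] by simp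
  have pB: "p \<in> BB" "p + v \<in> BB" using p PD D PB[OF p v_small[OF v]] by auto
  have 1: "\<bar>dp [c] f q p t\<bar> \<le> E * ?w"
    using decays_bound[OF decays_p[OF c] pB(1), of q t] unfolding weights .
  have 2: "\<bar>\<Sum>b\<in>Basis. (v \<bullet> b) * JP t b c p q v\<bar> \<le> (\<Sum>b\<in>(Basis :: (real^'n) set). \<rho> * ?w * K)"
  proof (rule order_trans[OF sum_abs sum_mono])
    fix b :: "real^'n" assume b: "b \<in> Basis"
    show "\<bar>(v \<bullet> b) * JP t b c p q v\<bar> \<le> \<rho> * ?w * K"
      unfolding abs_mult using inner_Basis_le[OF b v] JP_bounds(1)[OF b c pB pB] by (intro mult_mono) auto
  qed
  have "\<bar>dp [c] H q (p + v) t - partial c h p\<bar> \<le> E * ?w + real CARD('n) * (\<rho> * ?w * K)"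
    unfolding dp_H_expansion[OF subsetD[OF PD p] pB(2) c] using 1 2 by simp
  also have "\<dots> \<le> \<rho> * ?w + real CARD('n) * (\<rho> * ?w * K)"
    using E_bounds w by (intro add_right_mono mult_right_mono) auto
  also have "\<dots> = (1 + real CARD('n) * K) * (\<rho> * ?w)" by (simp add: algebra_simps)
  also have "\<dots> \<le> c1 * (\<rho> * ?w)" using c1_ge(1) w \<rho> by (intro mult_right_mono) auto
  finally show ?thesis by (simp add: mult.assoc)
qed

text \<open>There are three contributions: the force of \<open>f\<close>, already with the exponent
  -l-2; the mixed derivative of \<open>f\<close> times v; and the remainder, quadratic in v. The
  last two are products of two factors with exponent -l-1, hence decay faster than required.\<close>

lemma dq_bound:
  assumes p: "p \<in> P" and v: "norm v \<le> \<rho> * (wa t * wi t)" and e: "e \<in> Basis"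
  shows "\<bar>dq [e] H q (p + v) t\<bar> \<le> c1 * \<rho>\<^sup>2 * (wa t * wi t * wi t)"
proof -
  let ?w = "wa t * wi t"
  have w: "0 \<le> ?w" using weights_range[of t] by simp
  have pB: "p \<in> BB" "p + v \<in> BB" using p PD D PB[OF p v_small[OF v]] by auto
  have ww: "?w * ?w \<le> ?w * wi t"
    using weights_range[of t] w by (intro mult_left_mono) (auto simp: mult_le_cancel_right1)
  have 1: "\<bar>dq [e] f q p t\<bar> \<le> \<rho>\<^sup>2 * (?w * wi t)"
  proof -
    have "\<bar>dq [e] f q p t\<bar> \<le> E * (?w * wi t)"
      using decays_bound[OF decays_q[OF e] pB(1), of q t] unfolding weights .
    also have "\<dots> \<le> \<rho>\<^sup>2 * (?w * wi t)" using E\<rho> w weights_range[of t] by (intro mult_right_mono) auto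
    finally show ?thesis .
  qed
  have 2: "\<bar>\<Sum>c\<in>Basis. (v \<bullet> c) * dq [e] (dp [c] f) q p t\<bar> \<le> (\<Sum>c\<in>(Basis :: (real^'n) set). \<rho>\<^sup>2 * (?w * wi t))"
  proof (rule order_trans[OF sum_abs sum_mono])
    fix c :: "real^'n" assume c: "c \<in> Basis"
    have "\<bar>dq [e] (dp [c] f) q p t\<bar> \<le> E * ?w"
      using decays_bound[OF decays_qp[OF e c] pB(1), of q t] unfolding weights .
    also have "\<dots> \<le> \<rho> * ?w" using E_bounds w by (intro mult_right_mono) auto
    finally have "\<bar>(v \<bullet> c) * dq [e] (dp [c] f) q p t\<bar> \<le> (\<rho> * ?w) * (\<rho> * ?w)"
      unfolding abs_mult using inner_Basis_le[OF c v] by (intro mult_mono) auto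
    also have "\<dots> = \<rho>\<^sup>2 * (?w * ?w)" by (simp add: power2_eq_square)
    also have "\<dots> \<le> \<rho>\<^sup>2 * (?w * wi t)" using mult_left_mono[OF ww, of "\<rho>\<^sup>2"] by simp
    finally show "\<bar>(v \<bullet> c) * dq [e] (dp [c] f) q p t\<bar> \<le> \<rho>\<^sup>2 * (?w * wi t)" .
  qed
  have 3: "\<bar>\<Sum>c\<in>Basis. \<Sum>b\<in>Basis. (v \<bullet> c) * (v \<bullet> b) * JQ t e b c p q v\<bar>
      \<le> (\<Sum>c\<in>(Basis :: (real^'n) set). \<Sum>b\<in>(Basis :: (real^'n) set). \<rho>\<^sup>2 * (?w * wi t) * K)"
  proof (rule order_trans[OF sum_abs sum_mono], rule order_trans[OF sum_abs sum_mono])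
    fix c b :: "real^'n" assume c: "c \<in> Basis" and b: "b \<in> Basis"
    have "\<bar>(v \<bullet> c) * (v \<bullet> b)\<bar> \<le> (\<rho> * ?w) * (\<rho> * ?w)"
      unfolding abs_mult using inner_Basis_le[OF c v] inner_Basis_le[OF b v] by (intro mult_mono) auto
    also have "\<dots> = \<rho>\<^sup>2 * (?w * ?w)" by (simp add: power2_eq_square)
    also have "\<dots> \<le> \<rho>\<^sup>2 * (?w * wi t)" using mult_left_mono[OF ww, of "\<rho>\<^sup>2"] by simp
    finally show "\<bar>(v \<bullet> c) * (v \<bullet> b) * JQ t e b c p q v\<bar> \<le> \<rho>\<^sup>2 * (?w * wi t) * K"
      unfolding abs_mult[of "(v \<bullet> c) * (v \<bullet> b)"] using JQ_bounds(1)[OF e b c pB pB] by (intro mult_mono) auto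
  qed
  have "\<bar>dq [e] H q (p + v) t\<bar> \<le> \<rho>\<^sup>2 * (?w * wi t) + real CARD('n) * (\<rho>\<^sup>2 * (?w * wi t)) + real CARD('n) * (real CARD('n) * (\<rho>\<^sup>2 * (?w * wi t) * K))"
    unfolding dq_H_expansion[OF subsetD[OF PD p] pB(2) e] using 1 2 3 by simp
  also have "\<dots> = (1 + real CARD('n) + real CARD('n) * real CARD('n) * K) * (\<rho>\<^sup>2 * (?w * wi t))" by (simp add: algebra_simps)
  also have "\<dots> \<le> c1 * (\<rho>\<^sup>2 * (?w * wi t))" using c1_ge(2) w weights_range[of t] by (intro mult_right_mono) auto
  finally show ?thesis by (simp add: mult.assoc)
qed

text \<open>The coefficient of \<open>norm (v - v')\<close> has no factor \<rho>, because it is an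
  average of the Hessian of \<open>H\<close>. The differences in q and p are multiplied by
  \<open>E\<close> or by v itself, which supplies both \<rho> and the decay.\<close>

lemma dp_lip:
  assumes p: "p \<in> P" "p' \<in> P" and v: "norm v \<le> \<rho> * (wa t * wi t)" "norm v' \<le> \<rho> * (wa t * wi t)" and c: "c \<in> Basis"
  shows "\<bar>(dp [c] H q (p + v) t - partial c h p) - (dp [c] H q' (p' + v') t - partial c h p')\<bar>
    \<le> c1 * norm (v - v') + c1 * \<rho> * wa t * (norm (q - q') * wi t + norm (p - p'))"
proof -
  let ?w = "wa t * wi t" and ?dq = "norm (q - q')" and ?dp = "norm (p - p')" and ?dv = "norm (v - v')"
  note wr = weights_range[of t]
  have w: "0 \<le> ?w" "?w \<le> wa t" using wr by (simp_all add: mult_left_le)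
  have pB: "p \<in> BB" "p + v \<in> BB" "p' \<in> BB" "p' + v' \<in> BB"
    using p PD D PB[OF p(1) v_small[OF v(1)]] PB[OF p(2) v_small[OF v(2)]] by auto
  have 1: "\<bar>dp [c] f q p t - dp [c] f q' p' t\<bar> \<le> E * ?w * ?dq + E * wa t * ?dp"
    using decays_lip[OF decays_p[OF c] pB(1,3), of q t q'] unfolding weights .
  have 2: "\<bar>(\<Sum>b\<in>Basis. (v \<bullet> b) * JP t b c p q v) - (\<Sum>b\<in>Basis. (v' \<bullet> b) * JP t b c p' q' v')\<bar>
      \<le> real CARD('n) * (?dv * K + \<rho> * ?w * (K * (?dq + ?dp + ?dv)))"
  proof -
    have d: "\<bar>(v \<bullet> b) * JP t b c p q v - (v' \<bullet> b) * JP t b c p' q' v'\<bar> \<le> ?dv * K + \<rho> * ?w * (K * (?dq + ?dp + ?dv))"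
      if b: "b \<in> Basis" for b
    proof -
      have "\<bar>v \<bullet> b - v' \<bullet> b\<bar> \<le> ?dv"
        using inner_Basis_le[OF b order_refl, of "v - v'"] by (simp add: inner_diff_left)
      from abs_mult_diff_le[OF JP_bounds(1)[OF b c pB(1,2,1,2)] inner_Basis_le[OF b v(2)] this JP_bounds(2)[OF b c pB]]
      show ?thesis .
    qed
    have "\<bar>(\<Sum>b\<in>Basis. (v \<bullet> b) * JP t b c p q v) - (\<Sum>b\<in>Basis. (v' \<bullet> b) * JP t b c p' q' v')\<bar>
      \<le> real (card (Basis :: (real^'n) set)) * (?dv * K + \<rho> * ?w * (K * (?dq + ?dp + ?dv)))"
      by (rule sum_diff_le) (rule d)
    thus ?thesis by simp
  qed
  \<comment> \<open>The variation of the averaged Hessian with v is simply joined to the main term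
    in \<open>norm (v - v')\<close>, hence the factor 2 in \<open>2 * K\<close>.\<close>
  have "\<rho> * ?w \<le> 1" using \<rho> w wr by (intro mult_le_one) auto
  hence "\<rho> * ?w * (K * ?dv) \<le> 1 * (K * ?dv)" using K0 by (intro mult_right_mono) auto
  moreover have "\<rho> * ?w * (K * ?dp) \<le> \<rho> * wa t * (K * ?dp)" using K0 \<rho> w by (intro mult_right_mono mult_left_mono) auto
  ultimately have "\<rho> * ?w * (K * (?dq + ?dp + ?dv)) \<le> K * ?dv + \<rho> * wa t * (K * (?dq * wi t + ?dp))"
    by (simp add: algebra_simps)
  hence "?dv * K + \<rho> * ?w * (K * (?dq + ?dp + ?dv)) \<le> 2 * K * ?dv + \<rho> * wa t * (K * (?dq * wi t + ?dp))"
    by simp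
  hence 3: "real CARD('n) * (?dv * K + \<rho> * ?w * (K * (?dq + ?dp + ?dv))) \<le> real CARD('n) * (2 * K * ?dv + \<rho> * wa t * (K * (?dq * wi t + ?dp)))"
    by (rule mult_left_mono) simp
  have "E * ?w * ?dq + E * wa t * ?dp = E * (wa t * (?dq * wi t + ?dp))" by (simp add: algebra_simps)
  also have "\<dots> \<le> \<rho> * (wa t * (?dq * wi t + ?dp))" using E_bounds wr by (intro mult_right_mono) auto
  finally have 4: "E * ?w * ?dq + E * wa t * ?dp \<le> \<rho> * (wa t * (?dq * wi t + ?dp))" .
  have "\<bar>(dp [c] H q (p + v) t - partial c h p) - (dp [c] H q' (p' + v') t - partial c h p')\<bar>
      \<le> \<rho> * (wa t * (?dq * wi t + ?dp)) + real CARD('n) * (2 * K * ?dv + \<rho> * wa t * (K * (?dq * wi t + ?dp)))"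
    unfolding dp_H_expansion[OF subsetD[OF PD p(1)] pB(2) c] dp_H_expansion[OF subsetD[OF PD p(2)] pB(4) c]
    using 1 2 3 4 by linarith
  also have "\<dots> = 2 * real CARD('n) * K * ?dv + (1 + real CARD('n) * K) * (\<rho> * (wa t * (?dq * wi t + ?dp)))" by (simp add: algebra_simps)
  also have "\<dots> \<le> c1 * ?dv + c1 * (\<rho> * (wa t * (?dq * wi t + ?dp)))"
    using c1_ge wr \<rho> by (intro add_mono mult_right_mono) auto
  finally show ?thesis by (simp add: mult.assoc)
qed

text \<open>Unlike for the velocity, every term here keeps a factor \<rho> with exponent -l-1: it
  comes from the derivatives of \<open>f\<close> or from one factor v. Any further small factor
  serves to bring the remaining difference into the form of the right-hand side.\<close>

lemma dq_lip:
  assumes p: "p \<in> P" "p' \<in> P" and v: "norm v \<le> \<rho> * (wa t * wi t)" "norm v' \<le> \<rho> * (wa t * wi t)" and e: "e \<in> Basis"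
  shows "\<bar>dq [e] H q (p + v) t - dq [e] H q' (p' + v') t\<bar>
    \<le> c1 * \<rho> * (wa t * wi t) * (norm (q - q') * wi t + norm (p - p') + norm (v - v'))"
proof -
  let ?w = "wa t * wi t" and ?dq = "norm (q - q')" and ?dp = "norm (p - p')" and ?dv = "norm (v - v')"
  define Y where "Y = ?dq * wi t + ?dp + ?dv"
  note wr = weights_range[of t]
  have w: "0 \<le> ?w" "?w \<le> 1" using wr by (simp_all add: mult_le_one)
  have Y: "0 \<le> Y" using wr by (simp add: Y_def)
  have pB: "p \<in> BB" "p + v \<in> BB" "p' \<in> BB" "p' + v' \<in> BB"
    using p PD D PB[OF p(1) v_small[OF v(1)]] PB[OF p(2) v_small[OF v(2)]] by auto
  have 1: "\<bar>dq [e] f q p t - dq [e] f q' p' t\<bar> \<le> \<rho> * ?w * Y"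
  proof -
    have "\<bar>dq [e] f q p t - dq [e] f q' p' t\<bar> \<le> E * (?w * wi t) * ?dq + E * ?w * ?dp"
      using decays_lip[OF decays_q[OF e] pB(1,3), of q t q'] unfolding weights .
    also have "\<dots> = E * (?w * (?dq * wi t + ?dp))" by (simp add: algebra_simps)
    also have "\<dots> \<le> \<rho> * (?w * Y)" using E_bounds w wr \<rho> by (intro mult_mono mult_nonneg_nonneg add_nonneg_nonneg) (auto simp: Y_def)
    finally show ?thesis by (simp add: mult.assoc)
  qed
  have 2: "\<bar>(v \<bullet> c) * dq [e] (dp [c] f) q p t - (v' \<bullet> c) * dq [e] (dp [c] f) q' p' t\<bar> \<le> \<rho> * ?w * Y"
    if c: "c \<in> Basis" for c
  proof -
    have a: "\<bar>dq [e] (dp [c] f) q p t\<bar> \<le> E * ?w"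
      using decays_bound[OF decays_qp[OF e c] pB(1), of q t] unfolding weights .
    have b: "\<bar>dq [e] (dp [c] f) q p t - dq [e] (dp [c] f) q' p' t\<bar> \<le> E * ?w * ?dq + E * wa t * ?dp"
      using decays_lip[OF decays_qp[OF e c] pB(1,3), of q t q'] unfolding weights .
    have "\<bar>(v \<bullet> c) * dq [e] (dp [c] f) q p t - (v' \<bullet> c) * dq [e] (dp [c] f) q' p' t\<bar>
        \<le> ?dv * (E * ?w) + \<rho> * ?w * (E * ?w * ?dq + E * wa t * ?dp)"
      using inner_Basis_le[OF c order_refl, of "v - v'"]
      by (intro abs_mult_diff_le a b inner_Basis_le[OF c v(2)]) (simp add: inner_diff_left)
    also have "\<dots> = E * (?w * ?dv) + (E * wa t) * (\<rho> * ?w * (?dq * wi t + ?dp))" by (simp add: algebra_simps)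
    also have "\<dots> \<le> \<rho> * (?w * ?dv) + 1 * (\<rho> * ?w * (?dq * wi t + ?dp))"
      using E_bounds w wr \<rho> by (intro add_mono mult_right_mono mult_nonneg_nonneg) (auto intro: mult_le_one)
    also have "\<dots> = \<rho> * ?w * Y" by (simp add: Y_def algebra_simps)
    finally show ?thesis .
  qed
  have 3: "\<bar>(v \<bullet> c) * (v \<bullet> b) * JQ t e b c p q v - (v' \<bullet> c) * (v' \<bullet> b) * JQ t e b c p' q' v'\<bar> \<le> 3 * K * (\<rho> * ?w * Y)"
    if c: "c \<in> Basis" and b: "b \<in> Basis" for c b
  proof -
    have i: "\<bar>v \<bullet> b - v' \<bullet> b\<bar> \<le> ?dv" "\<bar>v \<bullet> c - v' \<bullet> c\<bar> \<le> ?dv"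
      using inner_Basis_le[OF b order_refl, of "v - v'"] inner_Basis_le[OF c order_refl, of "v - v'"]
      by (simp_all add: inner_diff_left)
    have vv: "\<bar>(v \<bullet> c) * (v \<bullet> b) - (v' \<bullet> c) * (v' \<bullet> b)\<bar> \<le> ?dv * (\<rho> * ?w) + \<rho> * ?w * ?dv"
      by (intro abs_mult_diff_le i inner_Basis_le[OF b v(1)] inner_Basis_le[OF c v(2)])
    have vw: "\<bar>(v' \<bullet> c) * (v' \<bullet> b)\<bar> \<le> (\<rho> * ?w) * (\<rho> * ?w)"
      unfolding abs_mult using inner_Basis_le[OF c v(2)] inner_Basis_le[OF b v(2)] by (intro mult_mono) auto
    have "\<bar>(v \<bullet> c) * (v \<bullet> b) * JQ t e b c p q v - (v' \<bullet> c) * (v' \<bullet> b) * JQ t e b c p' q' v'\<bar>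
        \<le> (?dv * (\<rho> * ?w) + \<rho> * ?w * ?dv) * K + (\<rho> * ?w) * (\<rho> * ?w) * (K * (?dq + ?dp + ?dv))"
      by (rule abs_mult_diff_le[OF JQ_bounds(1)[OF e b c pB(1,2,1,2)] vw vv JQ_bounds(2)[OF e b c pB]])
    also have "(\<rho> * ?w) * (\<rho> * ?w) * (K * (?dq + ?dp + ?dv)) \<le> (\<rho> * ?w) * (K * Y)"
    proof -
      \<comment> \<open>\<open>norm (q - q')\<close> has to come with the factor
        \<open>wi t\<close>; of the two factors bounded by \<open>\<rho> * ?w\<close> one supplies
        it, the other is kept in front.\<close>
      have a1: "\<rho> * ?w \<le> wi t"
      proof -
        have "(\<rho> * wa t) * wi t \<le> 1 * wi t" using \<rho> wr by (intro mult_right_mono mult_le_one) auto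
        thus ?thesis by simp
      qed
      hence a2: "\<rho> * ?w \<le> 1" using wr by linarith
      have "(\<rho> * ?w) * (?dq + ?dp + ?dv) = (\<rho> * ?w) * ?dq + (\<rho> * ?w) * ?dp + (\<rho> * ?w) * ?dv" by (simp add: algebra_simps)
      also have "\<dots> \<le> wi t * ?dq + 1 * ?dp + 1 * ?dv" using a1 a2 by (intro add_mono mult_right_mono) auto
      finally have "(\<rho> * ?w) * (?dq + ?dp + ?dv) \<le> Y" by (simp add: Y_def mult.commute)
      hence "(\<rho> * ?w) * (K * ((\<rho> * ?w) * (?dq + ?dp + ?dv))) \<le> (\<rho> * ?w) * (K * Y)"
        using K0 w \<rho> by (intro mult_left_mono) auto
      thus ?thesis by (simp add: mult_ac)
    qed
    also have "(?dv * (\<rho> * ?w) + \<rho> * ?w * ?dv) * K = 2 * K * (\<rho> * ?w * ?dv)" by (simp add: algebra_simps)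
    also have "2 * K * (\<rho> * ?w * ?dv) \<le> 2 * K * (\<rho> * ?w * Y)"
      using K0 w \<rho> wr by (intro mult_left_mono) (auto simp: Y_def)
    finally show ?thesis by (simp add: algebra_simps)
  qed
  have "\<bar>(\<Sum>c\<in>Basis. (v \<bullet> c) * dq [e] (dp [c] f) q p t) - (\<Sum>c\<in>Basis. (v' \<bullet> c) * dq [e] (dp [c] f) q' p' t)\<bar>
      \<le> real (card (Basis :: (real^'n) set)) * (\<rho> * ?w * Y)"
    by (rule sum_diff_le) (rule 2)
  hence S2: "\<bar>(\<Sum>c\<in>Basis. (v \<bullet> c) * dq [e] (dp [c] f) q p t) - (\<Sum>c\<in>Basis. (v' \<bullet> c) * dq [e] (dp [c] f) q' p' t)\<bar>
      \<le> real CARD('n) * (\<rho> * ?w * Y)" by simp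
  have "\<bar>(\<Sum>c\<in>Basis. \<Sum>b\<in>Basis. (v \<bullet> c) * (v \<bullet> b) * JQ t e b c p q v) -
      (\<Sum>c\<in>Basis. \<Sum>b\<in>Basis. (v' \<bullet> c) * (v' \<bullet> b) * JQ t e b c p' q' v')\<bar>
      \<le> real (card (Basis :: (real^'n) set)) * (real (card (Basis :: (real^'n) set)) * (3 * K * (\<rho> * ?w * Y)))"
    by (rule sum_diff_le, rule sum_diff_le, rule 3)
  hence S3: "\<bar>(\<Sum>c\<in>Basis. \<Sum>b\<in>Basis. (v \<bullet> c) * (v \<bullet> b) * JQ t e b c p q v) -
      (\<Sum>c\<in>Basis. \<Sum>b\<in>Basis. (v' \<bullet> c) * (v' \<bullet> b) * JQ t e b c p' q' v')\<bar>
      \<le> real CARD('n) * (real CARD('n) * (3 * K * (\<rho> * ?w * Y)))" by simp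
  have "\<bar>dq [e] H q (p + v) t - dq [e] H q' (p' + v') t\<bar> \<le> \<rho> * ?w * Y + real CARD('n) * (\<rho> * ?w * Y) + real CARD('n) * (real CARD('n) * (3 * K * (\<rho> * ?w * Y)))"
    unfolding dq_H_expansion[OF subsetD[OF PD p(1)] pB(2) e] dq_H_expansion[OF subsetD[OF PD p(2)] pB(4) e]
    using 1 S2 S3 by linarith
  also have "\<dots> = (1 + real CARD('n) + 3 * real CARD('n) * real CARD('n) * K) * (\<rho> * ?w * Y)" by (simp add: algebra_simps)
  also have "\<dots> \<le> c1 * (\<rho> * ?w * Y)" using c1_ge(5) w \<rho> Y by (intro mult_right_mono) auto
  finally show ?thesis by (simp add: Y_def mult.assoc)
qed

text \<open>\<open>D\<close> need not be convex, so the mean value argument is carried out in the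
  ball, for the p-gradient of \<open>H\<close> at q = 0 and t = 0, whose derivatives are bounded by
  \<open>K\<close>. On \<open>D\<close> it differs from the gradient of \<open>h\<close> only by
  that of \<open>f\<close>, which is Lipschitz in p.\<close>

lemma partial_h_lip:
  assumes p: "p \<in> P" "p' \<in> P" and c: "c \<in> Basis"
  shows "\<bar>partial c h p - partial c h p'\<bar> \<le> c1 * norm (p - p')"
proof -
  have pD: "p \<in> D" "p' \<in> D" and pB: "p \<in> BB" "p' \<in> BB" using p PD D by auto
  have b: "partial c h p = dp [c] H 0 p 0 - dp [c] f 0 p 0" if "p \<in> D" for p
    using hessian_data(2)[OF that c, of 0 0] by (simp add: Ht_def dp_def)
  have "Ck_on (Suc 1) BB (\<lambda>p. H 0 p 0)" using H_C2 by (simp add: numeral_2_eq_2)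
  from Ck_on_Suc(3)[OF this c] have C: "Ck_on (Suc 0) BB (partial c (\<lambda>p. H 0 p 0))" by simp
  have "\<bar>partial c (\<lambda>p. H 0 p 0) p - partial c (\<lambda>p. H 0 p 0) p'\<bar> \<le> real DIM(real^'n) * K * dist p p'"
  proof (rule Lipschitz_of_partial_bound[OF C open_ball convex_ball _ pB])
    fix b p :: "real^'n" assume "b \<in> Basis" "p \<in> BB"
    thus "\<bar>partial b (partial c (\<lambda>p. H 0 p 0)) p\<bar> \<le> K"
      using CkLip_bd_lip[OF F_CkLip[of b c 0]] c by (auto simp: bd_lip_def F_def)
  qed
  moreover have "\<bar>dp [c] f 0 p 0 - dp [c] f 0 p' 0\<bar> \<le> norm (p - p')"
  proof -
    have "\<bar>dp [c] f 0 p 0 - dp [c] f 0 p' 0\<bar> \<le> E * norm (p - p')"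
      using decays_lip[OF decays_p[OF c] pB, of 0 0 0] by simp
    also have "\<dots> \<le> 1 * norm (p - p')" using E_bounds by (intro mult_right_mono) auto
    finally show ?thesis by simp
  qed
  ultimately have "\<bar>partial c h p - partial c h p'\<bar> \<le> real CARD('n) * K * norm (p - p') + norm (p - p')"
    unfolding b[OF pD(1)] b[OF pD(2)] dp_def partials.simps by (simp add: dist_norm)
  also have "\<dots> = (1 + real CARD('n) * K) * norm (p - p')" by (simp add: algebra_simps)
  also have "\<dots> \<le> c1 * norm (p - p')" using c1_ge(1) by (rule mult_right_mono) simp
  finally show ?thesis .
qed

end

end

section \<open>Trivial tori, distance on the torus and glueing of half-orbits\<close>

lemma torus_embedding_trivial:
  fixes p :: "real^'n::finite"
  assumes "p \<in> B" "0 \<le> \<sigma>"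
  shows "torus_embedding \<sigma> B (trivial_torus p)"
  unfolding torus_embedding_def
proof (intro conjI allI ballI impI)
  fix q show "snd (trivial_torus p q) \<in> B" using assms by (simp add: trivial_torus_def)
next
  fix q m :: "real^'n" assume "m \<in> lattice_vecs"
  thus "\<exists>m'\<in>lattice_vecs. trivial_torus p (q + m) = trivial_torus p q + (m', 0)"
    by (intro bexI[of _ m]) (auto simp: trivial_torus_def)
next
  fix q q' :: "real^'n" assume "\<exists>m\<in>lattice_vecs. trivial_torus p q' = trivial_torus p q + (m, 0)"
  thus "q' - q \<in> lattice_vecs" by (auto simp: trivial_torus_def)
next
  fix r :: real and b :: "'n phase" assume b: "b \<in> Basis"
  show "C_sigma \<sigma> (ball 0 r) (\<lambda>q. trivial_torus p q \<bullet> b)"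
    using b
  proof (cases rule: phase_basis_cases)
    case (1 i)
    have bd: "\<bar>(x - 0) \<bullet> axis i 1\<bar> \<le> \<bar>r\<bar> + 1" if "x \<in> ball 0 r" for x :: "real^'n"
      using Basis_le_norm[OF axis_in_Basis, of x i] that by simp
    have "norm (axis i 1 :: real^'n) \<le> \<bar>r\<bar> + 1" by (simp add: norm_Basis[OF axis_in_Basis])
    note CkLip_inner[of "ball 0 r" 0 "axis i 1" "\<bar>r\<bar> + 1" "nat \<lfloor>\<sigma>\<rfloor>", OF bd this]
    from CkLip_C_sigma[OF this] show ?thesis by (simp add: 1 trivial_torus_def)
  next
    case (2 i)
    from CkLip_C_sigma[OF CkLip_const[OF order_refl, of "nat \<lfloor>\<sigma>\<rfloor>" "ball 0 r" "p \<bullet> axis i 1"]]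
    show ?thesis by (simp add: 2 trivial_torus_def)
  qed
next
  fix q :: "real^'n"
  have "(trivial_torus p has_derivative (\<lambda>v. (v, 0))) (at q)"
    unfolding trivial_torus_def by (auto intro!: derivative_eq_intros)
  from frechet_derivative_at[OF this, symmetric]
  show "inj (frechet_derivative (trivial_torus p) (at q))" by (simp add: inj_on_def)
qed

lemma torus_dist_tendsto_0:
  fixes g k :: "'t \<Rightarrow> 'n::finite phase"
  assumes "((\<lambda>t. norm (g t - k t)) \<longlongrightarrow> 0) Fl"
  shows "((\<lambda>t. torus_dist (g t) (k t)) \<longlongrightarrow> 0) Fl"
proof (rule tendsto_sandwich[OF _ _ tendsto_const assms])
  have "0 \<le> torus_dist z z'" for z z' :: "'n phase"
    unfolding torus_dist_def using zero_in_lattice_vecs by (intro cINF_greatest) auto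
  thus "\<forall>\<^sub>F t in Fl. 0 \<le> torus_dist (g t) (k t)" by simp
  have "torus_dist z z' \<le> norm (z - z')" for z z' :: "'n phase"
  proof -
    have "torus_dist z z' \<le> norm (z + (0, 0) - z')"
      unfolding torus_dist_def
      by (rule cINF_lower[OF _ zero_in_lattice_vecs]) (auto simp: bdd_below_def intro!: exI[of _ 0])
    thus ?thesis by (simp flip: zero_prod_def)
  qed
  thus "\<forall>\<^sub>F t in Fl. torus_dist (g t) (k t) \<le> norm (g t - k t)" by simp
qed

text \<open>Each half-orbit is differentiable at time 0 from one side only; the two one-sided
  filters have the punctured neighbourhood filter as their supremum.\<close>

lemma has_vector_derivative_glue:
  fixes g :: "real \<Rightarrow> 'a::real_normed_vector"
  assumes "t \<ge> 0 \<Longrightarrow> (g has_vector_derivative d) (at t within {0..})"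
    and "t \<le> 0 \<Longrightarrow> (g has_vector_derivative d) (at t within {..0})"
  shows "(g has_vector_derivative d) (at t)"
proof -
  consider "t > 0" | "t < 0" | "t = 0" by linarith
  thus ?thesis
  proof cases
    case 1
    have "at t within {0..} = at t" using 1 by (intro at_within_interior) (simp add: interior_Ici[of 0 "-1"])
    thus ?thesis using assms(1) 1 by simp
  next
    case 2
    have "at t within {..0} = at t" using 2 by (intro at_within_interior) (simp add: interior_Iic[of 0 1])
    thus ?thesis using assms(2) 2 by simp
  next
    case 3
    have "{0..} \<union> {..0} = (UNIV :: real set)" by auto
    hence "at t within UNIV = sup (at t within {0..}) (at t within {..0})"
      by (metis at_within_union)
    thus ?thesis using assms 3
      unfolding has_vector_derivative_def has_derivative_within by (auto intro: filterlim_sup)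
  qed
qed

section \<open>The field of \<open>H\<close> as a decaying system, for both directions of
  time\<close>

context perturbed_hamiltonian
begin

text \<open>The part belonging to \<open>htilde\<close> is autonomous and continuous in (q, p), and
  the first derivatives of \<open>f\<close> are continuous in all variables as members of
  \<open>D_space\<close>; their sum is continuous jointly with time.\<close>

lemma dp_dq_H_continuous:
  assumes "D \<noteq> {}"
  shows "continuous_on (UNIV \<times> BB \<times> UNIV) (\<lambda>(q, p, t). dp [axis i 1] H q p t)"
    "continuous_on (UNIV \<times> BB \<times> UNIV) (\<lambda>(q, p, t). dq [axis i 1] H q p t)"
proof -
  have g: "continuous_on (UNIV \<times> BB \<times> UNIV) (\<lambda>x. ham_field htilde (fst x, fst (snd x)) 0)"
    for Y :: "real set"
    by (rule continuous_on_compose2[OF fields(4)[OF assms]]) (auto intro!: continuous_intros)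
  have p: "continuous_on (UNIV \<times> BB \<times> UNIV) (\<lambda>x. ham_field htilde (fst x, fst (snd x)) 0 \<bullet> (axis i 1, 0) + (\<lambda>(q, p, t). dp [axis i 1] f q p t) x)"
    using fp_in[OF axis_in_Basis, of i] by (intro continuous_on_add continuous_on_inner g continuous_on_const) (auto simp: D_space_def)
  have q: "continuous_on (UNIV \<times> BB \<times> UNIV) (\<lambda>x. (\<lambda>(q, p, t). dq [axis i 1] f q p t) x - ham_field htilde (fst x, fst (snd x)) 0 \<bullet> (0, axis i 1))"
    using fq_in[OF axis_in_Basis, of i] by (intro continuous_on_diff continuous_on_inner g continuous_on_const) (auto simp: D_space_def)
  show "continuous_on (UNIV \<times> BB \<times> UNIV) (\<lambda>(q, p, t). dp [axis i 1] H q p t)"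
    by (rule continuous_on_eq[OF p])
      (auto simp: ham_field_inner dp_H[OF _ axis_in_Basis] htilde_indep(1)[of _ _ _ 0])
  show "continuous_on (UNIV \<times> BB \<times> UNIV) (\<lambda>(q, p, t). dq [axis i 1] H q p t)"
    by (rule continuous_on_eq[OF q])
      (auto simp: ham_field_inner dq_H[OF _ axis_in_Basis] htilde_indep(2)[of _ _ _ 0])
qed

lemma XP_XQ_continuous:
  assumes "D \<noteq> {}"
  shows "continuous_on (UNIV \<times> BB \<times> UNIV) (\<lambda>x. XP (fst x) (fst (snd x)) (snd (snd x)))"
    "continuous_on (UNIV \<times> BB \<times> UNIV) (\<lambda>x. XQ (fst x) (fst (snd x)) (snd (snd x)))"
  unfolding XP_def XQ_def using dp_dq_H_continuous[OF assms]
  by (auto intro!: continuous_on_vec_lambda simp: case_prod_unfold)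

lemma XP_XQ_periodic:
  assumes "p \<in> BB" "m \<in> lattice_vecs"
  shows "XP (q + m) p t = XP q p t" "XQ (q + m) p t = XQ q p t"
proof -
  have "ham_field H (q + m, p) t = ham_field H (q, p) t"
    using ham_field_periodic[OF open_ball H_periodic] assms by (simp add: q_periodic_def fun_eq_iff)
  thus "XP (q + m) p t = XP q p t" "XQ (q + m) p t = XQ q p t"
    by (simp_all add: ham_field_def XP_def XQ_def vec_eq_iff)
qed

text \<open>\<open>sg = -1\<close> handles the past by time reversal: with
  \<open>t = sg * (s - 1)\<close> one has \<open>s = 1 + \<bar>t\<bar>\<close> for
  \<open>s \<ge> 1\<close>, and the field is multiplied by \<open>sg\<close>. In this variable
  \<open>wa\<close> and \<open>wi\<close> become the powers of s required by the locale.\<close>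

lemma decaying_system_H:
  fixes \<rho> M \<kappa> sg :: real
  assumes \<rho>: "0 < \<rho>" "\<rho> \<le> 1" and E\<rho>: "E \<le> \<rho>\<^sup>2"
    and PD: "P \<subseteq> D" and PB: "\<And>p v. p \<in> P \<Longrightarrow> norm v \<le> \<rho> \<Longrightarrow> p + v \<in> BB"
    and D0: "D \<noteq> {}" and M: "M = 4 * Cdyn / (l - 1) + 1" and \<kappa>: "\<kappa> = \<rho> * (Cdyn / (l - 1) + M * Cdyn)"
    and small: "\<kappa> \<le> 1 / 8" "Cdyn * \<rho> \<le> 1" and sg: "sg = 1 \<or> sg = -1"
  shows "decaying_system (\<lambda>q p s. sg *\<^sub>R XP q p (sg * (s - 1))) (\<lambda>q p s. - sg *\<^sub>R XQ q p (sg * (s - 1)))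
    BB P (\<lambda>p. sg *\<^sub>R freq p) l Cdyn \<rho> M \<kappa>"
proof
  have c10: "0 \<le> c1" using K0 by (simp add: c1_def)
  show C: "0 \<le> Cdyn" using c10 by (simp add: Cdyn_def)
  have nsg: "norm (sg *\<^sub>R x) = norm x" "norm (- sg *\<^sub>R x) = norm x" for x :: "real^'n" using sg by auto
  have asg: "\<bar>sg\<bar> = 1" using sg by auto
  define T where "T s = sg * (s - 1)" for s
  have T: "1 + \<bar>T s\<bar> = s" if "s \<ge> 1" for s using that sg by (auto simp: T_def)
  have pw: "s powr (- l - 1) = wa (T s) * wi (T s)" "s powr (- l - 2) = wa (T s) * wi (T s) * wi (T s)"
    "s powr (- l) = wa (T s)" "1 / s = wi (T s)" if "s \<ge> 1" for s
    using weights(3,4)[OF \<rho> E\<rho> PD PB, of "T s"] T[OF that] by (simp_all add: wa_def wi_def)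
  have c: "continuous_on (UNIV \<times> BB \<times> {1..}) (\<lambda>x :: (real^'n) \<times> (real^'n) \<times> real. (fst x, fst (snd x), sg * (snd (snd x) - 1)))"
    by (intro continuous_intros)
  have "continuous_on (UNIV \<times> BB \<times> {1..}) (\<lambda>x. XP (fst x) (fst (snd x)) (sg * (snd (snd x) - 1)))"
    "continuous_on (UNIV \<times> BB \<times> {1..}) (\<lambda>x. XQ (fst x) (fst (snd x)) (sg * (snd (snd x) - 1)))"
    using continuous_on_compose2[OF XP_XQ_continuous(1)[OF D0] c] continuous_on_compose2[OF XP_XQ_continuous(2)[OF D0] c]
    by (auto simp: image_subset_iff)
  thus "continuous_on (UNIV \<times> BB \<times> {1..}) (\<lambda>(q, p, s). sg *\<^sub>R XP q p (sg * (s - 1)))"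
    "continuous_on (UNIV \<times> BB \<times> {1..}) (\<lambda>(q, p, s). - sg *\<^sub>R XQ q p (sg * (s - 1)))"
    unfolding case_prod_unfold by - (rule continuous_on_scaleR[OF continuous_on_const], assumption)+
  show "norm (sg *\<^sub>R freq p - sg *\<^sub>R freq p') \<le> Cdyn * norm (p - p')" if "p \<in> P" "p' \<in> P" for p p'
  proof -
    have "norm (freq p - freq p') \<le> real CARD('n) * (c1 * norm (p - p'))"
      using partial_h_lip[OF \<rho> E\<rho> PD PB that axis_in_Basis] by (intro norm_vec_le) (simp add: freq_def)
    thus ?thesis by (simp add: scaleR_diff_right[symmetric] asg Cdyn_def mult.assoc del: scaleR_minus_left)
  qed
  fix q q' p p' v v' :: "real^'n" and s :: real
  assume p: "p \<in> P" and s: "1 \<le> s" and v: "norm v \<le> \<rho> * s powr (- l - 1)"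
  note vw = v[unfolded pw[OF s]]
  show "norm (sg *\<^sub>R XP q (p + v) (sg * (s - 1)) - sg *\<^sub>R freq p) \<le> Cdyn * \<rho> * s powr (- l - 1)"
  proof -
    have "norm (XP q (p + v) (T s) - freq p) \<le> real CARD('n) * (c1 * \<rho> * (wa (T s) * wi (T s)))"
      using dp_bound[OF \<rho> E\<rho> PD PB p vw axis_in_Basis] by (intro norm_vec_le) (simp add: freq_def XP_def)
    thus ?thesis
      by (simp add: scaleR_diff_right[symmetric] asg Cdyn_def mult.assoc pw[OF s] T_def del: scaleR_minus_left)
  qed
  show "norm (- sg *\<^sub>R XQ q (p + v) (sg * (s - 1))) \<le> Cdyn * \<rho>\<^sup>2 * s powr (- l - 2)"
  proof -
    have "norm (XQ q (p + v) (T s)) \<le> real CARD('n) * (c1 * \<rho>\<^sup>2 * (wa (T s) * wi (T s) * wi (T s)))"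
      using dq_bound[OF \<rho> E\<rho> PD PB p vw axis_in_Basis] by (intro norm_vec_le) (simp add: XQ_def)
    thus ?thesis unfolding nsg by (simp add: Cdyn_def mult.assoc pw[OF s] T_def)
  qed
  assume p': "p' \<in> P" and v': "norm v' \<le> \<rho> * s powr (- l - 1)"
  note vw' = v'[unfolded pw[OF s]]
  have qs: "norm (q - q') / s = norm (q - q') * wi (T s)" using pw(4)[OF s] by (simp add: divide_inverse)
  show "norm (sg *\<^sub>R XP q (p + v) (sg * (s - 1)) - sg *\<^sub>R freq p - (sg *\<^sub>R XP q' (p' + v') (sg * (s - 1)) - sg *\<^sub>R freq p'))
      \<le> Cdyn * norm (v - v') + Cdyn * \<rho> * s powr (- l) * (norm (q - q') / s + norm (p - p'))"
  proof -
    have "norm ((XP q (p + v) (T s) - freq p) - (XP q' (p' + v') (T s) - freq p')) \<le>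
       real CARD('n) * (c1 * norm (v - v') + c1 * \<rho> * wa (T s) * (norm (q - q') * wi (T s) + norm (p - p')))"
      using dp_lip[OF \<rho> E\<rho> PD PB p p' vw vw' axis_in_Basis] by (intro norm_vec_le) (simp add: freq_def XP_def)
    also have "\<dots> = Cdyn * norm (v - v') + Cdyn * \<rho> * wa (T s) * (norm (q - q') * wi (T s) + norm (p - p'))"
      by (simp add: Cdyn_def algebra_simps)
    finally show ?thesis
      by (simp add: scaleR_diff_right[symmetric] asg pw(3)[OF s] qs T_def del: scaleR_minus_left)
  qed
  show "norm (- sg *\<^sub>R XQ q (p + v) (sg * (s - 1)) - - sg *\<^sub>R XQ q' (p' + v') (sg * (s - 1)))
      \<le> Cdyn * \<rho> * s powr (- l - 1) * (norm (q - q') / s + norm (p - p') + norm (v - v'))"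
  proof -
    have "norm (XQ q (p + v) (T s) - XQ q' (p' + v') (T s)) \<le>
       real CARD('n) * (c1 * \<rho> * (wa (T s) * wi (T s)) * (norm (q - q') * wi (T s) + norm (p - p') + norm (v - v')))"
      using dq_lip[OF \<rho> E\<rho> PD PB p p' vw vw' axis_in_Basis] by (intro norm_vec_le) (simp add: XQ_def)
    also have "\<dots> = Cdyn * \<rho> * (wa (T s) * wi (T s)) * (norm (q - q') * wi (T s) + norm (p - p') + norm (v - v'))"
      by (simp add: Cdyn_def)
    finally show ?thesis
      unfolding scaleR_diff_right[symmetric] nsg pw(1)[OF s] qs T_def .
  qed
qed (use l \<rho> M \<kappa> small PB in simp_all)

text \<open>For p in \<open>D\<close> the p-gradient of \<open>R\<close> vanishes and
  \<open>R\<close> is zero for every q, so its q-derivative vanishes too; the field of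
  \<open>htilde\<close> there is the constant \<open>(freq p, 0)\<close>.\<close>

lemma quasiperiodic_htilde:
  assumes "p \<in> D"
  shows "quasiperiodic_on (ham_field htilde) (trivial_torus p) (freq p)"
proof -
  have pB: "p \<in> BB" using assms D by auto
  have z: "(\<lambda>q. R q p) = (\<lambda>q. 0)" using R_zero assms by blast
  have "ham_field htilde (q, p) t = (freq p, 0)" for q t
    using R_zero assms axis_in_Basis z
    by (simp add: ham_field_def freq_def vec_eq_iff dp_htilde[OF pB axis_in_Basis] dq_htilde[OF pB axis_in_Basis]
      has_partial_const(2))
  thus ?thesis
    unfolding quasiperiodic_on_def trivial_torus_def
    by (auto intro!: derivative_eq_intros has_vector_derivative_Pair)
qed

end

text \<open>By Bernoulli's inequality the distortion costs at most \<mu>/2, so \<open>W\<close> has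
  at least the volume of \<open>P\<close> minus \<mu>/2. Together with the volume of
  \<open>B\<close> outside \<open>P\<close>, at most 3\<mu>/2, this gives
  \<open>2 * \<mu>\<close>.\<close>

lemma torus_leb_complement:
  fixes W :: "'n::finite phase set" and P B :: "(real^'n) set"
  assumes W: "closed W" "W \<subseteq> UNIV \<times> B" and B: "B \<in> sets borel" "B \<in> lmeasurable" and P: "compact P" "P \<subseteq> B"
    and \<delta>: "0 \<le> \<delta>" "\<delta> * real DIM('n phase) < 1"
    and big: "emeasure lebesgue P \<le> ennreal ((1 / (1 - \<delta> * real DIM('n phase))) ^ DIM('n phase)) * torus_leb W"
    and BP: "measure lebesgue (B - P) \<le> 3 / 2 * \<mu>"
    and \<delta>\<mu>: "real DIM('n phase) * (\<delta> * real DIM('n phase)) * measure lebesgue B \<le> \<mu> / 2"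
  shows "torus_leb (UNIV \<times> B - W) \<le> ennreal (2 * \<mu>)"
proof -
  let ?d = "DIM('n phase)"
  define F where "F = (unit_cell \<times> UNIV :: 'n phase set)"
  have F: "F \<in> sets lebesgue" unfolding F_def by (intro sets_completionI_sets) (simp add: borel_Times)
  have CF: "(UNIV \<times> B) \<inter> F = unit_cell \<times> B" by (auto simp: F_def)
  have eC: "emeasure lebesgue ((UNIV \<times> B) \<inter> F) = ennreal (measure lebesgue B)"
    unfolding CF emeasure_unit_cell_times[OF B(1)] using B(2) by (simp add: emeasure_eq_measure2)
  have CFs: "(UNIV \<times> B) \<inter> F \<in> sets lebesgue"
    unfolding CF using B(1) by (intro sets_completionI_sets) (simp add: borel_Times)
  have Ws: "W \<inter> F \<in> sets lebesgue" using W(1) F by (intro sets.Int) auto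
  have sub: "W \<inter> F \<subseteq> (UNIV \<times> B) \<inter> F" using W(2) by blast
  have CFm: "(UNIV \<times> B) \<inter> F \<in> lmeasurable" using CFs eC by (simp add: fmeasurable_def)
  have Wm: "W \<inter> F \<in> lmeasurable" using fmeasurableI2[OF CFm sub Ws] .
  define w where "w = measure lebesgue (W \<inter> F)"
  define \<pi> where "\<pi> = measure lebesgue P"
  have w: "torus_leb W = ennreal w" "0 \<le> w"
    using Wm by (simp_all add: torus_leb_unit_cell F_def[symmetric] w_def emeasure_eq_measure2)
  have Pm: "P \<in> lmeasurable" using P(1) by (rule lmeasurable_compact)
  have \<pi>: "emeasure lebesgue P = ennreal \<pi>" "0 \<le> \<pi>" "\<pi> \<le> measure lebesgue B"
    using Pm B(2) P(2) by (auto simp: \<pi>_def emeasure_eq_measure2 intro: measure_mono_fmeasurable)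
  define y where "y = 1 - \<delta> * real ?d"
  have y: "0 < y" using \<delta> by (simp add: y_def)
  have "ennreal \<pi> \<le> ennreal ((1 / y) ^ ?d * w)"
    using big y w(2) unfolding w(1) \<pi>(1) y_def[symmetric] by (simp add: ennreal_mult)
  hence "\<pi> \<le> (1 / y) ^ ?d * w" using y w(2) by (simp add: ennreal_le_iff)
  hence "y ^ ?d * \<pi> \<le> w" using y by (simp add: power_one_over field_simps)
  moreover have "1 - real ?d * (\<delta> * real ?d) \<le> y ^ ?d"
    using Bernoulli_inequality[of "- (\<delta> * real ?d)" ?d] \<delta>(2) by (simp add: y_def)
  hence "(1 - real ?d * (\<delta> * real ?d)) * \<pi> \<le> y ^ ?d * \<pi>" using \<pi>(2) by (rule mult_right_mono)
  moreover have "real ?d * (\<delta> * real ?d) * \<pi> \<le> real ?d * (\<delta> * real ?d) * measure lebesgue B"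
    using \<pi>(3) \<delta>(1) by (intro mult_left_mono) auto
  ultimately have lower: "\<pi> - \<mu> / 2 \<le> w" using \<delta>\<mu> by (simp add: algebra_simps)
  have "measure lebesgue (B - P) = measure lebesgue B - \<pi>"
    unfolding \<pi>_def using B(2) Pm P(2) by (intro measurable_measure_Diff) auto
  hence upper: "measure lebesgue B - w \<le> 2 * \<mu>" using BP lower by simp
  have "torus_leb (UNIV \<times> B - W) = emeasure lebesgue ((UNIV \<times> B) \<inter> F - W \<inter> F)"
    unfolding torus_leb_unit_cell F_def by (rule arg_cong[where f="emeasure lebesgue"]) blast
  also have "\<dots> = emeasure lebesgue ((UNIV \<times> B) \<inter> F) - emeasure lebesgue (W \<inter> F)"
    using Wm sub CFs by (intro emeasure_Diff) (auto simp: fmeasurable_def)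
  also have "\<dots> = ennreal (measure lebesgue B - w)"
    using eC w by (simp add: torus_leb_unit_cell F_def ennreal_minus)
  also have "\<dots> \<le> ennreal (2 * \<mu>)" using upper by (rule ennreal_leI)
  finally show ?thesis .
qed

section \<open>Half-orbits, the set of their common initial values, and its volume\<close>

context perturbed_hamiltonian
begin

lemma half_flow:
  fixes \<rho> M \<kappa> sg :: real
  assumes \<rho>: "0 < \<rho>" "\<rho> \<le> 1" and E\<rho>: "E \<le> \<rho>\<^sup>2"
    and PD: "P \<subseteq> D" and PB: "\<And>p v. p \<in> P \<Longrightarrow> norm v \<le> \<rho> \<Longrightarrow> p + v \<in> BB"
    and D0: "D \<noteq> {}" and M: "M = 4 * Cdyn / (l - 1) + 1" and \<kappa>: "\<kappa> = \<rho> * (Cdyn / (l - 1) + M * Cdyn)"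
    and small: "\<kappa> \<le> 1 / 8" "Cdyn * \<rho> \<le> 1" and sg: "sg = 1 \<or> sg = -1"
    and P: "compact P" and \<delta>: "\<delta> = 8 * \<kappa> * (1 + Cdyn)" "\<delta> * real DIM('n phase) < 1"
  obtains orb where "near_identity (\<lambda>x. orb x 1) P \<delta>"
    "\<And>x s. x \<in> UNIV \<times> P \<Longrightarrow> s \<ge> 1 \<Longrightarrow> snd (orb x s) \<in> BB"
    "\<And>x s. x \<in> UNIV \<times> P \<Longrightarrow> s \<ge> 1 \<Longrightarrow>
      (orb x has_vector_derivative sg *\<^sub>R ham_field H (orb x s) (sg * (s - 1))) (at s within {1..})"
    "\<And>x. x \<in> UNIV \<times> P \<Longrightarrow>
      ((\<lambda>s. norm (orb x s - (fst x + (s - 1) *\<^sub>R (sg *\<^sub>R freq (snd x)), snd x))) \<longlongrightarrow> 0) at_top"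
proof -
  interpret decaying_system "\<lambda>q p s. sg *\<^sub>R XP q p (sg * (s - 1))" "\<lambda>q p s. - sg *\<^sub>R XQ q p (sg * (s - 1))"
    BB P "\<lambda>p. sg *\<^sub>R freq p" l Cdyn \<rho> M \<kappa>
    by (rule decaying_system_H[OF \<rho> E\<rho> PD PB D0 M \<kappa> small sg])
  have x: "snd x \<in> P" if "x \<in> UNIV \<times> P" for x :: "'n phase" using that by (simp add: mem_Times_iff)
  show ?thesis
  proof (rule that[of orbit])
    show "near_identity (\<lambda>x. orbit x 1) P \<delta>"
    proof
      show "0 \<le> \<delta>" using \<kappa>0 C by (simp add: \<delta>(1))
      show "norm (orbit x 1 - x - (orbit y 1 - y)) \<le> \<delta> * norm (x - y)"
        if "x \<in> UNIV \<times> P" "y \<in> UNIV \<times> P" for x y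
        using orbit_initial_lip[OF x[OF that(1)] x[OF that(2)]] by (simp add: \<delta>(1))
      show "orbit (x + (m, 0)) 1 = orbit x 1 + (m, 0)" if "x \<in> UNIV \<times> P" "m \<in> lattice_vecs" for x m
        by (rule orbit_periodic) (simp_all add: XP_XQ_periodic[OF _ that(2)] x[OF that(1)] del: mem_ball)
    qed (use P \<delta>(2) in auto)
    show "snd (orbit y s) \<in> BB" if "y \<in> UNIV \<times> P" "s \<ge> 1" for y :: "'n phase" and s
      using orbit_in_B[OF x[OF that(1)] that(2)] .
    show "((\<lambda>s. norm (orbit y s - (fst y + (s - 1) *\<^sub>R (sg *\<^sub>R freq (snd y)), snd y))) \<longlongrightarrow> 0) at_top"
      if "y \<in> UNIV \<times> P" for y :: "'n phase"
      using orbit_limit[OF x[OF that]] .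
    fix y :: "'n phase" and s :: real assume y: "y \<in> UNIV \<times> P" and s: "s \<ge> 1"
    have "ham_field H z t = (XP (fst z) (snd z) t, - XQ (fst z) (snd z) t)" for z t
      by (cases z) (simp add: ham_field_def XP_def XQ_def vec_eq_iff)
    thus "(orbit y has_vector_derivative sg *\<^sub>R ham_field H (orbit y s) (sg * (s - 1))) (at s within {1..})"
      using orbit_derivative[OF x[OF y] s] by simp
  qed
qed

lemma large_set:
  fixes \<rho> M \<kappa> \<mu> :: real
  assumes \<rho>: "0 < \<rho>" "\<rho> \<le> 1" and E\<rho>: "E \<le> \<rho>\<^sup>2"
    and PD: "P \<subseteq> D" and PB: "\<And>p v. p \<in> P \<Longrightarrow> norm v \<le> \<rho> \<Longrightarrow> p + v \<in> BB"
    and D0: "D \<noteq> {}" and M: "M = 4 * Cdyn / (l - 1) + 1" and \<kappa>: "\<kappa> = \<rho> * (Cdyn / (l - 1) + M * Cdyn)"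
    and small: "\<kappa> \<le> 1 / 8" "Cdyn * \<rho> \<le> 1"
    and P: "compact P" and \<delta>: "\<delta> = 8 * \<kappa> * (1 + Cdyn)" "\<delta> * real DIM('n phase) < 1"
    and BP: "measure lebesgue (BB - P) \<le> 3 / 2 * \<mu>"
    and \<delta>\<mu>: "real DIM('n phase) * (\<delta> * real DIM('n phase)) * measure lebesgue BB \<le> \<mu> / 2"
  shows "\<exists>W :: 'n phase set. W \<subseteq> UNIV \<times> BB \<and> torus_measurable W \<and>
    (\<forall>(q, p)\<in>W. \<exists>pminus\<in>D. \<exists>pplus\<in>D. \<exists>k g.
       biasymptotically_quasiperiodic \<sigma> k BB (ham_field H) (ham_field htilde) (ham_field htilde)
         (trivial_torus pplus) (trivial_torus pminus) g \<and> g 0 = (q, p)) \<and>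
    torus_leb (UNIV \<times> BB - W) \<le> ennreal (4 * \<mu>)"
proof -
  obtain op where op: "near_identity (\<lambda>x. op x 1) P \<delta>"
    "\<And>x s. x \<in> UNIV \<times> P \<Longrightarrow> s \<ge> 1 \<Longrightarrow> snd (op x s) \<in> BB"
    "\<And>x s. x \<in> UNIV \<times> P \<Longrightarrow> s \<ge> 1 \<Longrightarrow>
      (op x has_vector_derivative 1 *\<^sub>R ham_field H (op x s) (1 * (s - 1))) (at s within {1..})"
    "\<And>x. x \<in> UNIV \<times> P \<Longrightarrow>
      ((\<lambda>s. norm (op x s - (fst x + (s - 1) *\<^sub>R (1 *\<^sub>R freq (snd x)), snd x))) \<longlongrightarrow> 0) at_top"
    using half_flow[OF \<rho> E\<rho> PD PB D0 M \<kappa> small disjI1[OF refl] P \<delta>] by blast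
  obtain om where om: "near_identity (\<lambda>x. om x 1) P \<delta>"
    "\<And>x s. x \<in> UNIV \<times> P \<Longrightarrow> s \<ge> 1 \<Longrightarrow> snd (om x s) \<in> BB"
    "\<And>x s. x \<in> UNIV \<times> P \<Longrightarrow> s \<ge> 1 \<Longrightarrow>
      (om x has_vector_derivative (-1) *\<^sub>R ham_field H (om x s) ((-1) * (s - 1))) (at s within {1..})"
    "\<And>x. x \<in> UNIV \<times> P \<Longrightarrow>
      ((\<lambda>s. norm (om x s - (fst x + (s - 1) *\<^sub>R ((-1) *\<^sub>R freq (snd x)), snd x))) \<longlongrightarrow> 0) at_top"
    using half_flow[OF \<rho> E\<rho> PD PB D0 M \<kappa> small disjI2[OF refl] P \<delta>] by blast
  define Wp where "Wp = (\<lambda>x. op x 1) ` (UNIV \<times> P)"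
  define Wm where "Wm = (\<lambda>x. om x 1) ` (UNIV \<times> P)"
  define W where "W = Wp \<inter> Wm"
  have PBB: "P \<subseteq> BB" using PD D by blast
  have W_sub: "Wp \<subseteq> UNIV \<times> BB" "Wm \<subseteq> UNIV \<times> BB"
    unfolding Wp_def Wm_def image_subset_iff mem_Times_iff[of "_ _ _"]
    using op(2)[OF _ order_refl] om(2)[OF _ order_refl] by blast+
  have cl: "closed Wp" "closed Wm"
    unfolding Wp_def Wm_def using near_identity.closed_image[OF op(1)] near_identity.closed_image[OF om(1)] .
  have bd: "bounded (snd ` Wp)" "bounded (snd ` Wm)"
    by (rule bounded_subset[OF bounded_ball[of 0 1]]; use W_sub in \<open>auto simp: subset_iff mem_Times_iff simp del: mem_ball\<close>)+
  have \<delta>0: "0 \<le> \<delta>" using op(1) by (simp add: near_identity_def)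
  have lebp: "torus_leb (UNIV \<times> BB - Wp) \<le> ennreal (2 * \<mu>)"
    using near_identity.emeasure_image[OF op(1) bd(1)[unfolded Wp_def]]
    by (intro torus_leb_complement[OF cl(1) W_sub(1) _ _ P PBB \<delta>0 \<delta>(2) _ BP \<delta>\<mu>]) (auto simp: Wp_def)
  have lebm: "torus_leb (UNIV \<times> BB - Wm) \<le> ennreal (2 * \<mu>)"
    using near_identity.emeasure_image[OF om(1) bd(2)[unfolded Wm_def]]
    by (intro torus_leb_complement[OF cl(2) W_sub(2) _ _ P PBB \<delta>0 \<delta>(2) _ BP \<delta>\<mu>]) (auto simp: Wm_def)
  have m: "S \<inter> unit_cell \<times> UNIV \<in> sets lebesgue" if "S \<in> sets borel" for S :: "'n phase set"
  proof -
    have "unit_cell \<times> UNIV \<in> sets (borel :: 'n phase measure)" by (simp add: borel_Times)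
    from sets.Int[OF that this] show ?thesis by simp
  qed
  have C: "UNIV \<times> BB \<in> sets (borel :: 'n phase measure)" by (rule borel_open[OF open_S])
  have "torus_leb (UNIV \<times> BB - W) \<le> torus_leb (UNIV \<times> BB - Wp) + torus_leb (UNIV \<times> BB - Wm)"
  proof -
    have "(UNIV \<times> BB - W) \<inter> unit_cell \<times> UNIV =
      (UNIV \<times> BB - Wp) \<inter> unit_cell \<times> UNIV \<union> (UNIV \<times> BB - Wm) \<inter> unit_cell \<times> UNIV"
      by (auto simp: W_def)
    thus ?thesis unfolding torus_leb_unit_cell
      using C cl by (auto intro!: emeasure_subadditive m)
  qed
  also have "\<dots> \<le> ennreal (2 * \<mu>) + ennreal (2 * \<mu>)" by (rule add_mono[OF lebp lebm])
  also have "\<dots> = ennreal (4 * \<mu>)"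
  proof -
    have "0 \<le> \<mu>" using order_trans[OF measure_nonneg BP] by simp
    thus ?thesis by (simp add: ennreal_plus[symmetric] del: ennreal_plus)
  qed
  finally have leb: "torus_leb (UNIV \<times> BB - W) \<le> ennreal (4 * \<mu>)" .
  have meas: "torus_measurable W"
    unfolding torus_measurable_def
  proof (intro conjI allI ballI impI)
    show "W \<in> sets lebesgue" unfolding W_def using cl by (simp add: sets.Int)
    fix q p m :: "real^'n" assume m: "m \<in> lattice_vecs" "(q, p) \<in> W"
    have "(q, p) + (m, 0) \<in> Wp" "(q, p) + (m, 0) \<in> Wm"
      using near_identity.image_translate[OF op(1) _ m(1), of "(q, p)"]
        near_identity.image_translate[OF om(1) _ m(1), of "(q, p)"] m(2) by (simp_all add: W_def Wp_def Wm_def)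
    thus "(q + m, p) \<in> W" by (simp add: W_def)
  qed
  have sol: "\<exists>pminus\<in>D. \<exists>pplus\<in>D. \<exists>k g.
       biasymptotically_quasiperiodic \<sigma> k BB (ham_field H) (ham_field htilde) (ham_field htilde)
         (trivial_torus pplus) (trivial_torus pminus) g \<and> g 0 = z" if z: "z \<in> W" for z
  proof -
    obtain x where x: "x \<in> UNIV \<times> P" "z = op x 1" using z by (auto simp: W_def Wp_def)
    obtain y where y: "y \<in> UNIV \<times> P" "z = om y 1" using z by (auto simp: W_def Wm_def)
    have xy: "snd x \<in> D" "snd y \<in> D" using x(1) y(1) PD by (auto simp: mem_Times_iff)
    \<comment> \<open>The past half is \<open>om y\<close> run backwards. Both halves pass through
      \<open>z\<close> at time 0, which is the value 1 of the shifted parameter.\<close>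
    define g where "g t = (if t \<ge> 0 then op x (1 + t) else om y (1 - t))" for t
    have gp: "g t = op x (1 + t)" if "t \<ge> 0" for t using that by (simp add: g_def)
    have gm: "g t = om y (1 - t)" if "t \<le> 0" for t using that x(2) y(2) by (cases "t = 0") (auto simp: g_def)
    have der: "(g has_vector_derivative ham_field H (g t) t) (at t)" for t
    proof (rule has_vector_derivative_glue)
      assume t: "t \<ge> 0"
      have "((\<lambda>t. 1 + t) has_vector_derivative 1) (at t within {0..})"
        using has_vector_derivative_add[OF has_vector_derivative_const has_vector_derivative_id] by simp
      moreover have "(op x has_vector_derivative ham_field H (g t) t) (at (1 + t) within (\<lambda>t. 1 + t) ` {0..})"
        using op(3)[OF x(1), of "1 + t"] t
        by (simp add: gp has_vector_derivative_within_subset[OF _ image_subsetI, of _ _ _ "{1..}"])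
      ultimately have "(op x \<circ> (\<lambda>t. 1 + t) has_vector_derivative 1 *\<^sub>R ham_field H (g t) t) (at t within {0..})"
        by (rule vector_diff_chain_within)
      hence "(op x \<circ> (\<lambda>t. 1 + t) has_vector_derivative ham_field H (g t) t) (at t within {0..})" by simp
      thus "(g has_vector_derivative ham_field H (g t) t) (at t within {0..})"
        by (rule has_vector_derivative_transform[rotated 2]) (use t in \<open>auto simp: gp\<close>)
    next
      assume t: "t \<le> 0"
      have "((\<lambda>t. 1 - t) has_vector_derivative (-1)) (at t within {..0})"
        using has_vector_derivative_diff[OF has_vector_derivative_const has_vector_derivative_id] by simp
      \<comment> \<open>\<open>om y\<close> solves the reversed equation; its sign cancels against
        the derivative -1 of the substitution.\<close>
      moreover have "(om y has_vector_derivative - ham_field H (g t) t) (at (1 - t) within (\<lambda>t. 1 - t) ` {..0})"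
        using om(3)[OF y(1), of "1 - t"] t
        by (simp add: gm has_vector_derivative_within_subset[OF _ image_subsetI, of _ _ _ "{1..}"])
      ultimately have "(om y \<circ> (\<lambda>t. 1 - t) has_vector_derivative (-1) *\<^sub>R (- ham_field H (g t) t)) (at t within {..0})"
        by (rule vector_diff_chain_within)
      hence "(om y \<circ> (\<lambda>t. 1 - t) has_vector_derivative ham_field H (g t) t) (at t within {..0})" by simp
      thus "(g has_vector_derivative ham_field H (g t) t) (at t within {..0})"
        by (rule has_vector_derivative_transform[rotated 2]) (use t in \<open>auto simp: gm\<close>)
    qed
    have inB: "snd (g t) \<in> BB" for t
      using op(2)[OF x(1), of "1 + t"] om(2)[OF y(1), of "1 - t"] by (cases "t \<ge> 0") (auto simp: gp gm simp del: mem_ball)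
    have limp: "((\<lambda>t. norm (g t - trivial_torus (snd x) (fst x + t *\<^sub>R freq (snd x)))) \<longlongrightarrow> 0) at_top"
    proof -
      have "filterlim (\<lambda>t::real. 1 + t) at_top at_top"
        by (rule filterlim_at_top_mono[OF filterlim_ident], rule always_eventually, rule allI, arith)
      from filterlim_compose[OF op(4)[OF x(1)] this]
      have "((\<lambda>t. norm (op x (1 + t) - trivial_torus (snd x) (fst x + t *\<^sub>R freq (snd x)))) \<longlongrightarrow> 0) at_top"
        by (simp add: trivial_torus_def)
      moreover have "\<forall>\<^sub>F t in at_top. norm (op x (1 + t) - trivial_torus (snd x) (fst x + t *\<^sub>R freq (snd x)))
          = norm (g t - trivial_torus (snd x) (fst x + t *\<^sub>R freq (snd x)))"
        using eventually_ge_at_top[of 0] by eventually_elim (simp add: gp)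
      ultimately show ?thesis by (rule Lim_transform_eventually)
    qed
    have limm: "((\<lambda>t. norm (g t - trivial_torus (snd y) (fst y + t *\<^sub>R freq (snd y)))) \<longlongrightarrow> 0) at_bot"
    proof -
      have "filterlim (\<lambda>t::real. 1 - t) at_top at_bot"
        by (rule filterlim_at_top_mono[OF filterlim_uminus_at_top_at_bot], rule always_eventually, rule allI, arith)
      from filterlim_compose[OF om(4)[OF y(1)] this]
      have "((\<lambda>t. norm (om y (1 - t) - trivial_torus (snd y) (fst y + t *\<^sub>R freq (snd y)))) \<longlongrightarrow> 0) at_bot"
        by (simp add: trivial_torus_def)
      moreover have "\<forall>\<^sub>F t in at_bot. norm (om y (1 - t) - trivial_torus (snd y) (fst y + t *\<^sub>R freq (snd y)))
          = norm (g t - trivial_torus (snd y) (fst y + t *\<^sub>R freq (snd y)))"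
        using eventually_le_at_bot[of 0] by eventually_elim (simp add: gm)
      ultimately show ?thesis by (rule Lim_transform_eventually)
    qed
    have s0: "0 \<le> \<sigma>" using \<sigma> by simp
    \<comment> \<open>The fields have been shown to be of class C^\<sigma> and to converge in that
      norm, so the order in excess of \<sigma> is taken to be 0.\<close>
    have "biasymptotically_quasiperiodic \<sigma> 0 BB (ham_field H) (ham_field htilde) (ham_field htilde)
         (trivial_torus (snd x)) (trivial_torus (snd y)) g"
      unfolding biasymptotically_quasiperiodic_def
    proof (intro conjI)
      show "torus_embedding \<sigma> BB (trivial_torus (snd x))" "torus_embedding \<sigma> BB (trivial_torus (snd y))"
        using xy D s0 by (auto intro!: torus_embedding_trivial simp del: mem_ball)
      show "integral_curve BB (ham_field H) g" unfolding integral_curve_def using der inB by blast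
      show "\<exists>\<omega>plus \<omega>minus qplus qminus.
         quasiperiodic_on (ham_field htilde) (trivial_torus (snd x)) \<omega>plus \<and>
         quasiperiodic_on (ham_field htilde) (trivial_torus (snd y)) \<omega>minus \<and>
         ((\<lambda>t. torus_dist (g t) (trivial_torus (snd x) (qplus + t *\<^sub>R \<omega>plus))) \<longlongrightarrow> 0) at_top \<and>
         ((\<lambda>t. torus_dist (g t) (trivial_torus (snd y) (qminus + t *\<^sub>R \<omega>minus))) \<longlongrightarrow> 0) at_bot"
        using quasiperiodic_htilde[OF xy(1)] quasiperiodic_htilde[OF xy(2)]
          torus_dist_tendsto_0[OF limp] torus_dist_tendsto_0[OF limm] by blast
    qed (use fields[OF D0] in simp_all)
    moreover have "g 0 = z" using gp[of 0] x(2) by simp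
    ultimately show ?thesis using xy by blast
  qed
  show ?thesis
  proof (intro exI[of _ W] conjI meas leb)
    show "W \<subseteq> UNIV \<times> BB" using W_sub by (auto simp: W_def)
    show "\<forall>(q, p)\<in>W. \<exists>pminus\<in>D. \<exists>pplus\<in>D. \<exists>k g.
       biasymptotically_quasiperiodic \<sigma> k BB (ham_field H) (ham_field htilde) (ham_field htilde)
         (trivial_torus pplus) (trivial_torus pminus) g \<and> g 0 = (q, p)"
      using sol by (auto simp del: mem_ball)
  qed
qed

end

section \<open>Choice of the constants and of the compact set of asymptotic actions\<close>

lemma exists_small:
  fixes X y :: "real list"
  assumes "length X = length y" "\<And>x. x \<in> set X \<Longrightarrow> 0 \<le> x" "\<And>z. z \<in> set y \<Longrightarrow> 0 < z"
  obtains \<rho> :: real where "0 < \<rho>" "list_all2 (\<lambda>x z. \<rho> * x \<le> z) X y"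
proof -
  have "\<exists>\<rho>>0. list_all2 (\<lambda>x z. \<rho> * x \<le> z) X y"
    using assms
  proof (induction X y rule: list_induct2)
    case Nil
    thus ?case by (auto intro: exI[of _ 1])
  next
    case (Cons x X z y)
    then obtain \<rho> where \<rho>: "\<rho> > 0" "list_all2 (\<lambda>x z. \<rho> * x \<le> z) X y" by auto
    have x: "0 \<le> x" "0 < z" using Cons.prems by auto
    define \<rho>' where "\<rho>' = min \<rho> (z / (x + 1))"
    have \<rho>': "0 < \<rho>'" "\<rho>' \<le> \<rho>" "\<rho>' \<le> z / (x + 1)" using \<rho>(1) x by (auto simp: \<rho>'_def)
    have "\<rho>' * x \<le> z / (x + 1) * x" using \<rho>' x by (intro mult_right_mono) auto
    also have "\<dots> \<le> z" using x by (simp add: divide_simps)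
    finally have 1: "\<rho>' * x \<le> z" .
    have "\<rho>' * x' \<le> z'" if "0 \<le> x'" "\<rho> * x' \<le> z'" for x' z'
      using mult_right_mono[OF \<rho>'(2) that(1)] that(2) by linarith
    hence "list_all2 (\<lambda>x z. \<rho>' * x \<le> z) X y"
      using \<rho>(2) Cons.prems(1) by (auto simp: list_all2_conv_all_nth)
    thus ?case using 1 \<rho>'(1) by auto
  qed
  thus ?thesis using that by blast
qed

text \<open>Volumes scale like \<open>(1 - r) ^ CARD('n)\<close>, and Bernoulli's inequality makes
  the loss linear in r. The case r = 0 is separate because the closed ball of radius 1 is not
  contained in the open one.\<close>

lemma measure_ball_annulus:
  fixes r :: real
  assumes "0 \<le> r" "r \<le> 1"
  shows "measure lebesgue (ball (0 :: real^'n::finite) 1 - cball 0 (1 - r))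
    \<le> measure lebesgue (ball (0 :: real^'n) 1) * (real CARD('n) * r)"
proof (cases "r = 0")
  case True
  have "ball (0 :: real^'n) 1 - cball 0 (1 - r) = {}" using True by auto
  thus ?thesis using assms(1) by (simp only: measure_empty) simp
next
  case False
  let ?\<beta> = "measure lebesgue (ball (0 :: real^'n) 1)"
  have "cball 0 (1 - r) \<subseteq> ball (0 :: real^'n) 1" using assms False by auto
  hence "measure lebesgue (ball (0 :: real^'n) 1 - cball 0 (1 - r)) = ?\<beta> - measure lebesgue (cball (0 :: real^'n) (1 - r))"
    by (intro measurable_measure_Diff) auto
  also have "measure lebesgue (cball (0 :: real^'n) (1 - r)) = ?\<beta> * (1 - r) ^ CARD('n)"
    using assms by (simp add: content_cball content_ball)
  also have "1 + real CARD('n) * (- r) \<le> (1 + (- r)) ^ CARD('n)"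
    using assms by (intro Bernoulli_inequality) auto
  hence "?\<beta> * (1 - real CARD('n) * r) \<le> ?\<beta> * (1 - r) ^ CARD('n)"
    by (intro mult_left_mono) auto
  hence "?\<beta> - ?\<beta> * (1 - r) ^ CARD('n) \<le> ?\<beta> * (real CARD('n) * r)" by (simp add: algebra_simps)
  finally show ?thesis .
qed

text \<open>The budget is \<mu> for the complement of \<open>D\<close>, \<mu>/4 for the inner
  approximation by a closed set and \<mu>/4 for the annulus. Removing the annulus creates the margin
  within which solutions may move in p.\<close>

lemma compact_core:
  fixes D :: "(real^'n::finite) set"
  assumes D: "D \<subseteq> ball 0 1" "D \<in> sets lebesgue" and \<mu>: "0 < \<mu>" "emeasure lebesgue (ball 0 1 - D) < ennreal \<mu>"
    and r: "0 \<le> r" "r \<le> 1" "measure lebesgue (ball (0 :: real^'n) 1) * (real CARD('n) * r) \<le> \<mu> / 4"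
  obtains P where "compact P" "P \<subseteq> D" "P \<subseteq> cball 0 (1 - r)" "measure lebesgue (ball 0 1 - P) \<le> 3 / 2 * \<mu>"
proof -
  obtain T where T: "closed T" "T \<subseteq> D" "D - T \<in> lmeasurable" "emeasure lebesgue (D - T) < ennreal (\<mu> / 4)"
    using sets_lebesgue_inner_closed[OF D(2), of "\<mu> / 4"] \<mu>(1) by auto
  define P where "P = T \<inter> cball 0 (1 - r)"
  have P: "compact P" "P \<subseteq> D" "P \<subseteq> cball 0 (1 - r)"
    using T by (auto simp: P_def intro: closed_Int_compact)
  have BD: "ball 0 1 - D \<in> lmeasurable"
    by (rule fmeasurableI2[OF lmeasurable_ball[of 0 1]]) (use D(2) in auto)
  have bc: "ball (0 :: real^'n) 1 - cball 0 (1 - r) \<in> lmeasurable"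
    by (rule fmeasurableI2[OF lmeasurable_ball[of 0 1]]) auto
  have Ps: "ball 0 1 - P \<in> sets lebesgue"
    using fmeasurableD[OF lmeasurable_compact[OF P(1)]] by auto
  have "measure lebesgue (ball 0 1 - P) \<le> measure lebesgue ((ball 0 1 - D) \<union> (D - T) \<union> (ball 0 1 - cball 0 (1 - r)))"
    by (rule measure_mono_fmeasurable) (use Ps BD T(3) bc in \<open>auto simp: P_def intro!: fmeasurable.Un\<close>)
  also have "\<dots> \<le> measure lebesgue ((ball 0 1 - D) \<union> (D - T)) + measure lebesgue (ball (0 :: real^'n) 1 - cball 0 (1 - r))"
    using BD T(3) bc by (intro measure_Un_le) auto
  also have "measure lebesgue ((ball 0 1 - D) \<union> (D - T)) \<le> measure lebesgue (ball 0 1 - D) + measure lebesgue (D - T)"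
    using BD T(3) by (intro measure_Un_le) auto
  also have "measure lebesgue (ball 0 1 - D) \<le> \<mu>"
    using \<mu> BD by (simp add: emeasure_eq_measure2 ennreal_less_iff)
  also have "measure lebesgue (D - T) \<le> \<mu> / 4"
    using T(4) T(3) by (simp add: emeasure_eq_measure2 ennreal_less_iff)
  also have "measure lebesgue (ball (0 :: real^'n) 1 - cball 0 (1 - r)) \<le> \<mu> / 4"
    using measure_ball_annulus[OF r(1,2), where 'n='n] r(3) by linarith
  finally have "measure lebesgue (ball 0 1 - P) \<le> 3 / 2 * \<mu>" by simp
  thus ?thesis using that P by blast
qed

theorem theorem2:
  fixes \<sigma> \<Upsilon> l \<mu> :: real and N :: ennreal
  assumes "\<sigma> \<ge> 1" and "\<Upsilon> \<ge> 1" and "l > 1" and "\<mu> > 0"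
  shows "\<exists>\<epsilon>0::real. \<epsilon>0 > 0 \<and>
    (\<forall>(\<epsilon>::real) (h :: real^'n \<Rightarrow> real) (R :: real^'n \<Rightarrow> real^'n \<Rightarrow> real)
       (f :: 'n observable) (H :: 'n observable) (D :: (real^'n) set).
      0 < \<epsilon> \<longrightarrow> \<epsilon> < 1 \<longrightarrow>
      hamiltonian_on (ball 0 1) H \<longrightarrow>
      (\<forall>q. \<forall>p\<in>ball 0 1. \<forall>t. H q p t = h p + R q p + f q p t) \<longrightarrow>

      f \<in> D_bar_space \<sigma> 2 (ball 0 1) \<longrightarrow>
      (\<forall>q t. Ck_on 1 (ball 0 1) (\<lambda>p. f q p t)) \<longrightarrow>
      (\<forall>b\<in>Basis. dp [b] f \<in> D_bar_space \<sigma> 2 (ball 0 1)) \<longrightarrow>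

      D_norm (\<sigma> + 2) 0 (ball 0 1) f
        + (SUP b\<in>Basis. D_bar_norm \<sigma> 1 (l + 2) (ball 0 1) (dq [b] f))
        + (SUP b\<in>Basis. D_bar_norm \<sigma> 2 (l + 1) (ball 0 1) (dp [b] f)) < ennreal \<epsilon> \<longrightarrow>

      D \<subseteq> ball 0 1 \<longrightarrow> D \<in> sets lebesgue \<longrightarrow>
      emeasure lebesgue (ball 0 1 - D) < ennreal \<mu> \<longrightarrow>

      q_periodic (ball 0 1) R \<longrightarrow>
      C_sigma 2 (UNIV \<times> ball 0 1) (\<lambda>(q, p). R q p) \<longrightarrow>
      (\<forall>q. \<forall>p\<in>D. R q p = 0 \<and> (\<forall>b\<in>Basis. partial b (R q) p = 0)) \<longrightarrow>

      (\<forall>q t. Ck_on 2 (ball 0 1) (\<lambda>p. H q p t)) \<longrightarrow>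
      (\<forall>b\<in>Basis. \<forall>c\<in>Basis. \<forall>t.
         C_sigma (\<sigma> + 2) (UNIV \<times> ball 0 1) (\<lambda>(q, p). dp [b, c] H q p t)) \<longrightarrow>
      (\<forall>b\<in>Basis. \<forall>c\<in>Basis. \<forall>i\<le>2. \<forall>bs\<in>multi_indices i.
         continuous_on (UNIV \<times> ball 0 1 \<times> UNIV)
           (\<lambda>(q, p, t). partials bs (\<lambda>(q', p'). dp [b, c] H q' p' t) (q, p))) \<longrightarrow>

      (SUP t. SUP b\<in>Basis. SUP c\<in>Basis.
         hoelder_norm (\<sigma> + 2) (UNIV \<times> ball 0 1) (\<lambda>(q, p). dp [b, c] H q p t)) \<le> ennreal \<Upsilon> \<longrightarrow>

      (SUP b\<in>Basis. lip_norm {()} D (\<lambda>_. partial b h)) = N \<longrightarrow>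

      (\<exists>htilde :: 'n observable. hamiltonian_on (ball 0 1) htilde \<and>
        (\<epsilon> \<le> \<epsilon>0 \<longrightarrow>
          (\<exists>W :: 'n phase set. W \<subseteq> UNIV \<times> ball 0 1 \<and> torus_measurable W \<and>
            (\<forall>(q, p)\<in>W. \<exists>pminus\<in>D. \<exists>pplus\<in>D. \<exists>k g.
               biasymptotically_quasiperiodic \<sigma> k (ball 0 1)
                 (ham_field H) (ham_field htilde) (ham_field htilde)
                 (trivial_torus pplus) (trivial_torus pminus) g \<and>
               g 0 = (q, p)) \<and>
            torus_leb (UNIV \<times> ball 0 1 - W) \<le> ennreal (4 * \<mu>)))))"
proof -
  define n where "n = real CARD('n)"
  define d where "d = real DIM('n phase)"
  \<comment> \<open>\<open>\<Lambda>\<close>, \<open>L\<close> and \<open>C\<close> are the later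
    \<open>K\<close>, \<open>c1\<close> and \<open>Cdyn\<close>, written out in n and \<Upsilon>
    before any Hamiltonian is given, because the threshold is quantified first.\<close>
  define \<Lambda> where "\<Lambda> = 2 * n * \<Upsilon>"
  define L where "L = 2 + n + 2 * n * \<Lambda> + 3 * n * n * \<Lambda>"
  define C where "C = n * L"
  define M where "M = 4 * C / (l - 1) + 1"
  define A where "A = C / (l - 1) + M * C"
  define \<beta> where "\<beta> = measure lebesgue (ball (0 :: real^'n) 1)"
  have n: "0 < n" and d: "0 < d" by (simp_all add: n_def d_def)
  have \<Lambda>: "0 \<le> \<Lambda>" using n assms by (simp add: \<Lambda>_def)
  have L: "0 \<le> L" using n \<Lambda> by (simp add: L_def)
  have C: "0 \<le> C" using n L by (simp add: C_def)
  have M: "1 \<le> M" using C assms by (simp add: M_def)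
  have A: "0 \<le> A" using C M assms by (simp add: A_def)
  have \<beta>: "0 \<le> \<beta>" by (simp add: \<beta>_def)
  \<comment> \<open>\<open>r\<close> is the width of the annulus to be removed from the ball, sized
    so that its volume stays within the share \<mu>/4.\<close>
  obtain r where r: "0 < r" "r \<le> 1" "\<beta> * (n * r) \<le> \<mu> / 4"
  proof (rule exists_small[of "[1, \<beta> * n]" "[1, \<mu> / 4]"])
    fix \<rho> :: real assume "0 < \<rho>" "list_all2 (\<lambda>x z. \<rho> * x \<le> z) [1, \<beta> * n] [1, \<mu> / 4]"
    thus ?thesis using that[of \<rho>] by (simp add: mult_ac)
  qed (use \<beta> n assms in auto)
  \<comment> \<open>Besides the normalisation the conditions are, in this order: the margin gained
    from the annulus, the contraction, the invariance of the admissible set, the invertibility of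
    the initial maps in the sup norm, and the bound \<mu>/2 for the distortion of volume.\<close>
  obtain \<rho> where \<rho>: "0 < \<rho>" "\<rho> \<le> 1" "\<rho> < r" "\<rho> * A \<le> 1 / 8" "C * \<rho> \<le> 1"
    "8 * (\<rho> * A) * (1 + C) * d < 1" "d * (8 * (\<rho> * A) * (1 + C) * d) * \<beta> \<le> \<mu> / 2"
  \<comment> \<open>The bounds \<open>r / 2\<close> and \<open>1 / 2\<close> turn the non-strict
    inequalities obtained here into the two strict ones that are needed.\<close>
  proof (rule exists_small[of "[1, 1, A, C, 8 * A * (1 + C) * d, d * (8 * A * (1 + C) * d) * \<beta>]"
        "[1, r / 2, 1 / 8, 1, 1 / 2, \<mu> / 2]"])
    fix \<rho> :: real assume "0 < \<rho>" "list_all2 (\<lambda>x z. \<rho> * x \<le> z) [1, 1, A, C, 8 * A * (1 + C) * d, d * (8 * A * (1 + C) * d) * \<beta>]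
        [1, r / 2, 1 / 8, 1, 1 / 2, \<mu> / 2]"
    hence "0 < \<rho>" "\<rho> \<le> 1" "\<rho> \<le> r / 2" "\<rho> * A \<le> 1 / 8" "\<rho> * C \<le> 1" "\<rho> * (8 * A * (1 + C) * d) \<le> 1 / 2"
      "\<rho> * (d * (8 * A * (1 + C) * d) * \<beta>) \<le> \<mu> / 2" by simp_all
    moreover have "8 * (\<rho> * A) * (1 + C) * d = \<rho> * (8 * A * (1 + C) * d)" by (simp only: mult_ac)
    moreover have "d * (8 * (\<rho> * A) * (1 + C) * d) * \<beta> = \<rho> * (d * (8 * A * (1 + C) * d) * \<beta>)"
      by (simp only: mult_ac)
    moreover have "C * \<rho> = \<rho> * C" by (rule mult.commute)
    ultimately show ?thesis using r(1) by (intro that[of \<rho>]) linarith+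
  qed (use \<beta> n d A C assms r in auto)
  \<comment> \<open>This is the value of \<epsilon> at which \<open>E\<close> equals
    \<open>\<rho>\<^sup>2\<close>.\<close>
  define \<epsilon>0 where "\<epsilon>0 = \<rho>\<^sup>2 / (2 powr (l + 2) * n)"
  have \<epsilon>0: "0 < \<epsilon>0" using \<rho>(1) n by (simp add: \<epsilon>0_def)
  show ?thesis
  proof (intro exI[of _ \<epsilon>0] conjI allI impI \<epsilon>0, goal_cases)
    case (1 \<epsilon> h R f H D)
    show ?case
    proof (cases "D = {}")
      \<comment> \<open>Without a point of \<open>D\<close> there is no base point for the
        expansions. In this case the whole ball has measure below \<mu>, and the empty set serves as
        \<open>W\<close>.\<close>
      case True
      have "torus_leb (UNIV \<times> ball 0 1 - {} :: 'n phase set) = emeasure lebesgue (ball (0 :: real^'n) 1)"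
        using emeasure_unit_cell_times[of "ball (0 :: real^'n) 1"]
        by (simp add: torus_leb_unit_cell Times_Int_Times)
      also have "\<dots> \<le> ennreal (4 * \<mu>)"
      proof -
        have "emeasure lebesgue (ball (0 :: real^'n) 1) \<le> ennreal \<mu>" using 1(11) True by (simp add: less_imp_le)
        also have "\<dots> \<le> ennreal (4 * \<mu>)" using assms by (intro ennreal_leI) simp
        finally show ?thesis .
      qed
      finally have leb: "torus_leb (UNIV \<times> ball 0 1 - {} :: 'n phase set) \<le> ennreal (4 * \<mu>)" .
      have "Ck_on 1 (UNIV \<times> ball 0 1) (\<lambda>z :: 'n phase. 0)" by (rule CkLip_Ck_on[OF CkLip_const[of 0 0]]) simp
      hence "hamiltonian_on (ball 0 1) (\<lambda>(q :: real^'n) p t. 0)"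
        by (simp add: hamiltonian_on_def q_periodic_def case_prod_unfold)
      thus ?thesis using leb
        by (intro exI[of _ "\<lambda>q p t. 0"] conjI impI exI[of _ "{}"]) (auto simp: torus_measurable_def)
    next
      case False
      interpret perturbed_hamiltonian \<sigma> \<Upsilon> l \<epsilon> h R f H D
        by (unfold_locales; fact)
      have Cdyn: "Cdyn = C" by (simp add: Cdyn_def L_def C_def c1_def \<Lambda>_def K_def n_def)
      show ?thesis
      proof (intro exI[of _ htilde] conjI impI htilde_hamiltonian False)
        assume "\<epsilon> \<le> \<epsilon>0"
        hence E: "E \<le> \<rho>\<^sup>2" using n by (simp add: E_def \<epsilon>0_def n_def field_simps)
        obtain P where P: "compact P" "P \<subseteq> D" "P \<subseteq> cball 0 (1 - r)" "measure lebesgue (ball 0 1 - P) \<le> 3 / 2 * \<mu>"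
          using compact_core[OF 1(9,10) assms(4) 1(11) less_imp_le[OF r(1)] r(2)] r(3) unfolding \<beta>_def n_def by blast
        have PB: "p + v \<in> ball 0 1" if "p \<in> P" "norm v \<le> \<rho>" for p v
        proof -
          have "norm (p + v) \<le> norm p + norm v" by (rule norm_triangle_ineq)
          also have "\<dots> < 1" using P(3) that \<rho>(3) by fastforce
          finally show ?thesis by simp
        qed
        show "\<exists>W :: 'n phase set. W \<subseteq> UNIV \<times> ball 0 1 \<and> torus_measurable W \<and>
            (\<forall>(q, p)\<in>W. \<exists>pminus\<in>D. \<exists>pplus\<in>D. \<exists>k g.
               biasymptotically_quasiperiodic \<sigma> k (ball 0 1)
                 (ham_field H) (ham_field htilde) (ham_field htilde)
                 (trivial_torus pplus) (trivial_torus pminus) g \<and>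
               g 0 = (q, p)) \<and>
            torus_leb (UNIV \<times> ball 0 1 - W) \<le> ennreal (4 * \<mu>)"
        proof (rule large_set[OF \<rho>(1,2) E P(2) PB False])
          show "M = 4 * Cdyn / (l - 1) + 1" by (simp add: M_def Cdyn)
          show "\<rho> * A = \<rho> * (Cdyn / (l - 1) + M * Cdyn)" by (simp add: A_def Cdyn)
          show "\<rho> * A \<le> 1 / 8" by (rule \<rho>(4))
          show "Cdyn * \<rho> \<le> 1" using \<rho>(5) by (simp add: Cdyn)
          show "8 * (\<rho> * A) * (1 + C) = 8 * (\<rho> * A) * (1 + Cdyn)" by (simp add: Cdyn)
          show "8 * (\<rho> * A) * (1 + C) * real DIM('n phase) < 1" using \<rho>(6) by (simp add: d_def)
          show "real DIM('n phase) * (8 * (\<rho> * A) * (1 + C) * real DIM('n phase)) * measure lebesgue (ball (0 :: real^'n) 1) \<le> \<mu> / 2"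
            using \<rho>(7) by (simp add: d_def \<beta>_def)
        qed (use P in simp_all)
      qed
    qed
  qed
qed

end
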